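(* Let $(x_{i,j},y_{i,j})$ ($i=1,\dots,m$, $j=1,\dots,n$) be i.i.d. samples with $x_{i,j}\in\mathcal X\subset\mathbb R^d$, $\sup_{x\in\mathcal X}\|x\|_2\le B<\infty$, $y_{i,j}\in\{-1,1\}$. Let $\gamma>0$, $\varphi(t)=\log(1+e^{-t})$, $$\ell(w)=\frac1{mn}\sum_{i=1}^m\sum_{j=1}^n\varphi(y_{i,j}w^Tx_{i,j})+\frac\gamma2\|w\|_2^2,$$ and let $f=\eta\ell$ with $\eta=\frac{B^2}{4\gamma}$. Suppose the minimizer $w_\star$ of $f$ satisfies $\mathbb E[\|w_\star\|_2^2]\le D^2$ for some constant $D>0$. Then the number $T$ of communication rounds required by DiSCO (see context) applied to $f$ to find an $\epsilon$-optimal solution ($f(\widehat w)-f(w_\star)\le\epsilon$) is bounded by $$\mathbb E[T]=\widetilde{\mathcal O}\left(\Bigl(\log(1/\epsilon)+\frac{B^3D}{\gamma n^{1/2}}\Bigr)\Bigl(1+\frac{Bd^{1/4}}{\gamma^{1/2}n^{1/4}}\Bigr)\right),$$ where the expectation is over the i.i.d. data, and $\widetilde{\mathcal O}$ hides universal constants, logarithmic factors in the problem parameters other than $1/\epsilon$, and the factor $1+\frac{1}{\sqrt n}\frac{GD}{4V_0+2G^2/\lambda}$ with the constants listed in the context.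
   Context: Write $f=\frac1m\sum_if_i$ with $f_i(w)=\frac1n\sum_j\eta\varphi(y_{i,j}w^Tx_{i,j})+\frac\lambda2\|w\|_2^2$, $\lambda=\eta\gamma$. Constants: $V_0=\eta\log2$, $G=\eta B$, $L=\eta(B^2/4+\gamma)$, $M=\eta B^3/10$. DiSCO inputs: $\rho=\frac{\sqrt6G}{\sqrt nD}$ and $\mu=\min\bigl\{L,\sqrt{32L^2d/n}\,\sqrt{\log(1+rM\sqrt{2n}/L)+\log(md/\delta)/d}\bigr\}$ with $r=\bigl(\frac{2V_0}\lambda+\frac{2G}\lambda\sqrt{2V_0/\lambda}\bigr)^{1/2}$ and $\delta=\frac{GD}{\sqrt n}\frac{\sqrt{\lambda/(4L)}}{4V_0+2G^2/\lambda}$ (understood to lie in $(0,1)$). Setting: there are $m$ machines; machine $i$ holds $f_i$; machine 1 is the master. In one round of communication the master broadcasts a message of $O(d)$ size to all machines and aggregates (sums or averages) messages of $O(d)$ size returned by the machines. DiSCO, inputs $\rho,\mu\ge0$. Initialization (one round): $w_0=\frac1m\sum_{i=1}^m\widehat w_i$ with $\widehat w_i=\arg\min_w\{f_i(w)+\frac\rho2\|w\|_2^2\}$. For $k=0,1,2,\dots$: compute $v_k$ by distributed PCG at $w_k$ (below), set $\delta_k=\sqrt{v_k^Tf''(w_k)v_k}$ and $w_{k+1}=w_k-\frac1{1+\delta_k}v_k$. Distributed PCG at $w_k$: let $H=f''(w_k)$, $P=f_1''(w_k)+\mu I$, $\epsilon_k=\beta(\lambda/L)^{1/2}\|f'(w_k)\|_2$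 with $\beta=1/20$. One round forms $f'(w_k)$. Set $v^{(0)}=0$, $r^{(0)}=f'(w_k)$, $s^{(0)}=P^{-1}r^{(0)}$, $u^{(0)}=s^{(0)}$ (if $f'(w_k)=0$, return $v_k=0$). For $t=0,1,\dots$, each iteration using one round (to form $Hu^{(t)},Hv^{(t)}$): $\alpha_t=\frac{\langle r^{(t)},s^{(t)}\rangle}{\langle u^{(t)},Hu^{(t)}\rangle}$, $v^{(t+1)}=v^{(t)}+\alpha_tu^{(t)}$, $r^{(t+1)}=r^{(t)}-\alpha_tHu^{(t)}$, $s^{(t+1)}=P^{-1}r^{(t+1)}$, $\beta_t=\frac{\langle r^{(t+1)},s^{(t+1)}\rangle}{\langle r^{(t)},s^{(t)}\rangle}$, $u^{(t+1)}=s^{(t+1)}+\beta_tu^{(t)}$; stop as soon as $\|r^{(t+1)}\|_2\le\epsilon_k$ and return $v_k=v^{(t+1)}$. $T$ counts all rounds used (initialization plus all PCG calls) until the first iterate $\widehat w=w_k$ with the required accuracy is available. *)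

theory Defs
  imports
    "HOL-Probability.Probability"
    "Jordan_Normal_Form.Gauss_Jordan_Elimination"
begin

(* The hidden constants of the complexity bound are universal, in particular independent of the
   dimension d. Hence d must be quantified inside the formula, and vectors live in carrier_vec d
   instead of a type of fixed dimension. *)

hide_const (open) Finite_Cartesian_Product.vec Finite_Cartesian_Product.mat
no_notation Finite_Cartesian_Product.vec_nth (infixl \<open>$\<close> 90)

definition vec_norm :: "real vec \<Rightarrow> real" where
  "vec_norm v = sqrt (v \<bullet> v)"

definition gradient :: "nat \<Rightarrow> (real vec \<Rightarrow> real) \<Rightarrow> real vec \<Rightarrow> real vec" where
  "gradient d F w = vec d (\<lambda>i. deriv (\<lambda>s. F (w + s \<cdot>\<^sub>v unit_vec d i)) 0)"

definition hessian :: "nat \<Rightarrow> (real vec \<Rightarrow> real) \<Rightarrow> real vec \<Rightarrow> real mat" where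
  "hessian d F w =
     mat d d (\<lambda>(i, j). deriv (\<lambda>s. gradient d F (w + s \<cdot>\<^sub>v unit_vec d j) $ i) 0)"

definition minimizer :: "nat \<Rightarrow> (real vec \<Rightarrow> real) \<Rightarrow> real vec" where
  "minimizer d F = arg_min_on F (carrier_vec d)"

definition average_obj :: "nat \<Rightarrow> (nat \<Rightarrow> real vec \<Rightarrow> real) \<Rightarrow> real vec \<Rightarrow> real" where
  "average_obj m fs w = (1 / real m) * (\<Sum>i = 1..m. fs i w)"


subsection \<open>Distributed preconditioned conjugate gradient\<close>

(* pcg_state d H P g t is the tuple (v, r, s, u) after t iterations for the system H v = g with
   preconditioner P. The stopping rule is separate; after it has fired the states are never used. *)

primrec pcg_state ::
  "nat \<Rightarrow> real mat \<Rightarrow> real mat \<Rightarrow> real vec \<Rightarrow> nat \<Rightarrow> real vec \<times> real vec \<times> real vec \<times> real vec" where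
  "pcg_state d H P g 0 =
     (let s = the (mat_inverse P) *\<^sub>v g in (0\<^sub>v d, g, s, s))"
| "pcg_state d H P g (Suc t) =
     (let (v, r, s, u) = pcg_state d H P g t;
          a = (r \<bullet> s) / (u \<bullet> (H *\<^sub>v u));
          v' = v + a \<cdot>\<^sub>v u;
          r' = r - a \<cdot>\<^sub>v (H *\<^sub>v u);
          s' = the (mat_inverse P) *\<^sub>v r';
          b = (r' \<bullet> s') / (r \<bullet> s);
          u' = s' + b \<cdot>\<^sub>v u
      in (v', r', s', u'))"

definition pcg_iterate :: "nat \<Rightarrow> real mat \<Rightarrow> real mat \<Rightarrow> real vec \<Rightarrow> nat \<Rightarrow> real vec" where
  "pcg_iterate d H P g t = fst (pcg_state d H P g t)"

definition pcg_residual :: "nat \<Rightarrow> real mat \<Rightarrow> real mat \<Rightarrow> real vec \<Rightarrow> nat \<Rightarrow> real vec" where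
  "pcg_residual d H P g t = fst (snd (pcg_state d H P g t))"

definition pcg_stop :: "nat \<Rightarrow> real mat \<Rightarrow> real mat \<Rightarrow> real vec \<Rightarrow> real \<Rightarrow> nat \<Rightarrow> bool" where
  "pcg_stop d H P g tol t \<longleftrightarrow> vec_norm (pcg_residual d H P g (Suc t)) \<le> tol"

definition pcg_result :: "nat \<Rightarrow> real mat \<Rightarrow> real mat \<Rightarrow> real vec \<Rightarrow> real \<Rightarrow> real vec" where
  "pcg_result d H P g tol =
     (if g = 0\<^sub>v d then 0\<^sub>v d
      else pcg_iterate d H P g (Suc (LEAST t. pcg_stop d H P g tol t)))"

(* One round forms the gradient, and each PCG iteration takes one more; a run that never stops
   costs infinitely many rounds. *)
definition pcg_rounds :: "nat \<Rightarrow> real mat \<Rightarrow> real mat \<Rightarrow> real vec \<Rightarrow> real \<Rightarrow> enat" where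
  "pcg_rounds d H P g tol =
     (if g = 0\<^sub>v d then 1
      else if \<exists>t. pcg_stop d H P g tol t
        then 1 + enat (Suc (LEAST t. pcg_stop d H P g tol t))
      else \<infinity>)"


subsection \<open>DiSCO\<close>

definition disco_hess ::
  "nat \<Rightarrow> nat \<Rightarrow> (nat \<Rightarrow> real vec \<Rightarrow> real) \<Rightarrow> real vec \<Rightarrow> real mat" where
  "disco_hess d m fs w = hessian d (average_obj m fs) w"

definition disco_precond ::
  "nat \<Rightarrow> (nat \<Rightarrow> real vec \<Rightarrow> real) \<Rightarrow> real \<Rightarrow> real vec \<Rightarrow> real mat" where
  "disco_precond d fs \<mu> w = hessian d (fs 1) w + \<mu> \<cdot>\<^sub>m 1\<^sub>m d"

definition disco_grad ::
  "nat \<Rightarrow> nat \<Rightarrow> (nat \<Rightarrow> real vec \<Rightarrow> real) \<Rightarrow> real vec \<Rightarrow> real vec" where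
  "disco_grad d m fs w = gradient d (average_obj m fs) w"

definition disco_tol ::
  "nat \<Rightarrow> nat \<Rightarrow> (nat \<Rightarrow> real vec \<Rightarrow> real) \<Rightarrow> real \<Rightarrow> real \<Rightarrow> real vec \<Rightarrow> real" where
  "disco_tol d m fs lam L w = (1 / 20) * sqrt (lam / L) * vec_norm (disco_grad d m fs w)"

definition disco_dir ::
  "nat \<Rightarrow> nat \<Rightarrow> (nat \<Rightarrow> real vec \<Rightarrow> real) \<Rightarrow> real \<Rightarrow> real \<Rightarrow> real \<Rightarrow> real vec \<Rightarrow> real vec" where
  "disco_dir d m fs lam L \<mu> w =
     pcg_result d (disco_hess d m fs w) (disco_precond d fs \<mu> w) (disco_grad d m fs w)
       (disco_tol d m fs lam L w)"

definition disco_pcg_rounds ::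
  "nat \<Rightarrow> nat \<Rightarrow> (nat \<Rightarrow> real vec \<Rightarrow> real) \<Rightarrow> real \<Rightarrow> real \<Rightarrow> real \<Rightarrow> real vec \<Rightarrow> enat" where
  "disco_pcg_rounds d m fs lam L \<mu> w =
     pcg_rounds d (disco_hess d m fs w) (disco_precond d fs \<mu> w) (disco_grad d m fs w)
       (disco_tol d m fs lam L w)"

definition disco_init ::
  "nat \<Rightarrow> nat \<Rightarrow> (nat \<Rightarrow> real vec \<Rightarrow> real) \<Rightarrow> real \<Rightarrow> real vec" where
  "disco_init d m fs \<rho> =
     vec d (\<lambda>k. (1 / real m) *
       (\<Sum>i = 1..m. minimizer d (\<lambda>w. fs i w + \<rho> / 2 * (vec_norm w)\<^sup>2) $ k))"

primrec disco_iterate ::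
  "nat \<Rightarrow> nat \<Rightarrow> (nat \<Rightarrow> real vec \<Rightarrow> real) \<Rightarrow> real \<Rightarrow> real \<Rightarrow> real \<Rightarrow> real \<Rightarrow> nat \<Rightarrow> real vec" where
  "disco_iterate d m fs lam L \<rho> \<mu> 0 = disco_init d m fs \<rho>"
| "disco_iterate d m fs lam L \<rho> \<mu> (Suc k) =
     (let w = disco_iterate d m fs lam L \<rho> \<mu> k;
          v = disco_dir d m fs lam L \<mu> w;
          \<delta>k = sqrt (v \<bullet> (disco_hess d m fs w *\<^sub>v v))
      in w - (1 / (1 + \<delta>k)) \<cdot>\<^sub>v v)"

definition disco_rounds_upto ::
  "nat \<Rightarrow> nat \<Rightarrow> (nat \<Rightarrow> real vec \<Rightarrow> real) \<Rightarrow> real \<Rightarrow> real \<Rightarrow> real \<Rightarrow> real \<Rightarrow> nat \<Rightarrow> enat" where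
  "disco_rounds_upto d m fs lam L \<rho> \<mu> k =
     1 + (\<Sum>j<k. disco_pcg_rounds d m fs lam L \<mu> (disco_iterate d m fs lam L \<rho> \<mu> j))"

definition disco_accurate ::
  "nat \<Rightarrow> nat \<Rightarrow> (nat \<Rightarrow> real vec \<Rightarrow> real) \<Rightarrow> real \<Rightarrow> real \<Rightarrow> real \<Rightarrow> real \<Rightarrow> real \<Rightarrow> nat \<Rightarrow> bool" where
  "disco_accurate d m fs lam L \<rho> \<mu> \<epsilon> k \<longleftrightarrow>
     average_obj m fs (disco_iterate d m fs lam L \<rho> \<mu> k)
       - average_obj m fs (minimizer d (average_obj m fs)) \<le> \<epsilon>"

definition disco_total_rounds ::
  "nat \<Rightarrow> nat \<Rightarrow> (nat \<Rightarrow> real vec \<Rightarrow> real) \<Rightarrow> real \<Rightarrow> real \<Rightarrow> real \<Rightarrow> real \<Rightarrow> real \<Rightarrow> enat" where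
  "disco_total_rounds d m fs lam L \<rho> \<mu> \<epsilon> =
     (if \<exists>k. disco_accurate d m fs lam L \<rho> \<mu> \<epsilon> k
      then disco_rounds_upto d m fs lam L \<rho> \<mu> (LEAST k. disco_accurate d m fs lam L \<rho> \<mu> \<epsilon> k)
      else \<infinity>)"


subsection \<open>Regularized logistic regression\<close>

(* A sample is a pair (x, y) with x given by its coordinates; z (i, j) is the j-th sample held by
   machine i. *)

type_synonym sample = "(nat \<Rightarrow> real) \<times> real"

definition sample_space :: "nat \<Rightarrow> sample measure" where
  "sample_space d = (\<Pi>\<^sub>M k\<in>{..<d}. borel) \<Otimes>\<^sub>M borel"

definition data_measure :: "nat \<Rightarrow> nat \<Rightarrow> sample measure \<Rightarrow> (nat \<times> nat \<Rightarrow> sample) measure" where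
  "data_measure m n Q = (\<Pi>\<^sub>M ij\<in>{1..m} \<times> {1..n}. Q)"

definition feature :: "nat \<Rightarrow> sample \<Rightarrow> real vec" where
  "feature d s = vec d (fst s)"

definition label :: "sample \<Rightarrow> real" where
  "label s = snd s"

definition logistic :: "real \<Rightarrow> real" where
  "logistic t = ln (1 + exp (- t))"

definition erm_loss ::
  "nat \<Rightarrow> nat \<Rightarrow> nat \<Rightarrow> real \<Rightarrow> (nat \<times> nat \<Rightarrow> sample) \<Rightarrow> real vec \<Rightarrow> real" where
  "erm_loss d m n \<gamma> z w =
     1 / (real m * real n) *
       (\<Sum>i = 1..m. \<Sum>j = 1..n. logistic (label (z (i, j)) * (w \<bullet> feature d (z (i, j)))))
     + \<gamma> / 2 * (vec_norm w)\<^sup>2"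

definition scale_eta :: "real \<Rightarrow> real \<Rightarrow> real" where
  "scale_eta B \<gamma> = B\<^sup>2 / (4 * \<gamma>)"

definition const_lambda :: "real \<Rightarrow> real \<Rightarrow> real" where
  "const_lambda B \<gamma> = scale_eta B \<gamma> * \<gamma>"

definition local_loss ::
  "nat \<Rightarrow> nat \<Rightarrow> real \<Rightarrow> real \<Rightarrow> (nat \<times> nat \<Rightarrow> sample) \<Rightarrow> nat \<Rightarrow> real vec \<Rightarrow> real" where
  "local_loss d n B \<gamma> z i w =
     1 / real n *
       (\<Sum>j = 1..n. scale_eta B \<gamma> * logistic (label (z (i, j)) * (w \<bullet> feature d (z (i, j)))))
     + const_lambda B \<gamma> / 2 * (vec_norm w)\<^sup>2"

lemma average_local_loss:
  assumes "m \<ge> 1"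
  shows "average_obj m (local_loss d n B \<gamma> z) w = scale_eta B \<gamma> * erm_loss d m n \<gamma> z w"
proof -
  let ?S = "\<lambda>i. \<Sum>j = 1..n. logistic (label (z (i, j)) * (w \<bullet> feature d (z (i, j))))"
  let ?e = "scale_eta B \<gamma>"
  have "average_obj m (local_loss d n B \<gamma> z) w =
      1 / real m * ((\<Sum>i = 1..m. ?e / real n * ?S i) + real m * (?e * \<gamma> / 2 * (vec_norm w)\<^sup>2))"
    by (simp add: average_obj_def local_loss_def const_lambda_def sum.distrib flip: sum_distrib_left)
  also have "(\<Sum>i = 1..m. ?e / real n * ?S i) = ?e / real n * (\<Sum>i = 1..m. ?S i)"
    by (rule sum_distrib_left [symmetric])
  finally show ?thesis
    using assms by (simp add: erm_loss_def distrib_left)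
qed

definition erm_minimizer ::
  "nat \<Rightarrow> nat \<Rightarrow> nat \<Rightarrow> real \<Rightarrow> real \<Rightarrow> (nat \<times> nat \<Rightarrow> sample) \<Rightarrow> real vec" where
  "erm_minimizer d m n B \<gamma> z = minimizer d (\<lambda>w. scale_eta B \<gamma> * erm_loss d m n \<gamma> z w)"

definition const_V0 :: "real \<Rightarrow> real \<Rightarrow> real" where
  "const_V0 B \<gamma> = scale_eta B \<gamma> * ln 2"

definition const_G :: "real \<Rightarrow> real \<Rightarrow> real" where
  "const_G B \<gamma> = scale_eta B \<gamma> * B"

definition const_L :: "real \<Rightarrow> real \<Rightarrow> real" where
  "const_L B \<gamma> = scale_eta B \<gamma> * (B\<^sup>2 / 4 + \<gamma>)"

definition const_M :: "real \<Rightarrow> real \<Rightarrow> real" where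
  "const_M B \<gamma> = scale_eta B \<gamma> * B ^ 3 / 10"

definition const_r :: "real \<Rightarrow> real \<Rightarrow> real" where
  "const_r B \<gamma> =
     (let V = const_V0 B \<gamma>; G = const_G B \<gamma>; l = const_lambda B \<gamma>
      in sqrt (2 * V / l + 2 * G / l * sqrt (2 * V / l)))"

definition const_delta :: "nat \<Rightarrow> real \<Rightarrow> real \<Rightarrow> real \<Rightarrow> real" where
  "const_delta n B \<gamma> D =
     (let V = const_V0 B \<gamma>; G = const_G B \<gamma>; l = const_lambda B \<gamma>; L = const_L B \<gamma>
      in G * D / sqrt (real n) * (sqrt (l / (4 * L)) / (4 * V + 2 * G\<^sup>2 / l)))"

definition const_rho :: "nat \<Rightarrow> real \<Rightarrow> real \<Rightarrow> real \<Rightarrow> real" where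
  "const_rho n B \<gamma> D = sqrt 6 * const_G B \<gamma> / (sqrt (real n) * D)"

definition const_mu :: "nat \<Rightarrow> nat \<Rightarrow> nat \<Rightarrow> real \<Rightarrow> real \<Rightarrow> real \<Rightarrow> real" where
  "const_mu d m n B \<gamma> D =
     (let L = const_L B \<gamma>; M = const_M B \<gamma>; r = const_r B \<gamma>; \<delta> = const_delta n B \<gamma> D
      in min L
           (sqrt (32 * L\<^sup>2 * real d / real n) *
            sqrt (ln (1 + r * M * sqrt (2 * real n) / L) + ln (real m * real d / \<delta>) / real d)))"

definition comm_rounds ::
  "nat \<Rightarrow> nat \<Rightarrow> nat \<Rightarrow> real \<Rightarrow> real \<Rightarrow> real \<Rightarrow> real \<Rightarrow> (nat \<times> nat \<Rightarrow> sample) \<Rightarrow> enat" where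
  "comm_rounds d m n B \<gamma> D \<epsilon> z =
     disco_total_rounds d m (local_loss d n B \<gamma> z) (const_lambda B \<gamma>) (const_L B \<gamma>)
       (const_rho n B \<gamma> D) (const_mu d m n B \<gamma> D) \<epsilon>"


subsection \<open>Quantities hidden in the soft-O bound\<close>

(* A power of log_factor dominates every product of logarithms of (monomials in) the problem
   parameters; the accuracy does not occur in it. *)
definition log_factor :: "nat \<Rightarrow> nat \<Rightarrow> nat \<Rightarrow> real \<Rightarrow> real \<Rightarrow> real \<Rightarrow> real" where
  "log_factor d m n B \<gamma> D =
     1 + ln (real d) + ln (real m) + ln (real n) + \<bar>ln B\<bar> + \<bar>ln \<gamma>\<bar> + \<bar>ln D\<bar>"

definition hidden_factor :: "nat \<Rightarrow> real \<Rightarrow> real \<Rightarrow> real \<Rightarrow> real" where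
  "hidden_factor n B \<gamma> D =
     1 + 1 / sqrt (real n) *
       (const_G B \<gamma> * D / (4 * const_V0 B \<gamma> + 2 * (const_G B \<gamma>)\<^sup>2 / const_lambda B \<gamma>))"

(* As usual under an O, log (1 / accuracy) is read as bounded below by a positive constant, so that
   the bound also makes sense for accuracies near or above 1: at least one round is always used. *)
definition rounds_rate :: "nat \<Rightarrow> nat \<Rightarrow> real \<Rightarrow> real \<Rightarrow> real \<Rightarrow> real \<Rightarrow> real" where
  "rounds_rate d n B \<gamma> D \<epsilon> =
     (max 1 (ln (1 / \<epsilon>)) + B ^ 3 * D / (\<gamma> * real n powr (1 / 2))) *
     (1 + B * real d powr (1 / 4) / (\<gamma> powr (1 / 2) * real n powr (1 / 4)))"

end

theory Submission
  imports Defs "Jordan_Normal_Form.Determinant"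
begin

text \<open>
  The number of rounds is at most the number of Newton steps times the length of one run of the
  conjugate gradient method.

  Newton steps: the logistic function satisfies \<open>\<phi>''(t + s) \<le> exp \<bar>s\<bar> \<phi>''(t)\<close>, and the scaling
  \<open>\<eta> = B\<^sup>2 / (4 \<gamma>)\<close>, that is \<open>B\<^sup>2 = 4 \<lambda>\<close>, bounds the inner product of a sample with a step by twice
  the local norm of the step. Hence an inexact damped step either lowers the objective by a constant or
  contracts the optimality gap by a constant factor, and the number of steps is at most a constant
  times the initial gap plus \<open>log (1 / \<epsilon>)\<close>.

  Conjugate gradients: the iterates are optimal over Krylov spaces, hence at least as good as
  Nesterov's accelerated method run in the geometry of the preconditioner, which lives in the same
  spaces; this gives the square root of the condition number without spectral theory. Hoeffding's
  inequality on a grid of points and directions bounds the distance between the first local Hessian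
  and the average one, so the condition number is at most \<open>(1 + (B\<^sup>2 / \<gamma>) sqrt (d / n))\<close> up to
  logarithms, except on an event whose probability is so small (polynomially in the parameters) that
  the trivial bounds on the number of steps and on the condition number suffice there.

  Initial gap: exchanging one sample between two machines preserves the law of the data, so by
  stability of regularized minimizers a local minimizer is in the mean almost as good for the other
  machines as for its own. With the given \<open>\<rho>\<close> the expected initial gap is at most a constant times
  \<open>G D / sqrt n\<close>.
\<close>

text \<open>The prescribed \<mu> is never shown to dominate the distance \<Delta> between the two
  Hessians, because Hoeffding's inequality on a grid yields constants and logarithms of its own. The
  condition number is therefore kept in the form (1 + (\<Delta> + \<mu>) / \<lambda>) (1 + \<Delta>
  / (\<lambda> + \<mu>)), and \<Delta> is compared with \<lambda> + \<mu>; here \<delta> < 1 keeps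
  the second logarithm inside \<mu> nonnegative. Uniformity over points is possible because no step
  increases f, so that all iterates stay in a ball whose radius depends on the constants only. The
  failure probability is the reciprocal of the price paid on the bad event: L / \<lambda> for the
  crude condition number, times 1 + F0, where F0 bounds the initial gap. Measurability of the round
  count is part of the claim, on the whole sample space and not only where the data are bounded. The
  count involves matrix inverses, arg-mins given by a choice operator, and stopping indices. Hence
  inverses are written by Cramer's rule, minimizers as limits of explicit gradient descent, and
  stopped quantities are glued from countably many measurable pieces.\<close>

unbundle no inner_syntax

subsection \<open>The logistic function\<close>

definition logistic1 :: "real \<Rightarrow> real" where
  "logistic1 t = - 1 / (1 + exp t)"

definition logistic2 :: "real \<Rightarrow> real" where
  "logistic2 t = exp t / (1 + exp t)\<^sup>2"

lemma one_plus_exp_pos: "1 + exp (t::real) > 0" "1 + exp (t::real) \<noteq> 0"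
proof -
  show "1 + exp t > 0" by (intro add_pos_pos) auto
  thus "1 + exp t \<noteq> 0" by linarith
qed

lemma logistic_DERIV [derivative_intros]:
  assumes "(g has_real_derivative g') (at x within S)"
  shows "((\<lambda>x. logistic (g x)) has_real_derivative logistic1 (g x) * g') (at x within S)"
proof -
  have "(logistic has_real_derivative logistic1 t) (at t)" for t
  proof -
    have "(logistic has_real_derivative - exp (- t) / (1 + exp (- t))) (at t)"
      unfolding logistic_def
      by (auto intro!: derivative_eq_intros simp: one_plus_exp_pos)
    moreover have "- exp (- t) / (1 + exp (- t)) = logistic1 t"
      by (simp add: logistic1_def exp_minus field_simps one_plus_exp_pos)
    ultimately show ?thesis by simp
  qed
  from DERIV_chain2[OF this assms] show ?thesis .
qed

lemma logistic1_DERIV [derivative_intros]: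
  assumes "(g has_real_derivative g') (at x within S)"
  shows "((\<lambda>x. logistic1 (g x)) has_real_derivative logistic2 (g x) * g') (at x within S)"
proof -
  have "(logistic1 has_real_derivative logistic2 t) (at t)" for t
    unfolding logistic1_def logistic2_def
    by (auto intro!: derivative_eq_intros simp: one_plus_exp_pos power2_eq_square)
  from DERIV_chain2[OF this assms] show ?thesis .
qed

lemma logistic_nonneg: "0 \<le> logistic t"
  by (simp add: logistic_def)

lemma logistic_zero: "logistic 0 = ln 2"
  by (simp add: logistic_def)

lemma abs_logistic1_le: "\<bar>logistic1 t\<bar> \<le> 1"
  using exp_gt_zero[of t] by (simp add: logistic1_def abs_div_pos one_plus_exp_pos divide_le_eq)

lemma logistic2_pos: "0 < logistic2 t"
  by (simp add: logistic2_def one_plus_exp_pos)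

lemma logistic2_le: "logistic2 t \<le> 1 / 4"
proof -
  have "4 * exp t \<le> (1 + exp t)\<^sup>2"
    using zero_le_power2[of "1 - exp t"] by (simp add: power2_eq_square algebra_simps)
  thus ?thesis by (simp add: logistic2_def one_plus_exp_pos field_simps)
qed

text \<open>With a = e^t and b = e^s the quotient of the two curvatures is b ((1 + a) / (1 + a
  b))^2. For b >= 1 the bracket is at most 1, for b <= 1 it is at most 1 / b; either way the
  quotient is at most e^|s|. This is the self-concordance on which the Newton analysis
  rests.\<close>

lemma logistic2_ratio: "logistic2 (t + s) \<le> exp \<bar>s\<bar> * logistic2 t"
proof -
  define a b where "a = exp t" and "b = exp s"
  have ab: "a > 0" "b > 0" by (simp_all add: a_def b_def)
  have pos: "1 + a > 0" "1 + a * b > 0" using ab by (auto intro: add_pos_pos)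
  have l: "logistic2 (t + s) = a * b / (1 + a * b)\<^sup>2" "logistic2 t = a / (1 + a)\<^sup>2"
    by (simp_all add: logistic2_def a_def b_def exp_add)
  show ?thesis
  proof (cases "s \<ge> 0")
    case True
    hence "b \<ge> 1" by (simp add: b_def)
    hence "1 + a \<le> 1 + a * b" using ab by simp
    hence "(1 + a)\<^sup>2 \<le> (1 + a * b)\<^sup>2" using pos by (intro power_mono) auto
    hence "a * b / (1 + a * b)\<^sup>2 \<le> a * b / (1 + a)\<^sup>2"
      using pos ab by (intro divide_left_mono) auto
    thus ?thesis using True by (simp add: l b_def mult.commute)
  next
    case False
    hence b1: "b \<le> 1" by (simp add: b_def)
    hence "b * (1 + a) \<le> 1 + a * b" using ab by (simp add: algebra_simps)
    hence "(b * (1 + a))\<^sup>2 \<le> (1 + a * b)\<^sup>2" using pos ab by (intro power_mono) auto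
    hence "a * b / (1 + a * b)\<^sup>2 \<le> a * b / (b * (1 + a))\<^sup>2"
      using pos ab by (intro divide_left_mono) auto
    also have "\<dots> = inverse b * (a / (1 + a)\<^sup>2)"
      using ab(2) by (simp add: power_mult_distrib power2_eq_square divide_inverse mult.assoc)
    finally show ?thesis using False by (simp add: l b_def exp_minus)
  qed
qed

lemma logistic2_ratio_lower: "exp (- \<bar>s\<bar>) * logistic2 t \<le> logistic2 (t + s)"
proof -
  have "logistic2 t \<le> exp \<bar>s\<bar> * logistic2 (t + s)"
    using logistic2_ratio[of "t + s" "- s"] by simp
  thus ?thesis by (simp add: exp_minus field_simps)
qed

section \<open>Taylor remainders of the logistic function from its second derivative\<close>

lemma nonneg_of_second_deriv:
  fixes F :: "real \<Rightarrow> real"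
  assumes "F 0 = 0" "F' 0 = 0"
    and "\<And>x. (F has_real_derivative F' x) (at x)"
    and "\<And>x. (F' has_real_derivative F'' x) (at x)"
    and "\<And>x. x \<ge> 0 \<Longrightarrow> F'' x \<ge> 0"
    and "s \<ge> 0"
  shows "F s \<ge> 0"
proof -
  have "F' x \<ge> 0" if "x \<ge> 0" for x
    using DERIV_nonneg_imp_nondecreasing[of 0 x F'] assms that by auto
  thus ?thesis
    using DERIV_nonneg_imp_nondecreasing[of 0 s F] assms by auto
qed

text \<open>Comes from integrating the two ratio bounds for \<open>logistic2\<close> twice along the
  ray from \<open>t\<close> to \<open>t + s\<close>. The sign \<sigma> of \<open>s\<close> is split
  off so that one argument on x >= 0 covers both directions.\<close>

lemma logistic_taylor_exp:
  shows "logistic (t + s) \<le> logistic t + logistic1 t * s + logistic2 t * (exp \<bar>s\<bar> - \<bar>s\<bar> - 1)"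
    and "logistic t + logistic1 t * s + logistic2 t * (exp (- \<bar>s\<bar>) + \<bar>s\<bar> - 1) \<le> logistic (t + s)"
proof -
  define \<sigma> :: real where "\<sigma> = (if s \<ge> 0 then 1 else - 1)"
  have s: "s = \<sigma> * \<bar>s\<bar>" "\<sigma> * \<sigma> = 1" "\<bar>\<sigma>\<bar> = 1" by (auto simp: \<sigma>_def)
  have abs: "\<bar>\<sigma> * x\<bar> = x" if "x \<ge> 0" for x using that s(3) by (simp add: abs_mult)
  have "0 \<le> logistic t + logistic1 t * (\<sigma> * \<bar>s\<bar>) + logistic2 t * (exp \<bar>s\<bar> - \<bar>s\<bar> - 1)
      - logistic (t + \<sigma> * \<bar>s\<bar>)"
  proof (rule nonneg_of_second_deriv[where
        F = "\<lambda>x. logistic t + logistic1 t * (\<sigma> * x) + logistic2 t * (exp x - x - 1)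
          - logistic (t + \<sigma> * x)" and
        F' = "\<lambda>x. logistic1 t * \<sigma> + logistic2 t * (exp x - 1) - logistic1 (t + \<sigma> * x) * \<sigma>" and
        F'' = "\<lambda>x. logistic2 t * exp x - logistic2 (t + \<sigma> * x) * (\<sigma> * \<sigma>)"])
    show "0 \<le> logistic2 t * exp x - logistic2 (t + \<sigma> * x) * (\<sigma> * \<sigma>)" if "x \<ge> 0" for x
      using logistic2_ratio[of t "\<sigma> * x"] abs[OF that] s(2) by (simp add: mult.commute)
  qed (auto intro!: derivative_eq_intros simp: algebra_simps)
  thus "logistic (t + s) \<le> logistic t + logistic1 t * s + logistic2 t * (exp \<bar>s\<bar> - \<bar>s\<bar> - 1)"
    using s(1) by simp
  have "0 \<le> logistic (t + \<sigma> * \<bar>s\<bar>) -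
      (logistic t + logistic1 t * (\<sigma> * \<bar>s\<bar>) + logistic2 t * (exp (- \<bar>s\<bar>) + \<bar>s\<bar> - 1))"
  proof (rule nonneg_of_second_deriv[where
        F = "\<lambda>x. logistic (t + \<sigma> * x) -
          (logistic t + logistic1 t * (\<sigma> * x) + logistic2 t * (exp (- x) + x - 1))" and
        F' = "\<lambda>x. logistic1 (t + \<sigma> * x) * \<sigma> - logistic1 t * \<sigma> - logistic2 t * (1 - exp (- x))" and
        F'' = "\<lambda>x. logistic2 (t + \<sigma> * x) * (\<sigma> * \<sigma>) - logistic2 t * exp (- x)"])
    show "0 \<le> logistic2 (t + \<sigma> * x) * (\<sigma> * \<sigma>) - logistic2 t * exp (- x)" if "x \<ge> 0" for x
      using logistic2_ratio_lower[of "\<sigma> * x" t] abs[OF that] s(2) by (simp add: mult.commute)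
  qed (auto intro!: derivative_eq_intros simp: algebra_simps)
  thus "logistic t + logistic1 t * s + logistic2 t * (exp (- \<bar>s\<bar>) + \<bar>s\<bar> - 1) \<le> logistic (t + s)"
    using s(1) by simp
qed

text \<open>Pade bounds for the exponential turn the Taylor remainders into rational functions.\<close>

lemma exp_minus_ge_pade:
  fixes s :: real assumes "s \<ge> 0"
  shows "2 - s \<le> (2 + s) * exp (- s)"
proof -
  have "0 \<le> (2 + s) * exp (- s) - (2 - s)"
  proof (rule nonneg_of_second_deriv[where
        F = "\<lambda>s. (2 + s) * exp (- s) - (2 - s)" and
        F' = "\<lambda>s. exp (- s) - (2 + s) * exp (- s) + 1" and
        F'' = "\<lambda>s. s * exp (- s)"])
  qed (use assms in \<open>auto intro!: derivative_eq_intros simp: algebra_simps\<close>)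
  thus ?thesis by simp
qed

lemma logistic_taylor_upper:
  assumes "\<bar>s\<bar> < 2"
  shows "logistic (t + s) \<le> logistic t + logistic1 t * s + logistic2 t * (s\<^sup>2 / (2 - \<bar>s\<bar>))"
proof -
  have "(2 - \<bar>s\<bar>) * exp \<bar>s\<bar> \<le> 2 + \<bar>s\<bar>"
    using mult_right_mono[OF exp_minus_ge_pade[of "\<bar>s\<bar>"], of "exp \<bar>s\<bar>"]
    by (simp add: mult.assoc flip: exp_add)
  hence "exp \<bar>s\<bar> - \<bar>s\<bar> - 1 \<le> s\<^sup>2 / (2 - \<bar>s\<bar>)"
    using assms by (simp add: field_simps power2_eq_square)
  from mult_left_mono[OF this, of "logistic2 t"] logistic_taylor_exp(1)[of t s] logistic2_pos[of t]
  show ?thesis by linarith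
qed

lemma logistic_taylor_lower:
  "logistic t + logistic1 t * s + logistic2 t * (s\<^sup>2 / (2 + \<bar>s\<bar>)) \<le> logistic (t + s)"
proof -
  have "s\<^sup>2 / (2 + \<bar>s\<bar>) \<le> exp (- \<bar>s\<bar>) + \<bar>s\<bar> - 1"
    using exp_minus_ge_pade[of "\<bar>s\<bar>"] by (simp add: field_simps power2_eq_square)
  from mult_left_mono[OF this, of "logistic2 t"] logistic_taylor_exp(2)[of t s] logistic2_pos[of t]
  show ?thesis by linarith
qed

lemma logistic_above_tangent: "logistic t + logistic1 t * (s - t) \<le> logistic s"
proof -
  have "0 \<le> logistic2 t * ((s - t)\<^sup>2 / (2 + \<bar>s - t\<bar>))"
    using logistic2_pos[of t] by (intro mult_nonneg_nonneg divide_nonneg_nonneg) auto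
  with logistic_taylor_lower[of t "s - t"] show ?thesis by simp
qed

lemma lipschitz_of_deriv_bound:
  fixes F :: "real \<Rightarrow> real"
  assumes "\<And>x. (F has_real_derivative F' x) (at x)" "\<And>x. \<bar>F' x\<bar> \<le> K"
  shows "\<bar>F s - F t\<bar> \<le> K * \<bar>s - t\<bar>"
  using field_differentiable_bound[of UNIV F F' K s t] assms
  by (auto simp: dist_norm has_field_derivative_at_within)

lemma logistic_lipschitz: "\<bar>logistic s - logistic t\<bar> \<le> \<bar>s - t\<bar>"
  using lipschitz_of_deriv_bound[of logistic logistic1 1 s t] logistic_DERIV[OF DERIV_ident]
    abs_logistic1_le by auto

lemma logistic1_lipschitz: "\<bar>logistic1 s - logistic1 t\<bar> \<le> 1 / 4 * \<bar>s - t\<bar>"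
  using lipschitz_of_deriv_bound[of logistic1 logistic2 "1/4" s t] logistic1_DERIV[OF DERIV_ident]
    logistic2_le logistic2_pos by (auto simp: abs_of_pos)

text \<open>The derivative is \<open>logistic2 x\<close> times (1 - e^x) / (1 + e^x), and both
  factors are at most 1 in absolute value. This modulus of continuity lets arbitrary points
  \<open>w\<close> be replaced by grid points.\<close>

lemma logistic2_lipschitz: "\<bar>logistic2 s - logistic2 t\<bar> \<le> \<bar>s - t\<bar>"
proof -
  have d: "(logistic2 has_real_derivative logistic2 x * ((1 - exp x) / (1 + exp x))) (at x)" for x
  proof -
    define a where "a = exp x"
    have a: "1 + a > 0" "1 + a \<noteq> 0" using one_plus_exp_pos[of x] by (auto simp: a_def)
    have "(logistic2 has_real_derivative
        (exp x * (1 + exp x)\<^sup>2 - exp x * (2 * (1 + exp x) * exp x)) / ((1 + exp x)\<^sup>2 * (1 + exp x)\<^sup>2)) (at x)"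
      unfolding logistic2_def
      by (auto intro!: derivative_eq_intros simp: one_plus_exp_pos power2_eq_square)
    also have "(exp x * (1 + exp x)\<^sup>2 - exp x * (2 * (1 + exp x) * exp x)) / ((1 + exp x)\<^sup>2 * (1 + exp x)\<^sup>2)
        = a * ((1 + a) * (1 - a)) / ((1 + a) * ((1 + a) * ((1 + a) * (1 + a))))"
      by (simp add: a_def power2_eq_square algebra_simps)
    also have "\<dots> = a / (1 + a)\<^sup>2 * ((1 - a) / (1 + a))"
      using a by (simp add: power2_eq_square)
    finally show ?thesis by (simp add: logistic2_def[abs_def] a_def)
  qed
  have "\<bar>logistic2 x * ((1 - exp x) / (1 + exp x))\<bar> \<le> 1" for x
  proof -
    have "\<bar>1 - exp x\<bar> \<le> 1 + exp x" by (simp add: abs_le_iff)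
    hence "\<bar>(1 - exp x) / (1 + exp x)\<bar> \<le> 1"
      using one_plus_exp_pos[of x] by (simp add: abs_divide)
    moreover have "\<bar>logistic2 x\<bar> \<le> 1" using logistic2_le[of x] logistic2_pos[of x] by simp
    ultimately show ?thesis unfolding abs_mult by (intro mult_le_one) auto
  qed
  from lipschitz_of_deriv_bound[OF d this] show ?thesis by simp
qed

subsection \<open>Energy forms\<close>

text \<open>Instantiated by the Hessian at a point, by the system operator and by the
  preconditioner, so that Cauchy-Schwarz and the triangle inequality are proved once for all these
  norms.\<close>

locale psd_form =
  fixes b :: "'a::real_vector \<Rightarrow> 'a \<Rightarrow> real"
  assumes add_left: "b (u + v) w = b u w + b v w"
    and scale_left: "b (k *\<^sub>R u) w = k * b u w"
    and sym: "b u v = b v u"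
    and nonneg: "0 \<le> b v v"
begin

lemma add_right: "b w (u + v) = b w u + b w v"
  using add_left sym by metis

lemma scale_right: "b w (k *\<^sub>R u) = k * b w u"
  using scale_left sym by metis

lemma minus_left: "b (- u) w = - b u w"
  using scale_left[of "-1" u w] by simp

lemma minus_right: "b w (- u) = - b w u"
  using scale_right[of w "-1" u] by simp

lemma diff_left: "b (u - v) w = b u w - b v w"
  using add_left[of u "- v" w] by (simp add: minus_left)

lemma diff_right: "b w (u - v) = b w u - b w v"
  using add_right[of w u "- v"] by (simp add: minus_right)

lemmas expand = add_left add_right scale_left scale_right minus_left minus_right diff_left diff_right

definition enorm :: "'a \<Rightarrow> real" where
  "enorm v = sqrt (b v v)"

lemma enorm_nonneg: "0 \<le> enorm v"
  by (simp add: enorm_def nonneg)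

lemma enorm_sq: "(enorm v)\<^sup>2 = b v v"
  by (simp add: enorm_def nonneg)

lemma enorm_scale: "enorm (k *\<^sub>R v) = \<bar>k\<bar> * enorm v"
proof -
  have "b (k *\<^sub>R v) (k *\<^sub>R v) = k\<^sup>2 * b v v"
    by (simp add: expand power2_eq_square)
  thus ?thesis by (simp add: enorm_def real_sqrt_mult)
qed

lemma enorm_minus: "enorm (- v) = enorm v"
  by (simp add: enorm_def expand)

lemma cauchy_schwarz_sq: "(b u v)\<^sup>2 \<le> b u u * b v v"
proof (cases "b v v = 0")
  case True
  have "b u v = 0"
  proof (rule ccontr)
    assume ne: "b u v \<noteq> 0"
    \<comment> \<open>With b(v, v) = 0 the form at u + t v is affine in t; this t makes it equal to
      -1.\<close>
    define t where "t = - (b u u + 1) / (2 * b u v)"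
    have "0 \<le> b (u + t *\<^sub>R v) (u + t *\<^sub>R v)" by (rule nonneg)
    also have "\<dots> = b u u + 2 * (t * b u v)" using True by (simp add: expand sym[of v u])
    also have "2 * (t * b u v) = - (b u u + 1)" using ne by (simp add: t_def)
    finally show False by simp
  qed
  thus ?thesis using True by simp
next
  case False
  hence pos: "b v v > 0" using nonneg[of v] by simp
  define t where "t = - b u v / b v v"
  have "0 \<le> b (u + t *\<^sub>R v) (u + t *\<^sub>R v)" by (rule nonneg)
  also have "\<dots> = b u u + 2 * t * b u v + t\<^sup>2 * b v v"
    by (simp add: expand sym[of v u] power2_eq_square algebra_simps)
  also have "\<dots> = b u u - (b u v)\<^sup>2 / b v v"
    using pos by (simp add: t_def field_simps power2_eq_square)
  finally show ?thesis using pos by (simp add: field_simps)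
qed

lemma cauchy_schwarz: "\<bar>b u v\<bar> \<le> enorm u * enorm v"
  using real_sqrt_le_mono[OF cauchy_schwarz_sq[of u v]]
  by (simp add: enorm_def real_sqrt_mult)

lemma enorm_triangle: "enorm (u + v) \<le> enorm u + enorm v"
proof (rule power2_le_imp_le)
  have "(enorm (u + v))\<^sup>2 = (enorm u)\<^sup>2 + 2 * b u v + (enorm v)\<^sup>2"
    by (simp add: enorm_sq expand sym[of v u])
  also have "\<dots> \<le> (enorm u)\<^sup>2 + 2 * (enorm u * enorm v) + (enorm v)\<^sup>2"
    using cauchy_schwarz[of u v] by linarith
  also have "\<dots> = (enorm u + enorm v)\<^sup>2"
    by (simp add: power2_eq_square algebra_simps)
  finally show "(enorm (u + v))\<^sup>2 \<le> (enorm u + enorm v)\<^sup>2" .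
qed (simp add: enorm_nonneg)

end


subsection \<open>Regularized logistic objectives\<close>

text \<open>Labels are absorbed into the vectors \<open>a j\<close>. One definition serves the local
  loss (c = \<eta> / n), the regularized local loss (lam + \<rho> in place of lam) and the average
  loss (c = \<eta> / (m n), with pairs as indices).\<close>

definition reg_logistic ::
    "'j set \<Rightarrow> real \<Rightarrow> ('j \<Rightarrow> 'a::real_inner) \<Rightarrow> real \<Rightarrow> 'a \<Rightarrow> real" where
  "reg_logistic J c a lam w = (\<Sum>j\<in>J. c * logistic (inner (a j) w)) + lam / 2 * (norm w)\<^sup>2"

definition reg_grad ::
    "'j set \<Rightarrow> real \<Rightarrow> ('j \<Rightarrow> 'a::real_inner) \<Rightarrow> real \<Rightarrow> 'a \<Rightarrow> 'a" where
  "reg_grad J c a lam w = (\<Sum>j\<in>J. (c * logistic1 (inner (a j) w)) *\<^sub>R a j) + lam *\<^sub>R w"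

definition reg_hess ::
    "'j set \<Rightarrow> real \<Rightarrow> ('j \<Rightarrow> 'a::real_inner) \<Rightarrow> real \<Rightarrow> 'a \<Rightarrow> 'a \<Rightarrow> 'a" where
  "reg_hess J c a lam w v =
     (\<Sum>j\<in>J. (c * logistic2 (inner (a j) w) * inner (a j) v) *\<^sub>R a j) + lam *\<^sub>R v"

locale logistic_objective =
  fixes J :: "'j set" and c :: real and a :: "'j \<Rightarrow> 'a::real_inner" and lam :: real
  assumes finite_J: "finite J" and c_nonneg: "c \<ge> 0" and lam_pos: "lam > 0"
begin

abbreviation "f \<equiv> reg_logistic J c a lam"
abbreviation "g \<equiv> reg_grad J c a lam"
abbreviation "H \<equiv> reg_hess J c a lam"

lemma hess_inner:
  "inner v (H w u) =
     (\<Sum>j\<in>J. c * logistic2 (inner (a j) w) * (inner (a j) v * inner (a j) u)) + lam * inner v u"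
  unfolding reg_hess_def
  by (simp add: inner_right_distrib inner_sum_right inner_commute[of v] mult.assoc
      mult.commute[of "inner _ u"])

lemma hess_add: "H w (u + v) = H w u + H w v"
  by (simp add: reg_hess_def inner_add_right scaleR_add_left scaleR_add_right sum.distrib distrib_left)

lemma hess_scale: "H w (k *\<^sub>R v) = k *\<^sub>R H w v"
  by (simp add: reg_hess_def scaleR_right_distrib scaleR_sum_right mult.left_commute mult.commute)

lemma hess_minus: "H w (- v) = - H w v"
  using hess_scale[of w "-1" v] by simp

lemma hess_diff: "H w (u - v) = H w u - H w v"
  using hess_add[of w u "- v"] by (simp add: hess_minus)

lemma hess_quadratic:
  "inner v (H w v) = (\<Sum>j\<in>J. c * logistic2 (inner (a j) w) * (inner (a j) v)\<^sup>2) + lam * (norm v)\<^sup>2"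
  by (simp add: hess_inner power2_eq_square power2_norm_eq_inner[unfolded power2_eq_square])

lemma hess_lower: "lam * (norm v)\<^sup>2 \<le> inner v (H w v)"
  using c_nonneg logistic2_pos
  by (auto simp: hess_quadratic intro!: sum_nonneg mult_nonneg_nonneg less_imp_le[OF logistic2_pos])

sublocale hess: psd_form "\<lambda>u v. inner u (H w v)" for w
proof
  show "inner u (H w v) = inner v (H w u)" for u v
    by (simp add: hess_inner mult.commute inner_commute)
  have "0 \<le> lam * (norm v)\<^sup>2" for v using lam_pos by simp
  thus "0 \<le> inner v (H w v)" for v using hess_lower order_trans by blast
qed (auto simp: inner_add_left)

lemma norm_le_enorm: "sqrt lam * norm v \<le> hess.enorm w v"
  using real_sqrt_le_mono[OF hess_lower[of v w]] lam_pos
  by (simp add: hess.enorm_def real_sqrt_mult)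

lemma hess_upper:
  assumes "\<And>j. j \<in> J \<Longrightarrow> norm (a j) \<le> B"
  shows "inner v (H w v) \<le> (c * card J * B\<^sup>2 / 4 + lam) * (norm v)\<^sup>2"
proof -
  have "(\<Sum>j\<in>J. c * logistic2 (inner (a j) w) * (inner (a j) v)\<^sup>2)
      \<le> (\<Sum>j\<in>J. c * (1 / 4) * (B\<^sup>2 * (norm v)\<^sup>2))"
  proof (intro sum_mono mult_mono)
    fix j assume "j \<in> J"
    have "\<bar>inner (a j) v\<bar> \<le> B * norm v"
      using Cauchy_Schwarz_ineq2[of "a j" v] mult_right_mono[OF assms[OF \<open>j \<in> J\<close>], of "norm v"] by simp
    hence "\<bar>inner (a j) v\<bar>\<^sup>2 \<le> (B * norm v)\<^sup>2" by (intro power_mono) auto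
    thus "(inner (a j) v)\<^sup>2 \<le> B\<^sup>2 * (norm v)\<^sup>2" by (simp add: power_mult_distrib)
  qed (use c_nonneg logistic2_le less_imp_le[OF logistic2_pos] in \<open>auto\<close>)
  thus ?thesis by (simp add: hess_quadratic algebra_simps)
qed

lemma norm_expand: "lam / 2 * (norm (w + h))\<^sup>2 = lam / 2 * (norm w)\<^sup>2 + inner (lam *\<^sub>R w) h + lam / 2 * (norm h)\<^sup>2"
  by (simp add: power2_norm_eq_inner inner_add_left inner_add_right inner_commute algebra_simps)

lemma grad_inner:
  "inner (g w) h = (\<Sum>j\<in>J. c * logistic1 (inner (a j) w) * inner (a j) h) + inner (lam *\<^sub>R w) h"
  by (simp add: reg_grad_def inner_add_left inner_sum_left mult.assoc)

text \<open>Termwise this is the rational Taylor estimate with 2 - |<a_j, h>| >= 2 (1 - s); the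
  quadratic regularizer only loses the factor 1 / (1 - s) >= 1. In the applications \<open>s\<close>
  is the local norm of the step \<open>h\<close>.\<close>

lemma taylor_upper:
  assumes "\<And>j. j \<in> J \<Longrightarrow> \<bar>inner (a j) h\<bar> \<le> 2 * s" and "0 \<le> s" "s < 1"
  shows "f (w + h) \<le> f w + inner (g w) h + inner h (H w h) / (2 * (1 - s))"
proof -
  have "(\<Sum>j\<in>J. c * logistic (inner (a j) (w + h)))
      \<le> (\<Sum>j\<in>J. c * logistic (inner (a j) w) + c * logistic1 (inner (a j) w) * inner (a j) h
          + c * logistic2 (inner (a j) w) * (inner (a j) h)\<^sup>2 / (2 * (1 - s)))"
  proof (intro sum_mono)
    fix j assume j: "j \<in> J"
    let ?t = "inner (a j) w" and ?h = "inner (a j) h"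
    have "logistic (?t + ?h) \<le> logistic ?t + logistic1 ?t * ?h + logistic2 ?t * (?h\<^sup>2 / (2 - \<bar>?h\<bar>))"
      using assms(1)[OF j] assms(3) by (intro logistic_taylor_upper) auto
    also have "?h\<^sup>2 / (2 - \<bar>?h\<bar>) \<le> ?h\<^sup>2 / (2 * (1 - s))"
      using assms(1)[OF j] assms(3) by (intro divide_left_mono) auto
    finally have "logistic (?t + ?h) \<le> logistic ?t + logistic1 ?t * ?h + logistic2 ?t * (?h\<^sup>2 / (2 * (1 - s)))"
      using less_imp_le[OF logistic2_pos[of ?t]] by (simp add: mult_left_mono)
    from mult_left_mono[OF this c_nonneg]
    show "c * logistic (inner (a j) (w + h)) \<le> c * logistic ?t + c * logistic1 ?t * ?h
          + c * logistic2 ?t * ?h\<^sup>2 / (2 * (1 - s))"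
      by (simp add: inner_add_right algebra_simps)
  qed
  moreover have "lam * (norm h)\<^sup>2 / 2 \<le> lam * (norm h)\<^sup>2 / (2 * (1 - s))"
    using assms lam_pos by (intro divide_left_mono) auto
  ultimately show ?thesis
    unfolding reg_logistic_def norm_expand grad_inner hess_quadratic add_divide_distrib
      sum.distrib sum_divide_distrib by linarith
qed

lemma taylor_lower:
  assumes "\<And>j. j \<in> J \<Longrightarrow> \<bar>inner (a j) h\<bar> \<le> 2 * s" and "0 \<le> s"
  shows "f w + inner (g w) h + inner h (H w h) / (2 * (1 + s)) \<le> f (w + h)"
proof -
  have "(\<Sum>j\<in>J. c * logistic (inner (a j) w) + c * logistic1 (inner (a j) w) * inner (a j) h
          + c * logistic2 (inner (a j) w) * (inner (a j) h)\<^sup>2 / (2 * (1 + s)))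
      \<le> (\<Sum>j\<in>J. c * logistic (inner (a j) (w + h)))"
  proof (intro sum_mono)
    fix j assume j: "j \<in> J"
    let ?t = "inner (a j) w" and ?h = "inner (a j) h"
    have "?h\<^sup>2 / (2 * (1 + s)) \<le> ?h\<^sup>2 / (2 + \<bar>?h\<bar>)"
      using assms(1)[OF j] assms(2) by (intro divide_left_mono) (auto intro: mult_pos_pos)
    hence "logistic2 ?t * (?h\<^sup>2 / (2 * (1 + s))) \<le> logistic2 ?t * (?h\<^sup>2 / (2 + \<bar>?h\<bar>))"
      by (intro mult_left_mono less_imp_le[OF logistic2_pos])
    with logistic_taylor_lower[of ?t ?h]
    have "logistic ?t + logistic1 ?t * ?h + logistic2 ?t * (?h\<^sup>2 / (2 * (1 + s))) \<le> logistic (?t + ?h)"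
      by linarith
    from mult_left_mono[OF this c_nonneg]
    show "c * logistic ?t + c * logistic1 ?t * ?h + c * logistic2 ?t * ?h\<^sup>2 / (2 * (1 + s))
        \<le> c * logistic (inner (a j) (w + h))"
      by (simp add: inner_add_right algebra_simps)
  qed
  moreover have "lam * (norm h)\<^sup>2 / (2 * (1 + s)) \<le> lam * (norm h)\<^sup>2 / 2"
    using assms lam_pos by (intro divide_left_mono) auto
  ultimately show ?thesis
    unfolding reg_logistic_def norm_expand grad_inner hess_quadratic add_divide_distrib
      sum.distrib sum_divide_distrib by linarith
qed

lemma strong_convexity: "f w + inner (g w) h + lam / 2 * (norm h)\<^sup>2 \<le> f (w + h)"
proof -
  have "(\<Sum>j\<in>J. c * logistic (inner (a j) w) + c * logistic1 (inner (a j) w) * inner (a j) h)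
      \<le> (\<Sum>j\<in>J. c * logistic (inner (a j) (w + h)))"
  proof (intro sum_mono)
    fix j
    show "c * logistic (inner (a j) w) + c * logistic1 (inner (a j) w) * inner (a j) h
        \<le> c * logistic (inner (a j) (w + h))"
      using mult_left_mono[OF logistic_above_tangent[of "inner (a j) w" "inner (a j) (w + h)"] c_nonneg]
      by (simp add: inner_add_right algebra_simps)
  qed
  thus ?thesis
    unfolding reg_logistic_def norm_expand grad_inner by (simp add: sum.distrib)
qed

end


subsection \<open>One inexact damped Newton step\<close>

text \<open>Read \<open>N\<close> as the local norm of the way to the minimizer and \<nu> as the
  Newton decrement. A nonnegative gap forces N <= 2 (1 + N) \<nu>, and 2 \<nu> < 1/2 turns this into
  N <= 4 \<nu>.\<close>

lemma newton_gap_arith: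
  fixes N \<nu> G :: real
  assumes "0 \<le> N" "0 \<le> \<nu>" "\<nu> < 1 / 4" "G \<le> N * \<nu> - N\<^sup>2 / (2 * (1 + N))" "0 \<le> G"
  shows "G \<le> 4 * \<nu>\<^sup>2"
proof -
  have "N\<^sup>2 / (2 * (1 + N)) \<le> N * \<nu>" using assms by linarith
  hence "N\<^sup>2 \<le> 2 * (1 + N) * (N * \<nu>)"
    using assms(1) by (simp add: divide_le_eq mult.commute)
  hence *: "N * N \<le> N * (2 * (1 + N) * \<nu>)" by (simp add: power2_eq_square algebra_simps)
  have "N \<le> 4 * \<nu>"
  proof (cases "N = 0")
    case False
    hence "N \<le> 2 * (1 + N) * \<nu>" using * assms by simp
    also have "\<dots> = 2 * \<nu> + N * (2 * \<nu>)" by (simp add: algebra_simps)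
    finally have 1: "N \<le> 2 * \<nu> + N * (2 * \<nu>)" .
    have "N * (2 * \<nu>) \<le> N * (1 / 2)" using assms by (intro mult_left_mono) auto
    with 1 show ?thesis by simp
  qed (use assms in simp)
  hence "N * \<nu> \<le> 4 * \<nu> * \<nu>" using assms by (intro mult_right_mono)
  moreover have "0 \<le> N\<^sup>2 / (2 * (1 + N))" using assms by simp
  ultimately show ?thesis using assms(4) unfolding power2_eq_square by linarith
qed

text \<open>\<nu> is the exact decrement and \<delta> that of the computed direction, at most 5
  percent apart by the tolerance 1/20. The factor 17/38 comes from \<open>newton_decrease\<close>;
  1/50 and 7/100 are rounded down from the values at the threshold \<nu> = 1/4.\<close>

lemma newton_decrease_arith:
  fixes \<delta> \<nu> :: real
  assumes "0 \<le> \<nu>" "19 / 20 * \<nu> \<le> \<delta>" "\<delta> \<le> 21 / 20 * \<nu>"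
  shows "\<nu> \<ge> 1 / 4 \<Longrightarrow> 1 / 50 \<le> 17 / 38 * (\<delta>\<^sup>2 / (1 + \<delta>))"
    and "\<nu> < 1 / 4 \<Longrightarrow> 7 / 100 * (4 * \<nu>\<^sup>2) \<le> 17 / 38 * (\<delta>\<^sup>2 / (1 + \<delta>))"
proof -
  have \<delta>: "\<delta> \<ge> 0" using assms by linarith
  {
    assume "\<nu> \<ge> 1 / 4"
    hence d: "\<delta> \<ge> 19 / 80" using assms by linarith
    have "(1 / 50) * (38 / 17) * (1 + \<delta>) \<le> \<delta> * \<delta>"
    proof -
      have "(19 / 80) * \<delta> \<le> \<delta> * \<delta>" using d \<delta> by (intro mult_right_mono)
      moreover have "(1 / 50) * (38 / 17) * (1 + \<delta>) \<le> (19 / 80) * \<delta>"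
        using d by (simp add: field_simps)
      ultimately show ?thesis by (rule order_trans[rotated])
    qed
    hence "(1 / 50) * (38 / 17) \<le> \<delta>\<^sup>2 / (1 + \<delta>)"
      using \<delta> by (simp only: pos_le_divide_eq power2_eq_square)
    thus "1 / 50 \<le> 17 / 38 * (\<delta>\<^sup>2 / (1 + \<delta>))" by linarith
  next
    assume "\<nu> < 1 / 4"
    hence d: "\<delta> \<le> 21 / 80" using assms by linarith
    have "(19 / 20 * \<nu>)\<^sup>2 \<le> \<delta>\<^sup>2" using assms by (intro power_mono) auto
    hence 1: "361 / 400 * \<nu>\<^sup>2 \<le> \<delta>\<^sup>2" by (simp add: power2_eq_square)
    have "\<delta>\<^sup>2 / (101 / 80) \<le> \<delta>\<^sup>2 / (1 + \<delta>)"
      using d \<delta> by (intro divide_left_mono) auto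
    hence 2: "80 / 101 * \<delta>\<^sup>2 \<le> \<delta>\<^sup>2 / (1 + \<delta>)" by simp
    have aux: "361 / 400 * y \<le> z \<Longrightarrow> 80 / 101 * z \<le> x \<Longrightarrow> 0 \<le> y \<Longrightarrow> 7 / 100 * (4 * y) \<le> 17 / 38 * x"
      for x y z :: real by (simp add: field_simps)
    show "7 / 100 * (4 * \<nu>\<^sup>2) \<le> 17 / 38 * (\<delta>\<^sup>2 / (1 + \<delta>))"
      by (rule aux[OF 1 2]) simp
  }
qed

context logistic_objective
begin

text \<open>\<open>vh\<close> is the exact Newton direction and \<open>v\<close> the one returned by
  conjugate gradients; \<open>inexact\<close> is their stopping rule with \<beta> = 1/20.\<close>

context
  fixes L B :: real and w v vh :: 'a
  assumes a_bound: "\<And>j. j \<in> J \<Longrightarrow> norm (a j) \<le> B"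
    and scaling: "B\<^sup>2 = 4 * lam"
    and L_pos: "L > 0"
    and upper: "\<And>u. inner u (H w u) \<le> L * (norm u)\<^sup>2"
    and newton_dir: "H w vh = g w"
    and inexact: "norm (H w v - g w) \<le> 1 / 20 * sqrt (lam / L) * norm (g w)"
begin

text \<open>The scaling of the objective enters here: |B| = 2 sqrt(lam), and sqrt(lam) times the
  Euclidean norm is at most the local norm. So the local norm is an admissible \<open>s\<close> in
  the Taylor bounds.\<close>

lemma a_inner_le: "j \<in> J \<Longrightarrow> \<bar>inner (a j) h\<bar> \<le> 2 * hess.enorm w h"
proof -
  assume j: "j \<in> J"
  have "sqrt (B\<^sup>2) = 2 * sqrt lam" using scaling by (simp add: real_sqrt_mult)
  hence B: "\<bar>B\<bar> = 2 * sqrt lam" by simp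
  have "\<bar>inner (a j) h\<bar> \<le> norm (a j) * norm h" by (rule Cauchy_Schwarz_ineq2)
  also have "\<dots> \<le> \<bar>B\<bar> * norm h" using a_bound[OF j] by (intro mult_right_mono) auto
  also have "\<dots> \<le> 2 * hess.enorm w h" using norm_le_enorm[of h w] B by simp
  finally show ?thesis .
qed

text \<open>The Euclidean tolerance is translated into the local norm by |g| <= sqrt(L) |vh|_H and
  sqrt(lam) |e|_H <= |H e|. The factor sqrt(lam / L) in the tolerance pays for exactly these two
  conversions.\<close>

lemma direction_error: "hess.enorm w (v - vh) \<le> 1 / 20 * hess.enorm w vh"
proof -
  let ?N = "hess.enorm w"
  define e where "e = v - vh"
  have He: "H w e = H w v - g w" by (simp add: e_def hess_diff newton_dir)
  have "norm (g w) * norm (g w) = \<bar>inner (g w) (H w vh)\<bar>"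
    by (simp add: newton_dir norm_eq_sqrt_inner)
  also have "\<dots> \<le> ?N (g w) * ?N vh" by (rule hess.cauchy_schwarz)
  also have "?N (g w) \<le> sqrt L * norm (g w)"
    using real_sqrt_le_mono[OF upper[of "g w"]] by (simp add: hess.enorm_def real_sqrt_mult)
  finally have "norm (g w) * norm (g w) \<le> norm (g w) * (sqrt L * ?N vh)"
    using hess.enorm_nonneg[of w vh] by (simp add: mult_right_mono mult_ac)
  hence gN: "norm (g w) \<le> sqrt L * ?N vh"
    using hess.enorm_nonneg[of w vh] L_pos
    by (cases "norm (g w) = 0") (auto simp: mult_le_cancel_left)
  have "sqrt lam * (?N e)\<^sup>2 = sqrt lam * inner e (H w e)" by (simp add: hess.enorm_sq)
  also have "\<dots> \<le> sqrt lam * (norm e * norm (H w e))"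
    using lam_pos by (intro mult_left_mono norm_cauchy_schwarz) auto
  also have "\<dots> \<le> ?N e * norm (H w e)"
    using norm_le_enorm[of e w] by (simp add: mult.assoc[symmetric] mult_right_mono)
  finally have "?N e * (sqrt lam * ?N e) \<le> ?N e * norm (H w e)"
    by (simp add: power2_eq_square mult_ac)
  hence "sqrt lam * ?N e \<le> norm (H w e)"
    using hess.enorm_nonneg[of w e] by (cases "?N e = 0") (auto simp: mult_le_cancel_left)
  also have "\<dots> \<le> 1 / 20 * sqrt (lam / L) * norm (g w)" using inexact He by simp
  also have "\<dots> \<le> 1 / 20 * sqrt (lam / L) * (sqrt L * ?N vh)"
    using gN lam_pos L_pos by (intro mult_left_mono) auto
  also have "\<dots> = sqrt lam * (1 / 20 * ?N vh)"
    using L_pos by (simp add: real_sqrt_divide)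
  finally show ?thesis using lam_pos by (simp add: e_def)
qed

lemma newton_decrease:
  defines "\<delta> \<equiv> hess.enorm w v"
  shows "f (w - (1 / (1 + \<delta>)) *\<^sub>R v) \<le> f w - 17 / 38 * (\<delta>\<^sup>2 / (1 + \<delta>))"
proof -
  let ?N = "hess.enorm w"
  have \<delta>: "\<delta> \<ge> 0" unfolding \<delta>_def by (rule hess.enorm_nonneg)
  define e where "e = v - vh"
  have "?N vh \<le> \<delta> + ?N e"
    using hess.enorm_triangle[of w v "- e"] hess.enorm_minus[of w e]
    by (simp add: \<delta>_def e_def)
  hence Ne: "?N e \<le> \<delta> / 19" using direction_error by (simp add: e_def)
  have "inner (g w) v = inner v (H w vh)" by (simp add: newton_dir inner_commute)
  also have "\<dots> = \<delta>\<^sup>2 - inner v (H w e)"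
    by (simp add: \<delta>_def hess.enorm_sq e_def hess_diff inner_diff_right)
  finally have gv0: "inner (g w) v = \<delta>\<^sup>2 - inner v (H w e)" .
  have "inner v (H w e) \<le> \<delta> * (\<delta> / 19)"
    using hess.cauchy_schwarz[of v w e] mult_left_mono[OF Ne \<delta>] by (simp add: \<delta>_def)
  hence gv: "inner (g w) v \<ge> 18 / 19 * \<delta>\<^sup>2" by (simp add: gv0 power2_eq_square)
  \<comment> \<open>The damping satisfies 1 - \<tau> \<delta> = \<tau>, so the denominator of the
    Taylor bound cancels and the quadratic term is \<tau> \<delta>^2 / 2. Against the linear gain of
    18/19 \<tau> \<delta>^2 this leaves 18/19 - 1/2 = 17/38.\<close>
  define \<tau> where "\<tau> = 1 / (1 + \<delta>)"
  have \<tau>: "\<tau> > 0" "1 - \<tau> * \<delta> = \<tau>" using \<delta> by (simp_all add: \<tau>_def field_simps)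
  have "f (w + - (\<tau> *\<^sub>R v)) \<le> f w + inner (g w) (- (\<tau> *\<^sub>R v))
      + inner (- (\<tau> *\<^sub>R v)) (H w (- (\<tau> *\<^sub>R v))) / (2 * (1 - \<tau> * \<delta>))"
  proof (rule taylor_upper)
    fix j assume "j \<in> J"
    from a_inner_le[OF this, of "- (\<tau> *\<^sub>R v)"]
    show "\<bar>inner (a j) (- (\<tau> *\<^sub>R v))\<bar> \<le> 2 * (\<tau> * \<delta>)"
      using \<tau> by (simp only: hess.enorm_minus hess.enorm_scale \<delta>_def abs_of_pos)
  qed (use \<tau> \<delta> in \<open>auto intro: mult_nonneg_nonneg simp: algebra_simps\<close>)
  also have "inner (- (\<tau> *\<^sub>R v)) (H w (- (\<tau> *\<^sub>R v))) = \<tau>\<^sup>2 * \<delta>\<^sup>2"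
    unfolding \<delta>_def hess.enorm_sq by (simp add: hess_minus hess_scale power2_eq_square)
  also have "\<tau>\<^sup>2 * \<delta>\<^sup>2 / (2 * (1 - \<tau> * \<delta>)) = \<tau> * \<delta>\<^sup>2 / 2"
    using \<tau> by (simp add: power2_eq_square)
  also have "inner (g w) (- (\<tau> *\<^sub>R v)) \<le> - (\<tau> * (18 / 19 * \<delta>\<^sup>2))"
    using mult_left_mono[OF gv, of \<tau>] \<tau> by simp
  finally have "f (w - \<tau> *\<^sub>R v) \<le> f w - \<tau> * (18 / 19 * \<delta>\<^sup>2) + \<tau> * \<delta>\<^sup>2 / 2" by simp
  moreover have "\<tau> * (18 / 19 * \<delta>\<^sup>2) - \<tau> * \<delta>\<^sup>2 / 2 = 17 / 38 * (\<delta>\<^sup>2 / (1 + \<delta>))"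
  proof -
    have "\<tau> * (18 / 19 * x) - \<tau> * x / 2 = 17 / 38 * (\<tau> * x)" for x by simp
    from this[of "\<delta>\<^sup>2"] show ?thesis by (simp add: \<tau>_def)
  qed
  ultimately show ?thesis unfolding \<tau>_def[symmetric] by linarith
qed

lemma newton_gap:
  assumes "f ws \<le> f w" and "hess.enorm w vh < 1 / 4"
  shows "f w - f ws \<le> 4 * (hess.enorm w vh)\<^sup>2"
proof -
  let ?N = "hess.enorm w"
  define h where "h = ws - w"
  have "f w + inner (g w) h + inner h (H w h) / (2 * (1 + ?N h)) \<le> f (w + h)"
    by (intro taylor_lower a_inner_le hess.enorm_nonneg)
  moreover have "- (?N h * ?N vh) \<le> inner (g w) h"
    using hess.cauchy_schwarz[of h w vh] by (simp add: newton_dir inner_commute)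
  ultimately have "f w - f ws \<le> ?N h * ?N vh - (?N h)\<^sup>2 / (2 * (1 + ?N h))"
    by (simp add: h_def hess.enorm_sq)
  from newton_gap_arith[OF _ _ _ this] show ?thesis
    using assms hess.enorm_nonneg by simp
qed

text \<open>Decrement at least 1/4: the decrease is at least a constant. Smaller decrement: the gap
  is at most 4 \<nu>^2, so the decrease is at least 7 percent of the gap.\<close>

lemma newton_progress:
  assumes "f ws \<le> f w"
  defines "w' \<equiv> w - (1 / (1 + hess.enorm w v)) *\<^sub>R v"
  shows "f w' - f ws \<le> f w - f ws - 1 / 50 \<or> f w' - f ws \<le> 93 / 100 * (f w - f ws)"
proof -
  let ?\<nu> = "hess.enorm w vh" and ?\<delta> = "hess.enorm w v"
  have "?\<delta> \<le> ?\<nu> + hess.enorm w (v - vh)"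
    using hess.enorm_triangle[of w vh "v - vh"] by simp
  moreover have "?\<nu> \<le> ?\<delta> + hess.enorm w (v - vh)"
    using hess.enorm_triangle[of w v "- (v - vh)"] hess.enorm_minus[of w "v - vh"] by simp
  ultimately have "19 / 20 * ?\<nu> \<le> ?\<delta>" "?\<delta> \<le> 21 / 20 * ?\<nu>"
    using direction_error by linarith+
  note dec = newton_decrease_arith[OF hess.enorm_nonneg this]
  show ?thesis
  proof (cases "?\<nu> < 1 / 4")
    case True
    have "f w - f ws \<le> 4 * ?\<nu>\<^sup>2" using newton_gap[OF assms(1) True] .
    hence "7 / 100 * (f w - f ws) \<le> 7 / 100 * (4 * ?\<nu>\<^sup>2)" by simp
    with dec(2)[OF True] newton_decrease have "f w' \<le> f w - 7 / 100 * (f w - f ws)"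
      unfolding w'_def by linarith
    thus ?thesis by (intro disjI2) (simp add: field_simps)
  next
    case False
    with dec(1) newton_decrease show ?thesis unfolding w'_def by (intro disjI1) linarith
  qed
qed

lemma newton_monotone: "f (w - (1 / (1 + hess.enorm w v)) *\<^sub>R v) \<le> f w"
proof -
  have "0 \<le> 17 / 38 * ((hess.enorm w v)\<^sup>2 / (1 + hess.enorm w v))"
    using hess.enorm_nonneg[of w v] by simp
  with newton_decrease show ?thesis by linarith
qed

end

end

subsection \<open>Preconditioned conjugate gradients\<close>

text \<open>The span of the first \<open>t\<close> search directions. That it behaves like a Krylov
  space is the content of \<open>krylov_grad\<close>.\<close>

primrec krylov :: "(nat \<Rightarrow> 'a::real_vector) \<Rightarrow> nat \<Rightarrow> 'a set" where
  "krylov u 0 = {0}"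
| "krylov u (Suc t) = {x + k *\<^sub>R u t | x k. x \<in> krylov u t}"

lemma krylov_Suc: "x \<in> krylov u t \<Longrightarrow> x \<in> krylov u (Suc t)"
  by (simp, rule exI[of _ x], auto intro: exI[of _ 0])

lemma krylov_zero: "0 \<in> krylov u t"
  by (induction t) (simp, rule krylov_Suc)

lemma krylov_add: "x \<in> krylov u t \<Longrightarrow> y \<in> krylov u t \<Longrightarrow> x + y \<in> krylov u t"
proof (induction t arbitrary: x y)
  case (Suc t)
  then obtain x' k y' l where *: "x = x' + k *\<^sub>R u t" "y = y' + l *\<^sub>R u t"
    "x' \<in> krylov u t" "y' \<in> krylov u t" by auto
  hence "x + y = (x' + y') + (k + l) *\<^sub>R u t" by (simp add: scaleR_left_distrib)
  with Suc.IH[OF *(3,4)] show ?case by auto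
qed simp

lemma krylov_scale: "x \<in> krylov u t \<Longrightarrow> c *\<^sub>R x \<in> krylov u t"
proof (induction t arbitrary: x)
  case (Suc t)
  then obtain x' k where *: "x = x' + k *\<^sub>R u t" "x' \<in> krylov u t" by auto
  hence "c *\<^sub>R x = c *\<^sub>R x' + (c * k) *\<^sub>R u t" by (simp add: scaleR_right_distrib)
  with Suc.IH[OF *(2)] show ?case by auto
qed simp

lemma krylov_diff: "x \<in> krylov u t \<Longrightarrow> y \<in> krylov u t \<Longrightarrow> x - y \<in> krylov u t"
  using krylov_add[of x u t "(-1) *\<^sub>R y"] krylov_scale[of y u t "-1"] by simp

lemma krylov_mono: "x \<in> krylov u s \<Longrightarrow> s \<le> t \<Longrightarrow> x \<in> krylov u t"
  by (rule dec_induct[of s t "\<lambda>t. x \<in> krylov u t"]) (auto simp del: krylov.simps intro: krylov_Suc)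

lemma krylov_base: fixes u :: "nat \<Rightarrow> 'a::real_vector" shows "u t \<in> krylov u (Suc t)"
  using krylov_zero[of u t] by (simp, intro exI[of _ "0::'a"] conjI) (auto intro: exI[of _ "1::real"])

text \<open>
  \<open>Q\<close> inverts the preconditioner \<open>P\<close> on the subspace \<open>S\<close> only: matrices act on the vectors of one
  fixed dimension, embedded in the space of all dimensions.
\<close>

locale pcg =
  fixes H P Q :: "'a::real_inner \<Rightarrow> 'a" and g :: 'a
    and v r s u :: "nat \<Rightarrow> 'a" and S :: "'a set"
  assumes H_add: "H (x + y) = H x + H y" and H_scale: "H (k *\<^sub>R x) = k *\<^sub>R H x"
    and P_scale: "P (k *\<^sub>R x) = k *\<^sub>R P x"
    and H_sym: "inner x (H y) = inner y (H x)" and P_sym: "inner x (P y) = inner y (P x)"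
    and H_nonneg: "0 \<le> inner x (H x)" and P_pos: "x \<noteq> 0 \<Longrightarrow> 0 < inner x (P x)"
    and H_pos: "x \<noteq> 0 \<Longrightarrow> 0 < inner x (H x)"
    and Q_add: "x \<in> S \<Longrightarrow> y \<in> S \<Longrightarrow> Q (x + y) = Q x + Q y"
    and Q_scale: "x \<in> S \<Longrightarrow> Q (k *\<^sub>R x) = k *\<^sub>R Q x"
    and PQ: "x \<in> S \<Longrightarrow> P (Q x) = x"
    and Q_S: "x \<in> S \<Longrightarrow> Q x \<in> S" and H_S: "x \<in> S \<Longrightarrow> H x \<in> S"
    and S_zero: "0 \<in> S" and S_add: "x \<in> S \<Longrightarrow> y \<in> S \<Longrightarrow> x + y \<in> S"
    and S_scale: "x \<in> S \<Longrightarrow> k *\<^sub>R x \<in> S"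
    and g_S: "g \<in> S"
    and init: "v 0 = 0" "r 0 = g" "u 0 = Q g"
    and s_eq: "s t = Q (r t)"
    and v_Suc: "v (Suc t) = v t + (inner (r t) (s t) / inner (u t) (H (u t))) *\<^sub>R u t"
    and r_Suc: "r (Suc t) = r t - (inner (r t) (s t) / inner (u t) (H (u t))) *\<^sub>R H (u t)"
    and u_Suc: "u (Suc t) = s (Suc t) + (inner (r (Suc t)) (s (Suc t)) / inner (r t) (s t)) *\<^sub>R u t"
begin

abbreviation "\<alpha> t \<equiv> inner (r t) (s t) / inner (u t) (H (u t))"

lemma H_zero: "H 0 = 0" using H_scale[of 0 0] by simp
lemma H_minus: "H (- x) = - H x" using H_scale[of "-1" x] by simp
lemma H_diff: "H (x - y) = H x - H y" using H_add[of x "- y"] by (simp add: H_minus)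
lemma P_minus: "P (- x) = - P x" using P_scale[of "-1" x] by simp
lemma P_zero: "P 0 = 0" using P_scale[of 0 0] by simp
lemma S_minus: "x \<in> S \<Longrightarrow> - x \<in> S" using S_scale[of x "-1"] by simp
lemma S_diff: "x \<in> S \<Longrightarrow> y \<in> S \<Longrightarrow> x - y \<in> S" using S_add[of x "- y"] S_minus by simp
lemma Q_minus: "x \<in> S \<Longrightarrow> Q (- x) = - Q x" using Q_scale[of x "-1"] by simp
lemma Q_diff: "x \<in> S \<Longrightarrow> y \<in> S \<Longrightarrow> Q (x - y) = Q x - Q y"
  using Q_add[of x "- y"] by (simp add: Q_minus S_minus)

lemma run_S: "v t \<in> S \<and> r t \<in> S \<and> u t \<in> S"
proof (induction t)
  case 0 thus ?case using g_S by (simp add: init S_zero Q_S)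
next
  case (Suc t) thus ?case
    using S_diff S_add S_scale H_S Q_S by (simp add: v_Suc r_Suc u_Suc s_eq del: scaleR_scaleR)
qed

lemma r_S: "r t \<in> S" and u_S: "u t \<in> S"
  using run_S by auto

lemma residual: "r t = g - H (v t)"
  by (induction t) (simp_all add: init H_zero v_Suc r_Suc H_add H_scale)

lemma Ps: "P (s t) = r t"
  by (simp add: s_eq PQ r_S)

lemma inner_rs: "inner (r i) (s j) = inner (s i) (P (s j))"
  using P_sym[of "s j" "s i"] by (simp add: Ps inner_commute)

lemma s_zero_iff: "s t = 0 \<longleftrightarrow> r t = 0"
  using Ps[of t] P_zero Q_scale[OF S_zero, of 0] by (auto simp: s_eq)

lemma rs_pos: "r t \<noteq> 0 \<Longrightarrow> inner (r t) (s t) > 0"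
  using P_pos[of "s t"] by (simp add: inner_rs s_zero_iff)

text \<open>
  The last conjunct shows that a direction does not vanish unless its residual does, which keeps all
  quotients of the recursion meaningful.
\<close>

lemma orthogonality:
  assumes "\<And>i. i < t \<Longrightarrow> r i \<noteq> 0"
  shows "(\<forall>i<t. inner (r t) (u i) = 0) \<and> (\<forall>i<t. inner (r t) (s i) = 0) \<and>
         (\<forall>i<t. inner (u t) (H (u i)) = 0) \<and> inner (r t) (u t) = inner (r t) (s t)"
  using assms
proof (induction t rule: less_induct)
  case (less t)
  show ?case
  proof (cases t)
    case 0 thus ?thesis by (simp add: init s_eq)
  next
    case (Suc t')
    have nz: "r i \<noteq> 0" if "i \<le> t'" for i using less.prems[of i] that Suc by simp
    have IH: "\<forall>i<j. inner (r j) (u i) = 0" "\<forall>i<j. inner (r j) (s i) = 0"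
      "\<forall>i<j. inner (u j) (H (u i)) = 0" "inner (r j) (u j) = inner (r j) (s j)" if "j \<le> t'" for j
      using less.IH[of j] less.prems that Suc by auto
    have unz: "u j \<noteq> 0" if "j \<le> t'" for j
      using IH(4)[OF that] rs_pos[OF nz[OF that]] by auto
    hence uHu: "inner (u j) (H (u j)) > 0" if "j \<le> t'" for j using H_pos that by blast
    have \<alpha>nz: "\<alpha> j \<noteq> 0" if "j \<le> t'" for j using uHu[OF that] rs_pos[OF nz[OF that]] by simp
    have ru: "inner (r (Suc t')) (u i) = 0" if "i \<le> t'" for i
    proof (cases "i = t'")
      case True thus ?thesis
        using uHu[of t'] IH(4)[of t'] by (simp add: r_Suc inner_diff_left inner_commute[of "H _"])
    next
      case False
      hence "i < t'" using that by simp
      thus ?thesis using IH(1,3)[of t'] H_sym[of "u i" "u t'"]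
        by (simp add: r_Suc inner_diff_left inner_commute[of "H _"])
    qed
    have rs: "inner (r (Suc t')) (s i) = 0" if "i \<le> t'" for i
    proof (cases i)
      case 0 thus ?thesis using ru[of 0] by (simp add: init s_eq)
    next
      case (Suc k)
      obtain c where "u (Suc k) = s (Suc k) + c *\<^sub>R u k" using u_Suc by blast
      hence "s i = u i - c *\<^sub>R u k" using Suc by simp
      thus ?thesis using ru[OF that] ru[of k] that Suc by (simp add: inner_diff_right)
    qed
    \<comment> \<open>The residual recursion read backwards: \<open>H (u i)\<close> pairs with the
      new \<open>s\<close> through residuals only, where orthogonality is already known.\<close>
    have Hu: "H (u i) = (1 / \<alpha> i) *\<^sub>R (r i - r (Suc i))" if "i \<le> t'" for i
      using \<alpha>nz[OF that] by (simp add: r_Suc)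
    have sr: "inner (s (Suc t')) (r i) = 0" if "i \<le> t'" for i
      using rs[OF that] inner_rs[of "Suc t'" i] Ps[of i] by (simp add: inner_commute)
    have uHu0: "inner (u (Suc t')) (H (u i)) = 0" if "i \<le> t'" for i
    proof (cases "i = t'")
      case True
      have "inner (s (Suc t')) (H (u t')) = inner (s (Suc t')) ((1 / \<alpha> t') *\<^sub>R (r t' - r (Suc t')))"
        using Hu[of t'] by (rule arg_cong) simp
      also have "\<dots> = - (1 / \<alpha> t') * inner (r (Suc t')) (s (Suc t'))"
        using sr[of t'] by (simp only: inner_scaleR_right inner_diff_right) (simp add: inner_commute)
      finally have "inner (s (Suc t')) (H (u t')) = - inner (r (Suc t')) (s (Suc t')) / \<alpha> t'" by simp
      moreover have "inner (r (Suc t')) (s (Suc t')) / inner (r t') (s t') * inner (u t') (H (u t'))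
          = inner (r (Suc t')) (s (Suc t')) / \<alpha> t'" by simp
      ultimately show ?thesis using True by (simp add: u_Suc inner_add_left)
    next
      case False
      hence "i < t'" using that by simp
      have "H (u i) = (1 / \<alpha> i) *\<^sub>R (r i - r (Suc i))" by (rule Hu[OF that])
      then obtain b where "H (u i) = b *\<^sub>R (r i - r (Suc i))" by blast
      hence "inner (s (Suc t')) (H (u i)) = 0"
        using sr[of i] sr[of "Suc i"] \<open>i < t'\<close> by (simp add: inner_diff_right)
      thus ?thesis using IH(3)[of t'] \<open>i < t'\<close> by (simp add: u_Suc inner_add_left)
    qed
    have "inner (r (Suc t')) (u (Suc t')) = inner (r (Suc t')) (s (Suc t'))"
      using ru[of t'] by (simp add: u_Suc inner_add_right)
    with ru rs uHu0 show ?thesis by (simp add: Suc less_Suc_eq_le)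
  qed
qed

lemma residual_orthogonal_krylov:
  assumes "\<And>i. i < t \<Longrightarrow> r i \<noteq> 0" "x \<in> krylov u t"
  shows "inner (r t) x = 0"
proof -
  have *: "\<forall>i<t. inner (r t) (u i) = 0" using orthogonality[OF assms(1)] by blast
  have "inner (r t) x = 0" if "x \<in> krylov u k" "k \<le> t" for k x
    using that
  proof (induction k arbitrary: x)
    case (Suc k) thus ?case using * by (auto simp: inner_add_right)
  qed simp
  from this[OF assms(2)] show ?thesis by simp
qed

lemma v_krylov: "v t \<in> krylov u t"
  by (induction t) (auto simp: init v_Suc)

lemma krylov_sub_S: "x \<in> krylov u t \<Longrightarrow> x \<in> S"
  by (induction t arbitrary: x) (auto simp: S_zero intro!: S_add S_scale u_S)

text \<open>\<open>Q (H (u k))\<close> is a multiple of s_k - s_(k+1), and both lie in the span of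
  the directions up to k + 1. So a preconditioned gradient step from a Krylov point ends in the next
  Krylov space, which is what places the accelerated method in the same spaces.\<close>

lemma krylov_grad:
  assumes nz: "\<And>i. i < t \<Longrightarrow> r i \<noteq> 0" and x: "x \<in> krylov u t"
  shows "Q (g - H x) \<in> krylov u (Suc t)"
proof -
  have s_mem: "s i \<in> krylov u (Suc i)" for i
  proof (cases i)
    case 0 thus ?thesis using krylov_base[of u 0] by (simp add: init s_eq)
  next
    case (Suc k)
    obtain c where "u (Suc k) = s (Suc k) + c *\<^sub>R u k" using u_Suc by blast
    hence "s i = u i - c *\<^sub>R u k" using Suc by simp
    moreover have "u k \<in> krylov u (Suc i)" using krylov_mono[OF krylov_base[of u k], of "Suc i"] Suc by (simp del: krylov.simps)
    ultimately show ?thesis by (metis krylov_base krylov_diff krylov_scale)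
  qed
  have HS: "H x \<in> S" if "x \<in> krylov u k" for x k using that krylov_sub_S H_S by blast
  have "Q (H x) \<in> krylov u (Suc k)" if "x \<in> krylov u k" "k \<le> t" for x k
    using that
  proof (induction k arbitrary: x)
    case 0 thus ?case using Q_scale[OF S_zero, of 0] krylov_zero[of u 1] by (simp add: H_zero del: krylov.simps(2))
  next
    case (Suc k)
    then obtain y c where y: "x = y + c *\<^sub>R u k" "y \<in> krylov u k" by auto
    have o: "inner (r k) (u k) = inner (r k) (s k)" using orthogonality[of k] nz Suc.prems by simp
    have rk: "r k \<noteq> 0" using nz Suc.prems by simp
    have "u k \<noteq> 0" using o rs_pos[OF rk] by auto
    hence "\<alpha> k \<noteq> 0" using H_pos[of "u k"] rs_pos[OF rk] by auto
    hence "H (u k) = (1 / \<alpha> k) *\<^sub>R (r k - r (Suc k))" by (simp add: r_Suc)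
    then obtain b where "H (u k) = b *\<^sub>R (r k - r (Suc k))" by blast
    hence "Q (H (u k)) = b *\<^sub>R (s k - s (Suc k))"
      by (simp add: Q_scale Q_diff r_S S_diff s_eq del: scaleR_scaleR)
    moreover have "s k \<in> krylov u (Suc (Suc k))" by (rule krylov_Suc[OF s_mem])
    ultimately have "Q (H (u k)) \<in> krylov u (Suc (Suc k))"
      by (simp only: krylov_diff krylov_scale s_mem)
    moreover have "Q (H y) \<in> krylov u (Suc (Suc k))" by (intro krylov_Suc Suc.IH) (use Suc.prems y in auto)
    moreover have "Q (H x) = Q (H y) + c *\<^sub>R Q (H (u k))"
      using HS[OF y(2)] H_S[OF u_S[of k]] by (simp add: y(1) H_add H_scale Q_add Q_scale S_scale)
    ultimately show ?case by (simp only: krylov_add krylov_scale)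
  qed
  from this[OF x] have "Q (H x) \<in> krylov u (Suc t)" by simp
  moreover have "Q g \<in> krylov u (Suc t)"
    using krylov_mono[OF krylov_base[of u 0], of "Suc t"] by (simp add: init del: krylov.simps)
  moreover have "Q (g - H x) = Q g - Q (H x)" using HS[OF x] g_S by (simp add: Q_diff)
  ultimately show ?thesis by (simp only: krylov_diff)
qed


section \<open>Convergence rate by comparison with an accelerated method\<close>

sublocale energy: psd_form "\<lambda>x y. inner x (H y)"
  by unfold_locales (simp_all add: inner_add_left H_nonneg, rule H_sym)

sublocale precond: psd_form "\<lambda>x y. inner x (P y)"
proof
  show "0 \<le> inner x (P x)" for x using P_pos[of x] by (cases "x = 0") auto
  show "inner x (P y) = inner y (P x)" for x y by (rule P_sym)
qed (simp_all add: inner_add_left)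

text \<open>
  One step of Nesterov's accelerated method in the geometry of \<open>P\<close>, with all points
  relative to the solution.
\<close>

lemma accelerated_step:
  assumes "0 < c1" "0 < c2" and \<theta>: "0 < \<theta>" "\<theta> \<le> 1" "\<theta>\<^sup>2 = c1 / c2"
    and low: "\<And>x. c1 * inner x (P x) \<le> inner x (H x)"
    and up: "\<And>x. inner x (H x) \<le> c2 * inner x (P x)"
    and Y: "(1 + \<theta>) *\<^sub>R Y = X + \<theta> *\<^sub>R Z" and G: "P G = H Y"
  defines "X' \<equiv> Y - (1 / c2) *\<^sub>R G" and "Z' \<equiv> (1 - \<theta>) *\<^sub>R Z + \<theta> *\<^sub>R Y - (\<theta> / c1) *\<^sub>R G"
  shows "inner X' (H X') + c1 * inner Z' (P Z') \<le> (1 - \<theta>) * (inner X (H X) + c1 * inner Z (P Z))"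
proof -
  let ?h = "\<lambda>x y. inner x (H y)" and ?p = "\<lambda>x y. inner x (P y)"
  define W where "W = (1 - \<theta>) *\<^sub>R Z + \<theta> *\<^sub>R Y"
  have pG: "?p A G = ?h A Y" for A by (simp add: G)
  have "?h X' X' = ?h Y Y - 2 / c2 * ?p G G + ?h G G / c2\<^sup>2"
  proof -
    have "?h X' X' = ?h Y Y - 2 / c2 * ?h G Y + (1 / c2) * (1 / c2) * ?h G G"
      unfolding X'_def by (simp only: energy.expand H_sym[of Y G]) (simp add: algebra_simps)
    thus ?thesis by (simp add: pG power2_eq_square)
  qed
  also have "?h G G / c2\<^sup>2 \<le> c2 * ?p G G / c2\<^sup>2"
    using up[of G] assms(2) by (intro divide_right_mono) auto
  finally have 1: "?h X' X' \<le> ?h Y Y - ?p G G / c2"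
    using assms(2) by (simp add: power2_eq_square)
  have "?p Z' Z' = ?p W W - 2 * (\<theta> / c1) * ?p W G + (\<theta> / c1)\<^sup>2 * ?p G G"
    unfolding Z'_def W_def[symmetric] using P_sym[of G W]
    by (simp only: precond.expand power2_eq_square) (simp add: algebra_simps)
  hence "c1 * ?p Z' Z' = c1 * ?p W W - 2 * (\<theta> * ?h W Y) + \<theta>\<^sup>2 / c1 * ?p G G"
    using assms(1) by (simp add: pG power2_eq_square field_simps)
  \<comment> \<open>Since \<theta>^2 / c1 = 1 / c2, this P-norm of the gradient cancels the one
    gained in 1.\<close>
  hence 2: "c1 * ?p Z' Z' = c1 * ?p W W - 2 * (\<theta> * ?h W Y) + ?p G G / c2"
    using assms(1,2) \<theta>(3) by simp
  have "?p W W = (1 - \<theta>) * ?p Z Z + \<theta> * ?p Y Y - \<theta> * (1 - \<theta>) * ?p (Z - Y) (Z - Y)"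
    unfolding W_def using P_sym[of Z Y] by (simp only: precond.expand) (simp add: algebra_simps)
  also have "\<dots> \<le> (1 - \<theta>) * ?p Z Z + \<theta> * ?p Y Y"
    using \<theta> precond.nonneg[of "Z - Y"] by simp
  finally have 3: "c1 * ?p W W \<le> c1 * (1 - \<theta>) * ?p Z Z + c1 * \<theta> * ?p Y Y"
    using assms(1) by (simp add: mult_left_mono mult.assoc flip: distrib_left)
  have Z: "\<theta> *\<^sub>R Z = (1 + \<theta>) *\<^sub>R Y - X" using Y by (simp add: algebra_simps)
  have "\<theta> *\<^sub>R W = (1 - \<theta>) *\<^sub>R (\<theta> *\<^sub>R Z) + \<theta>\<^sup>2 *\<^sub>R Y"
    by (simp add: W_def scaleR_right_distrib power2_eq_square mult.commute)
  also have "\<dots> = Y - (1 - \<theta>) *\<^sub>R X"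
    unfolding Z by (simp add: algebra_simps power2_eq_square)
  finally have "\<theta> * ?h W Y = ?h (Y - (1 - \<theta>) *\<^sub>R X) Y"
    by (metis inner_scaleR_left)
  hence 4: "\<theta> * ?h W Y = ?h Y Y - (1 - \<theta>) * ?h X Y" by (simp only: energy.expand)
  have 5: "\<theta> * (c1 * ?p Y Y) \<le> \<theta> * ?h Y Y" using low[of Y] \<theta> by (intro mult_left_mono) auto
  \<comment> \<open>This square absorbs the mixed term of X and Y left over from 4.\<close>
  have "0 \<le> (1 - \<theta>) * ?h (X - Y) (X - Y)" using \<theta> energy.nonneg by simp
  also have "?h (X - Y) (X - Y) = ?h X X - 2 * ?h X Y + ?h Y Y"
    using H_sym[of X Y] by (simp only: energy.expand)
  finally have 6: "0 \<le> (1 - \<theta>) * ?h X X - 2 * ((1 - \<theta>) * ?h X Y) + ?h Y Y - \<theta> * ?h Y Y"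
    by (simp add: algebra_simps)
  have "(1 - \<theta>) * (?h X X + c1 * ?p Z Z) = (1 - \<theta>) * ?h X X + c1 * (1 - \<theta>) * ?p Z Z"
    by (simp add: algebra_simps)
  moreover have "\<theta> * (c1 * ?p Y Y) = c1 * \<theta> * ?p Y Y" by simp
  ultimately show ?thesis using 1 2 3 4 5 6 by linarith
qed

text \<open>Pythagoras in the energy norm: x - v_t lies in the Krylov space, and the residual, which
  up to sign is H applied to the error, is orthogonal to that space.\<close>

lemma cg_optimal:
  assumes "\<And>i. i < t \<Longrightarrow> r i \<noteq> 0" "H xs = g" "x \<in> krylov u t"
  shows "inner (v t - xs) (H (v t - xs)) \<le> inner (x - xs) (H (x - xs))"
proof -
  have "inner (x - v t) (H (v t - xs)) = - inner (r t) (x - v t)"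
    using assms(2) by (simp add: residual H_diff inner_commute inner_diff_left inner_diff_right)
  also have "\<dots> = 0"
    using residual_orthogonal_krylov[OF assms(1) krylov_diff[OF assms(3) v_krylov]] by simp
  finally have 0: "inner (x - v t) (H (v t - xs)) = 0" .
  have "x - xs = (x - v t) + (v t - xs)" by simp
  hence "inner (x - xs) (H (x - xs)) = inner ((x - v t) + (v t - xs)) (H ((x - v t) + (v t - xs)))"
    by (rule arg_cong)
  also have "\<dots> = inner (x - v t) (H (x - v t)) + inner (v t - xs) (H (v t - xs))"
    using 0 H_sym[of "v t - xs" "x - v t"] by (simp only: energy.add_left energy.add_right)
  finally show ?thesis using H_nonneg[of "x - v t"] by simp
qed

text \<open>The potential adds c1 times the squared P-norm distance of an auxiliary point
  \<open>z\<close>. Each accelerated step starts from the conjugate gradient iterate itself, and its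
  result is replaced by the next iterate, which is at least as good; only \<open>z\<close> is
  carried along. The factor 2 is the initial potential, as z = 0 costs at most the energy of
  \<open>xs\<close>.\<close>

lemma cg_convergence:
  assumes nz: "\<And>i. i < t \<Longrightarrow> r i \<noteq> 0" and xs: "H xs = g" "xs \<in> S"
    and "0 < c1" "0 < c2" and \<theta>: "0 < \<theta>" "\<theta> \<le> 1" "\<theta>\<^sup>2 = c1 / c2"
    and low: "\<And>x. c1 * inner x (P x) \<le> inner x (H x)"
    and up: "\<And>x. inner x (H x) \<le> c2 * inner x (P x)"
  shows "inner (v t - xs) (H (v t - xs)) \<le> 2 * (1 - \<theta>) ^ t * inner xs (H xs)"
proof -
  have "\<exists>z. z \<in> krylov u k \<and> inner (v k - xs) (H (v k - xs)) + c1 * inner (z - xs) (P (z - xs))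
      \<le> (1 - \<theta>) ^ k * (2 * inner xs (H xs))" if "k \<le> t" for k
    using that
  proof (induction k)
    case 0
    have "inner (v 0 - xs) (H (v 0 - xs)) + c1 * inner (0 - xs) (P (0 - xs)) \<le> 2 * inner xs (H xs)"
      using low[of xs] by (simp add: init H_minus P_minus)
    thus ?case by (intro exI[of _ 0]) simp
  next
    case (Suc k)
    then obtain z where z: "z \<in> krylov u k" and
      IH: "inner (v k - xs) (H (v k - xs)) + c1 * inner (z - xs) (P (z - xs))
        \<le> (1 - \<theta>) ^ k * (2 * inner xs (H xs))" by auto
    define y where "y = (1 / (1 + \<theta>)) *\<^sub>R (v k + \<theta> *\<^sub>R z)"
    define G where "G = Q (H y - g)"
    have y: "y \<in> krylov u k"
      unfolding y_def by (intro krylov_scale krylov_add v_krylov z)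
    have HyS: "H y - g \<in> S" using H_S krylov_sub_S y g_S S_diff by blast
    have "Q (g - H y) = - G" using Q_minus[OF HyS] by (simp add: G_def)
    moreover have "Q (g - H y) \<in> krylov u (Suc k)" using nz Suc.prems y by (intro krylov_grad) auto
    ultimately have Gk: "G \<in> krylov u (Suc k)" using krylov_scale[of "- G" u "Suc k" "-1"] by (simp del: krylov.simps)
    define x' where "x' = y - (1 / c2) *\<^sub>R G"
    define z' where "z' = (1 - \<theta>) *\<^sub>R z + \<theta> *\<^sub>R y - (\<theta> / c1) *\<^sub>R G"
    have x'k: "x' \<in> krylov u (Suc k)" and z'k: "z' \<in> krylov u (Suc k)"
      unfolding x'_def z'_def by (intro krylov_diff krylov_add krylov_scale krylov_Suc y z Gk)+
    have "(1 + \<theta>) *\<^sub>R y = v k + \<theta> *\<^sub>R z" using \<theta> by (simp add: y_def)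
    hence "(1 + \<theta>) *\<^sub>R (y - xs) = (v k - xs) + \<theta> *\<^sub>R (z - xs)"
      by (simp add: algebra_simps)
    moreover have "P G = H (y - xs)" using PQ[OF HyS] by (simp add: G_def H_diff xs)
    ultimately have "inner ((y - xs) - (1 / c2) *\<^sub>R G) (H ((y - xs) - (1 / c2) *\<^sub>R G)) +
        c1 * inner ((1 - \<theta>) *\<^sub>R (z - xs) + \<theta> *\<^sub>R (y - xs) - (\<theta> / c1) *\<^sub>R G)
          (P ((1 - \<theta>) *\<^sub>R (z - xs) + \<theta> *\<^sub>R (y - xs) - (\<theta> / c1) *\<^sub>R G))
      \<le> (1 - \<theta>) * (inner (v k - xs) (H (v k - xs)) + c1 * inner (z - xs) (P (z - xs)))"
      by (intro accelerated_step assms)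
    moreover have "(y - xs) - (1 / c2) *\<^sub>R G = x' - xs" by (simp add: x'_def)
    moreover have "(1 - \<theta>) *\<^sub>R (z - xs) + \<theta> *\<^sub>R (y - xs) - (\<theta> / c1) *\<^sub>R G = z' - xs"
      by (simp add: z'_def algebra_simps)
    ultimately have "inner (x' - xs) (H (x' - xs)) + c1 * inner (z' - xs) (P (z' - xs))
      \<le> (1 - \<theta>) * (inner (v k - xs) (H (v k - xs)) + c1 * inner (z - xs) (P (z - xs)))" by simp
    also have "\<dots> \<le> (1 - \<theta>) * ((1 - \<theta>) ^ k * (2 * inner xs (H xs)))"
      using IH \<theta> by (intro mult_left_mono) auto
    finally have "inner (x' - xs) (H (x' - xs)) + c1 * inner (z' - xs) (P (z' - xs))
      \<le> (1 - \<theta>) ^ Suc k * (2 * inner xs (H xs))" by simp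
    moreover have "inner (v (Suc k) - xs) (H (v (Suc k) - xs)) \<le> inner (x' - xs) (H (x' - xs))"
      using nz Suc.prems by (intro cg_optimal xs x'k) auto
    ultimately show ?case using z'k by (intro exI[of _ z'] conjI) linarith+
  qed
  then obtain z where "inner (v t - xs) (H (v t - xs)) + c1 * inner (z - xs) (P (z - xs))
      \<le> (1 - \<theta>) ^ t * (2 * inner xs (H xs))" by blast
  moreover have "0 \<le> c1 * inner (z - xs) (P (z - xs))"
    using assms(4) precond.nonneg by simp
  ultimately show ?thesis by (simp add: mult.assoc mult.left_commute)
qed

text \<open>Two conversions cost the factor L / lam: the squared residual is at most L times the
  energy of the error, and the energy of the solution is at most |g|^2 / lam.\<close>

lemma cg_residual:
  assumes nz: "\<And>i. i < t \<Longrightarrow> r i \<noteq> 0" and xs: "H xs = g" "xs \<in> S"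
    and c: "0 < c1" "0 < c2" and \<theta>: "0 < \<theta>" "\<theta> \<le> 1" "\<theta>\<^sup>2 = c1 / c2"
    and low: "\<And>x. c1 * inner x (P x) \<le> inner x (H x)"
    and up: "\<And>x. inner x (H x) \<le> c2 * inner x (P x)"
    and lam: "0 < lam" "\<And>x. lam * (norm x)\<^sup>2 \<le> inner x (H x)"
    and L: "0 < L" "\<And>x. inner x (H x) \<le> L * (norm x)\<^sup>2"
  shows "(norm (r t))\<^sup>2 \<le> 2 * (L / lam) * (1 - \<theta>) ^ t * (norm g)\<^sup>2"
proof -
  define e where "e = xs - v t"
  have re: "r t = H e" by (simp add: e_def residual H_diff xs)
  have "((norm (r t))\<^sup>2)\<^sup>2 = (inner (r t) (H e))\<^sup>2" by (simp add: re power2_norm_eq_inner)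
  also have "\<dots> \<le> inner (r t) (H (r t)) * inner e (H e)" by (rule energy.cauchy_schwarz_sq)
  also have "\<dots> \<le> L * (norm (r t))\<^sup>2 * inner e (H e)"
    using L(2) H_nonneg by (intro mult_right_mono) auto
  finally have "(norm (r t))\<^sup>2 * (norm (r t))\<^sup>2 \<le> (norm (r t))\<^sup>2 * (L * inner e (H e))"
    by (simp add: power2_eq_square mult_ac)
  hence "(norm (r t))\<^sup>2 \<le> L * inner e (H e)"
  proof (cases "r t = 0")
    case True thus ?thesis using L(1) H_nonneg[of e] by simp
  next
    case False
    hence "0 < (norm (r t))\<^sup>2" by simp
    thus ?thesis using \<open>(norm (r t))\<^sup>2 * (norm (r t))\<^sup>2 \<le> _\<close> mult_le_cancel_left_pos by blast
  qed
  also have "inner e (H e) = inner (v t - xs) (H (v t - xs))"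
  proof -
    have "e = - (v t - xs)" by (simp add: e_def)
    thus ?thesis by (simp only: H_minus inner_minus_left inner_minus_right minus_minus)
  qed
  also have "\<dots> \<le> 2 * (1 - \<theta>) ^ t * inner xs (H xs)"
    by (rule cg_convergence[OF nz xs c \<theta> low up])
  also have "inner xs (H xs) \<le> (norm g)\<^sup>2 / lam"
  proof -
    have 1: "inner xs (H xs) \<le> norm xs * norm g" using norm_cauchy_schwarz[of xs g] xs by simp
    have "norm xs * (lam * norm xs) \<le> norm xs * norm g"
      using lam(2)[of xs] 1 by (simp add: power2_eq_square mult_ac)
    hence "lam * norm xs \<le> norm g" by (cases "xs = 0") auto
    hence "norm xs \<le> norm g / lam" using lam by (simp add: field_simps)
    hence "norm xs * norm g \<le> norm g / lam * norm g" by (intro mult_right_mono) auto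
    with 1 show ?thesis by (simp add: power2_eq_square)
  qed
  finally have "(norm (r t))\<^sup>2 \<le> L * (2 * (1 - \<theta>) ^ t * ((norm g)\<^sup>2 / lam))"
    using L \<theta> by (simp add: mult_left_mono)
  thus ?thesis by (simp add: mult_ac)
qed

text \<open>Relative to |g|^2 the squared tolerance is lam / (400 L), so by
  \<open>cg_residual\<close> it suffices that (1 - \<theta>)^T <= (lam / L)^2 / 800. The summand 2
  ln(L / lam) in the number of steps yields the square, and 7 yields the constant, as e^7 >= 800. A
  run that has not stopped has nonzero residuals, as that bound demands.\<close>

lemma cg_stops:
  assumes xs: "H xs = g" "xs \<in> S"
    and c: "0 < c1" "0 < c2" "c1 \<le> c2"
    and low: "\<And>x. c1 * inner x (P x) \<le> inner x (H x)"
    and up: "\<And>x. inner x (H x) \<le> c2 * inner x (P x)"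
    and lam: "0 < lam" "\<And>x. lam * (norm x)\<^sup>2 \<le> inner x (H x)"
    and L: "lam \<le> L" "\<And>x. inner x (H x) \<le> L * (norm x)\<^sup>2"
    and "g \<noteq> 0" "T > 0" and T: "real T \<ge> sqrt (c2 / c1) * (7 + 2 * ln (L / lam))"
  shows "\<exists>t<T. norm (r (Suc t)) \<le> 1 / 20 * sqrt (lam / L) * norm g"
proof (rule ccontr)
  let ?tol = "1 / 20 * sqrt (lam / L) * norm g"
  assume "\<not> ?thesis"
  hence big: "?tol < norm (r (Suc t))" if "t < T" for t using that by auto
  have "L > 0" using lam L by simp
  hence tol: "0 \<le> ?tol" using lam by simp
  have nz: "r i \<noteq> 0" if "i < T" for i
  proof (cases i)
    case 0 thus ?thesis using \<open>g \<noteq> 0\<close> by (simp add: init)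
  next
    case (Suc k) thus ?thesis using big[of k] that tol by auto
  qed
  define \<theta> where "\<theta> = sqrt (c1 / c2)"
  have \<theta>: "0 < \<theta>" "\<theta> \<le> 1" "\<theta>\<^sup>2 = c1 / c2" using c by (simp_all add: \<theta>_def)
  have "(1 - \<theta>) ^ T \<le> exp (- \<theta>) ^ T"
    using \<theta> exp_ge_add_one_self[of "- \<theta>"] by (intro power_mono) auto
  also have "\<dots> = exp (- (\<theta> * real T))" by (simp add: exp_of_nat_mult[symmetric] mult.commute)
  also have "\<dots> \<le> exp (- (7 + 2 * ln (L / lam)))"
  proof -
    have "\<theta> * (sqrt (c2 / c1) * (7 + 2 * ln (L / lam))) \<le> \<theta> * real T"
      using T \<theta> by (intro mult_left_mono) auto
    moreover have "\<theta> * sqrt (c2 / c1) = 1"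
      using c by (simp add: \<theta>_def flip: real_sqrt_mult)
    ultimately show ?thesis by (simp add: mult.assoc[symmetric])
  qed
  also have "\<dots> = exp (- 7) * (lam / L)\<^sup>2"
  proof -
    have "exp (- (7 + 2 * x)) = exp (- 7) * (exp (- x))\<^sup>2" for x :: real
      by (simp add: power2_eq_square flip: exp_add)
    moreover have "exp (- ln (L / lam)) = lam / L"
      using lam \<open>L > 0\<close> by (simp add: exp_minus)
    ultimately show ?thesis by simp
  qed
  also have "\<dots> \<le> 1 / 800 * (lam / L)\<^sup>2"
  proof -
    \<comment> \<open>A lower bound for e^7, from e^(1/2) >= 1 + 1/2 + 1/8 = 13/8.\<close>
    have "(13/8::real) ^ 14 \<le> exp (1/2) ^ 14"
      using exp_lower_Taylor_quadratic[of "1/2::real"] by (intro power_mono) (simp_all add: power2_eq_square)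
    hence "800 \<le> exp (7::real)" by (simp add: exp_of_nat_mult[symmetric] power_divide)
    hence "exp (- 7) \<le> (1 / 800 :: real)" by (simp add: exp_minus field_simps)
    thus ?thesis by (intro mult_right_mono) auto
  qed
  finally have pow: "(1 - \<theta>) ^ T \<le> 1 / 800 * (lam / L)\<^sup>2" .
  have "(norm (r T))\<^sup>2 \<le> 2 * (L / lam) * (1 - \<theta>) ^ T * (norm g)\<^sup>2"
    by (rule cg_residual[OF nz xs c(1,2) \<theta> low up lam \<open>L > 0\<close> L(2)])
  also have "\<dots> \<le> 2 * (L / lam) * (1 / 800 * (lam / L)\<^sup>2) * (norm g)\<^sup>2"
    using pow lam \<open>L > 0\<close> by (intro mult_right_mono mult_left_mono) auto
  also have "\<dots> = ?tol\<^sup>2"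
    using lam \<open>L > 0\<close> by (simp add: power_mult_distrib power_divide) (simp add: field_simps power2_eq_square)
  finally have "norm (r T) \<le> ?tol" using tol by (rule power2_le_imp_le)
  moreover obtain k where "T = Suc k" using \<open>T > 0\<close> by (cases T) auto
  ultimately show False using big[of k] by simp
qed

end

subsection \<open>Counting the outer iterations\<close>

text \<open>The potential 50 gap + 15 ln(gap / \<epsilon>) drops by at least 1 per step: 50 / 50 in
  the first alternative, 15 * 7/100 in the second. The bound ln gap <= gap merges the initial values
  into 65 gap 0.\<close>

lemma newton_iteration_count:
  fixes gap :: "nat \<Rightarrow> real"
  assumes eps: "\<epsilon> > 0"
    and step: "\<And>k. gap (Suc k) \<le> gap k - 1 / 50 \<or> gap (Suc k) \<le> 93 / 100 * gap k"
    and big: "\<And>k. k < K \<Longrightarrow> gap k > \<epsilon>"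
    and "gap 0 \<ge> 0"
  shows "real K \<le> 65 * gap 0 + 15 * max 1 (ln (1 / \<epsilon>)) + 1"
proof (cases K)
  case 0 thus ?thesis using assms by simp
next
  case (Suc K')
  define \<Phi> where "\<Phi> = (\<lambda>k. 50 * gap k + 15 * ln (gap k / \<epsilon>))"
  have "\<Phi> k \<le> \<Phi> 0 - real k" if "k \<le> K'" for k
    using that
  proof (induction k)
    case (Suc k)
    have pos: "gap k > \<epsilon>" "gap (Suc k) > \<epsilon>" using big Suc.prems \<open>K = Suc K'\<close> by auto
    hence pos': "gap k / \<epsilon> > 0" "gap (Suc k) / \<epsilon> > 0" using eps by auto
    have "\<Phi> (Suc k) \<le> \<Phi> k - 1"
      using step[of k]
    proof
      assume s: "gap (Suc k) \<le> gap k - 1 / 50"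
      hence "ln (gap (Suc k) / \<epsilon>) \<le> ln (gap k / \<epsilon>)"
        using pos' eps by (subst ln_le_cancel_iff) (auto simp: divide_right_mono)
      thus ?thesis using s by (simp add: \<Phi>_def)
    next
      assume s: "gap (Suc k) \<le> 93 / 100 * gap k"
      have "gap (Suc k) / \<epsilon> \<le> 93 / 100 * (gap k / \<epsilon>)"
        using s eps by (simp add: field_simps)
      hence "ln (gap (Suc k) / \<epsilon>) \<le> ln (93 / 100 * (gap k / \<epsilon>))"
        using pos' by (subst ln_le_cancel_iff) auto
      also have "\<dots> = ln (93 / 100) + ln (gap k / \<epsilon>)" using pos' by (intro ln_mult_pos) auto
      also have "ln (93 / 100 :: real) \<le> 93 / 100 - 1" by (rule ln_le_minus_one) simp
      finally have "15 * ln (gap (Suc k) / \<epsilon>) \<le> 15 * ln (gap k / \<epsilon>) - 1" by simp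
      moreover have "gap (Suc k) \<le> gap k" using s pos eps by simp
      ultimately show ?thesis by (simp add: \<Phi>_def)
    qed
    with Suc show ?case by simp
  qed simp
  from this[of K'] have 1: "\<Phi> K' \<le> \<Phi> 0 - real K'" by simp
  have K': "gap K' > \<epsilon>" "gap 0 > \<epsilon>" using big Suc by auto
  hence "\<Phi> K' > 0" using eps by (simp add: \<Phi>_def add_pos_pos)
  with 1 have "real K' \<le> \<Phi> 0" by simp
  also have "\<Phi> 0 = 50 * gap 0 + 15 * (ln (gap 0) + ln (1 / \<epsilon>))"
    using K' eps by (simp add: \<Phi>_def ln_div)
  also have "ln (gap 0) \<le> gap 0" using ln_le_minus_one[of "gap 0"] K' eps by simp
  finally show ?thesis using Suc by simp
qed


subsection \<open>Finitely supported sequences\<close>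

text \<open>
  The dimension is a variable of the statement, so coordinate vectors of all dimensions are
  embedded into one inner product space.
\<close>

typedef fseq = "{f :: nat \<Rightarrow> real. finite {i. f i \<noteq> 0}}"
  morphisms coord Abs_fseq
  by (rule exI[of _ "\<lambda>_. 0"]) simp

setup_lifting type_definition_fseq

lemma fseq_eqI: "(\<And>i. coord x i = coord y i) \<Longrightarrow> x = y"
  by (simp add: coord_inject[symmetric] fun_eq_iff)

lemma finite_coord: "finite {i. coord x i \<noteq> 0}"
  using coord[of x] by simp

lemma finite_support_binop:
  fixes f g :: "nat \<Rightarrow> real"
  assumes "finite {i. f i \<noteq> 0}" "finite {i. g i \<noteq> 0}" "h 0 0 = 0"
  shows "finite {i. h (f i) (g i) \<noteq> (0 :: real)}"
  by (rule finite_subset[OF _ finite_UnI[OF assms(1,2)]]) (use assms(3) in force)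

instantiation fseq :: real_vector
begin

lift_definition zero_fseq :: fseq is "\<lambda>_. 0" by simp

lift_definition plus_fseq :: "fseq \<Rightarrow> fseq \<Rightarrow> fseq" is "\<lambda>f g i. f i + g i"
  by (rule finite_support_binop[where h = "(+)"]) auto

lift_definition uminus_fseq :: "fseq \<Rightarrow> fseq" is "\<lambda>f i. - f i" by simp

lift_definition minus_fseq :: "fseq \<Rightarrow> fseq \<Rightarrow> fseq" is "\<lambda>f g i. f i - g i"
  by (rule finite_support_binop[where h = "(-)"]) auto

lift_definition scaleR_fseq :: "real \<Rightarrow> fseq \<Rightarrow> fseq" is "\<lambda>c f i. c * f i"
  by (rule finite_subset) auto

instance
  by standard (transfer; simp add: fun_eq_iff algebra_simps)+

end

lemma coord_simps [simp]:
  "coord 0 i = 0" "coord (x + y) i = coord x i + coord y i" "coord (- x) i = - coord x i"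
  "coord (x - y) i = coord x i - coord y i" "coord (c *\<^sub>R x) i = c * coord x i"
  by (transfer; simp)+

lemma coord_sum: "coord (\<Sum>j\<in>I. f j) i = (\<Sum>j\<in>I. coord (f j) i)"
  by (induction I rule: infinite_finite_induct) auto

instantiation fseq :: real_inner
begin

definition inner_fseq :: "fseq \<Rightarrow> fseq \<Rightarrow> real" where
  "inner_fseq x y = (\<Sum>i | coord x i \<noteq> 0. coord x i * coord y i)"

definition norm_fseq :: "fseq \<Rightarrow> real" where
  "norm_fseq x = sqrt (inner x x)"

definition dist_fseq :: "fseq \<Rightarrow> fseq \<Rightarrow> real" where
  "dist_fseq x y = norm (x - y)"

definition sgn_fseq :: "fseq \<Rightarrow> fseq" where
  "sgn_fseq x = x /\<^sub>R norm x"

definition uniformity_fseq :: "(fseq \<times> fseq) filter" where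
  "uniformity_fseq = (INF e\<in>{0<..}. principal {(x, y). dist x y < e})"

definition open_fseq :: "fseq set \<Rightarrow> bool" where
  "open_fseq U = (\<forall>x\<in>U. eventually (\<lambda>(x', y). x' = x \<longrightarrow> y \<in> U) uniformity)"

lemma inner_fseq_eq:
  assumes "finite I" "{i. coord x i \<noteq> 0} \<subseteq> I"
  shows "inner x y = (\<Sum>i\<in>I. coord x i * coord y i)"
  unfolding inner_fseq_def using assms by (intro sum.mono_neutral_left) auto

instance
proof
  fix x y z :: fseq and r :: real
  define I where "I = {i. coord x i \<noteq> 0} \<union> {i. coord y i \<noteq> 0}"
  have I: "finite I" "{i. coord x i \<noteq> 0} \<subseteq> I" "{i. coord y i \<noteq> 0} \<subseteq> I"
    by (auto simp: I_def finite_coord)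
  show "dist x y = norm (x - y)" by (simp add: dist_fseq_def)
  show "sgn x = x /\<^sub>R norm x" by (simp add: sgn_fseq_def)
  show "(uniformity :: (fseq \<times> fseq) filter) = (INF e\<in>{0<..}. principal {(x, y). dist x y < e})"
    by (simp add: uniformity_fseq_def)
  show "open U = (\<forall>x\<in>U. eventually (\<lambda>(x', y). x' = x \<longrightarrow> y \<in> U) uniformity)" for U :: "fseq set"
    by (simp add: open_fseq_def)
  show "inner x y = inner y x"
    using inner_fseq_eq[OF I(1,2)] inner_fseq_eq[OF I(1,3)] by (simp add: mult.commute)
  show "inner (x + y) z = inner x z + inner y z"
  proof -
    have "{i. coord (x + y) i \<noteq> 0} \<subseteq> I" by (auto simp: I_def)
    from inner_fseq_eq[OF I(1) this] show ?thesis
      using inner_fseq_eq[OF I(1,2)] inner_fseq_eq[OF I(1,3)] by (simp add: distrib_right sum.distrib)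
  qed
  show "inner (r *\<^sub>R x) y = r * inner x y"
  proof -
    have "{i. coord (r *\<^sub>R x) i \<noteq> 0} \<subseteq> I" by (auto simp: I_def)
    from inner_fseq_eq[OF I(1) this] show ?thesis
      using inner_fseq_eq[OF I(1,2)] by (simp add: sum_distrib_left mult.assoc)
  qed
  show "0 \<le> inner x x" by (simp add: inner_fseq_def sum_nonneg)
  show "inner x x = 0 \<longleftrightarrow> x = 0"
  proof
    assume "inner x x = 0"
    hence "\<forall>i\<in>{i. coord x i \<noteq> 0}. coord x i * coord x i = 0"
      unfolding inner_fseq_def by (subst (asm) sum_nonneg_eq_0_iff) (auto simp: finite_coord)
    thus "x = 0" by (intro fseq_eqI) auto
  qed (simp add: inner_fseq_def)
  show "norm x = sqrt (inner x x)" by (simp add: norm_fseq_def)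
qed

end

section \<open>Vectors of a fixed dimension inside the sequence space\<close>

definition supported :: "nat \<Rightarrow> fseq set" where
  "supported d = {x. \<forall>i\<ge>d. coord x i = 0}"

lemma supported_simps [simp]:
  "0 \<in> supported d" "x \<in> supported d \<Longrightarrow> y \<in> supported d \<Longrightarrow> x + y \<in> supported d"
  "x \<in> supported d \<Longrightarrow> y \<in> supported d \<Longrightarrow> x - y \<in> supported d"
  "x \<in> supported d \<Longrightarrow> c *\<^sub>R x \<in> supported d" "x \<in> supported d \<Longrightarrow> - x \<in> supported d"
  by (auto simp: supported_def)

lemma supported_sum: "(\<And>j. j \<in> I \<Longrightarrow> f j \<in> supported d) \<Longrightarrow> (\<Sum>j\<in>I. f j) \<in> supported d"
  by (induction I rule: infinite_finite_induct) auto

lemma inner_supported: "x \<in> supported d \<Longrightarrow> inner x y = (\<Sum>i<d. coord x i * coord y i)"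
  by (rule inner_fseq_eq) (auto simp: supported_def not_le[symmetric])

definition emb :: "real vec \<Rightarrow> fseq" where
  "emb v = Abs_fseq (\<lambda>i. if i < dim_vec v then v $ i else 0)"

definition prj :: "nat \<Rightarrow> fseq \<Rightarrow> real vec" where
  "prj d x = vec d (coord x)"

lemma coord_emb: "coord (emb v) i = (if i < dim_vec v then v $ i else 0)"
  unfolding emb_def by (subst Abs_fseq_inverse) (auto intro: finite_subset[of _ "{..<dim_vec v}"])

lemma emb_supported [simp]: "v \<in> carrier_vec d \<Longrightarrow> emb v \<in> supported d"
  by (auto simp: supported_def coord_emb)

lemma prj_carrier [simp]: "prj d x \<in> carrier_vec d"
  by (simp add: prj_def)

lemma emb_prj: "x \<in> supported d \<Longrightarrow> emb (prj d x) = x"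
  by (rule fseq_eqI) (auto simp: coord_emb prj_def supported_def)

lemma prj_emb: "v \<in> carrier_vec d \<Longrightarrow> prj d (emb v) = v"
  by (rule eq_vecI) (auto simp: coord_emb prj_def)

lemma emb_inject: "v \<in> carrier_vec d \<Longrightarrow> w \<in> carrier_vec d \<Longrightarrow> emb v = emb w \<longleftrightarrow> v = w"
  by (metis prj_emb)

lemma emb_add: "v \<in> carrier_vec d \<Longrightarrow> w \<in> carrier_vec d \<Longrightarrow> emb (v + w) = emb v + emb w"
  by (rule fseq_eqI) (auto simp: coord_emb)

lemma emb_minus: "v \<in> carrier_vec d \<Longrightarrow> w \<in> carrier_vec d \<Longrightarrow> emb (v - w) = emb v - emb w"
  by (rule fseq_eqI) (auto simp: coord_emb)

lemma emb_smult: "emb (c \<cdot>\<^sub>v v) = c *\<^sub>R emb v"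
  by (rule fseq_eqI) (auto simp: coord_emb)

lemma emb_zero [simp]: "emb (0\<^sub>v d) = 0"
  by (rule fseq_eqI) (auto simp: coord_emb)

lemma emb_inner: "v \<in> carrier_vec d \<Longrightarrow> w \<in> carrier_vec d \<Longrightarrow> v \<bullet> w = inner (emb v) (emb w)"
  by (simp add: inner_supported[of _ d] scalar_prod_def coord_emb atLeast0LessThan)

lemma emb_norm: "vec_norm v = norm (emb v)"
proof -
  have "v \<in> carrier_vec (dim_vec v)" by simp
  from emb_inner[OF this this] show ?thesis by (simp add: vec_norm_def norm_eq_sqrt_inner)
qed

abbreviation axis_seq :: "nat \<Rightarrow> nat \<Rightarrow> fseq" where
  "axis_seq d i \<equiv> emb (unit_vec d i)"

lemma inner_axis: "i < d \<Longrightarrow> inner (axis_seq d i) x = coord x i"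
proof -
  assume i: "i < d"
  have "inner (axis_seq d i) x = (\<Sum>j<d. coord (axis_seq d i) j * coord x j)"
    by (rule inner_supported) simp
  also have "\<dots> = (\<Sum>j<d. if i = j then coord x j else 0)"
    by (intro sum.cong) (auto simp: coord_emb unit_vec_def)
  also have "\<dots> = coord x i" using i by (simp add: sum.delta)
  finally show ?thesis .
qed

lemma axis_expansion: "x \<in> supported d \<Longrightarrow> x = (\<Sum>j<d. coord x j *\<^sub>R axis_seq d j)"
proof (rule fseq_eqI)
  fix i assume x: "x \<in> supported d"
  have "coord (\<Sum>j<d. coord x j *\<^sub>R axis_seq d j) i = (\<Sum>j<d. if j = i then coord x i else 0)"
    unfolding coord_sum by (intro sum.cong) (auto simp: coord_emb unit_vec_def)
  also have "\<dots> = coord x i" using x by (auto simp: sum.delta supported_def)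
  finally show "coord x i = coord (\<Sum>j<d. coord x j *\<^sub>R axis_seq d j) i" ..
qed

lemma abs_coord_le_norm: "\<bar>coord x i\<bar> \<le> norm x"
proof -
  have "coord x i = inner (axis_seq (Suc i) i) x" by (simp add: inner_axis)
  also have "\<bar>\<dots>\<bar> \<le> norm (axis_seq (Suc i) i) * norm x" by (rule Cauchy_Schwarz_ineq2)
  also have "norm (axis_seq (Suc i) i) = 1"
    by (simp add: norm_eq_sqrt_inner inner_axis coord_emb)
  finally show ?thesis by simp
qed

text \<open>The sequence space is not complete, so limits are only taken inside one
  \<open>supported d\<close>, where convergence of the finitely many coordinates suffices.\<close>

lemma tendsto_fseqI:
  assumes "\<And>k. X k \<in> supported d" "x \<in> supported d" "\<And>i. i < d \<Longrightarrow> (\<lambda>k. coord (X k) i) \<longlonglongrightarrow> coord x i"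
  shows "X \<longlonglongrightarrow> x"
proof -
  have "(\<lambda>k. \<Sum>i<d. (coord (X k) i - coord x i) * (coord (X k) i - coord x i)) \<longlonglongrightarrow>
      (\<Sum>i<d. (coord x i - coord x i) * (coord x i - coord x i))"
    by (intro tendsto_sum tendsto_mult tendsto_diff assms tendsto_const) auto
  moreover have "(norm (X k - x))\<^sup>2 = (\<Sum>i<d. (coord (X k) i - coord x i) * (coord (X k) i - coord x i))" for k
    using assms by (simp add: power2_norm_eq_inner inner_supported[of _ d])
  ultimately have "(\<lambda>k. (norm (X k - x))\<^sup>2) \<longlonglongrightarrow> 0" by simp
  hence "(\<lambda>k. sqrt ((norm (X k - x))\<^sup>2)) \<longlonglongrightarrow> sqrt 0" by (rule tendsto_real_sqrt)
  thus ?thesis by (simp add: tendsto_norm_zero_iff flip: LIM_zero_iff[of X x])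
qed

subsection \<open>Derivatives and minimizers in coordinates\<close>

lemma reg_logistic_line_deriv:
  "((\<lambda>s. reg_logistic J c a lam (w + s *\<^sub>R h)) has_real_derivative inner (reg_grad J c a lam w) h) (at 0)"
proof -
  have n: "(norm (w + s *\<^sub>R h))\<^sup>2 = (norm w)\<^sup>2 + 2 * s * inner w h + s\<^sup>2 * (norm h)\<^sup>2" for s
    unfolding power2_norm_eq_inner
    by (simp add: inner_add_left inner_add_right inner_commute[of h w] power2_eq_square algebra_simps)
  have "((\<lambda>s. (\<Sum>j\<in>J. c * logistic (inner (a j) w + s * inner (a j) h))
      + lam / 2 * ((norm w)\<^sup>2 + 2 * s * inner w h + s\<^sup>2 * (norm h)\<^sup>2)) has_real_derivative
      (\<Sum>j\<in>J. c * (logistic1 (inner (a j) w + 0 * inner (a j) h) * inner (a j) h)) + lam / 2 * (2 * inner w h)) (at 0)"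
    by (auto intro!: derivative_eq_intros sum.cong simp: algebra_simps)
  thus ?thesis
    unfolding reg_logistic_def n
    by (simp add: inner_add_right reg_grad_def inner_add_left inner_sum_left mult.assoc)
qed

lemma reg_grad_line_deriv:
  "((\<lambda>s. inner x (reg_grad J c a lam (w + s *\<^sub>R h))) has_real_derivative inner x (reg_hess J c a lam w h)) (at 0)"
proof -
  have "((\<lambda>s. (\<Sum>j\<in>J. c * logistic1 (inner (a j) w + s * inner (a j) h) * inner x (a j))
      + lam * (inner x w + s * inner x h)) has_real_derivative
      (\<Sum>j\<in>J. c * (logistic2 (inner (a j) w + 0 * inner (a j) h) * inner (a j) h) * inner x (a j)) + lam * inner x h) (at 0)"
    by (auto intro!: derivative_eq_intros sum.cong simp: algebra_simps)
  thus ?thesis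
    unfolding reg_grad_def reg_hess_def
    by (simp add: inner_add_right inner_sum_right mult.assoc)
qed

text \<open>Ties an objective on vectors to its counterpart on sequences. Agreement is required on
  \<open>carrier_vec d\<close> only; as the data lie in \<open>supported d\<close>, gradients and
  Hessians at supported points do not leave that subspace.\<close>

locale coordinate_objective = logistic_objective J c a lam
  for J :: "'j set" and c :: real and a :: "'j \<Rightarrow> fseq" and lam :: real +
  fixes d :: nat and F :: "real vec \<Rightarrow> real"
  assumes F_eq: "w \<in> carrier_vec d \<Longrightarrow> F w = f (emb w)"
    and a_supp: "j \<in> J \<Longrightarrow> a j \<in> supported d"
begin

lemma g_supp: "x \<in> supported d \<Longrightarrow> g x \<in> supported d"
  unfolding reg_grad_def by (intro supported_simps supported_sum a_supp) auto

lemma H_supp: "x \<in> supported d \<Longrightarrow> H w x \<in> supported d"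
  unfolding reg_hess_def by (intro supported_simps supported_sum a_supp) auto

lemma emb_line: "w \<in> carrier_vec d \<Longrightarrow> emb (w + s \<cdot>\<^sub>v unit_vec d i) = emb w + s *\<^sub>R axis_seq d i"
  by (simp add: emb_add[of _ d] emb_smult)

lemma gradient_eq:
  assumes w: "w \<in> carrier_vec d"
  shows "gradient d F w = prj d (g (emb w))"
proof (rule eq_vecI)
  fix i assume "i < dim_vec (prj d (g (emb w)))"
  hence i: "i < d" by (simp add: prj_def)
  have "(\<lambda>s. F (w + s \<cdot>\<^sub>v unit_vec d i)) = (\<lambda>s. f (emb w + s *\<^sub>R axis_seq d i))"
    using w by (simp add: F_eq emb_line fun_eq_iff)
  with reg_logistic_line_deriv[of J c a lam "emb w" "axis_seq d i"]
  have "deriv (\<lambda>s. F (w + s \<cdot>\<^sub>v unit_vec d i)) 0 = inner (g (emb w)) (axis_seq d i)"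
    by (simp add: DERIV_imp_deriv)
  thus "gradient d F w $ i = prj d (g (emb w)) $ i"
    using i by (simp add: gradient_def prj_def inner_axis inner_commute[of "g _"])
qed (simp add: gradient_def prj_def)

lemma gradient_carrier [simp]: "gradient d F w \<in> carrier_vec d"
  by (simp add: gradient_def)

lemma emb_gradient: "w \<in> carrier_vec d \<Longrightarrow> emb (gradient d F w) = g (emb w)"
  by (simp add: gradient_eq emb_prj g_supp)

lemma hessian_carrier [simp]: "hessian d F w \<in> carrier_mat d d"
  by (simp add: hessian_def)

lemma hessian_entry:
  assumes w: "w \<in> carrier_vec d" and ij: "i < d" "j < d"
  shows "hessian d F w $$ (i, j) = coord (H (emb w) (axis_seq d j)) i"
proof -
  have "(\<lambda>s. gradient d F (w + s \<cdot>\<^sub>v unit_vec d j) $ i)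
      = (\<lambda>s. inner (axis_seq d i) (g (emb w + s *\<^sub>R axis_seq d j)))"
    using w ij by (auto simp: fun_eq_iff gradient_eq emb_line inner_axis prj_def)
  with reg_grad_line_deriv[of "axis_seq d i" J c a lam "emb w" "axis_seq d j"]
  have "deriv (\<lambda>s. gradient d F (w + s \<cdot>\<^sub>v unit_vec d j) $ i) 0
      = inner (axis_seq d i) (H (emb w) (axis_seq d j))"
    by (simp add: DERIV_imp_deriv)
  thus ?thesis using ij by (simp add: hessian_def inner_axis)
qed

lemma hess_sum: "H w (\<Sum>j\<in>I. x j) = (\<Sum>j\<in>I. H w (x j))"
  by (induction I rule: infinite_finite_induct) (use hess_add hess_scale[of w 0 0] in auto)

lemma emb_hessian_mult:
  assumes w: "w \<in> carrier_vec d" and v: "v \<in> carrier_vec d"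
  shows "emb (hessian d F w *\<^sub>v v) = H (emb w) (emb v)"
proof (rule fseq_eqI)
  fix i
  show "coord (emb (hessian d F w *\<^sub>v v)) i = coord (H (emb w) (emb v)) i"
  proof (cases "i < d")
    case True
    have "dim_row (hessian d F w) = d" "dim_col (hessian d F w) = d" by (simp_all add: hessian_def)
    hence "coord (emb (hessian d F w *\<^sub>v v)) i = (\<Sum>j<d. coord (H (emb w) (axis_seq d j)) i * v $ j)"
      using True w v
      by (simp add: coord_emb mult_mat_vec_def scalar_prod_def hessian_entry atLeast0LessThan)
    also have "\<dots> = coord (\<Sum>j<d. H (emb w) (coord (emb v) j *\<^sub>R axis_seq d j)) i"
      using v by (simp add: coord_sum hess_scale coord_emb mult.commute)
    also have "\<dots> = coord (H (emb w) (emb v)) i"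
      using axis_expansion[of "emb v" d] v by (simp flip: hess_sum)
    finally show ?thesis .
  next
    case False
    moreover have "H (emb w) (emb v) \<in> supported d" using v by (intro H_supp) simp
    ultimately show ?thesis by (auto simp: coord_emb supported_def hessian_def)
  qed
qed

lemma gradient_zero_minimizes: "g x = 0 \<Longrightarrow> f x \<le> f y"
proof -
  assume "g x = 0"
  with strong_convexity[of x "y - x"] have "f x + lam / 2 * (norm (y - x))\<^sup>2 \<le> f y" by simp
  moreover have "0 \<le> lam / 2 * (norm (y - x))\<^sup>2" using lam_pos by simp
  ultimately show ?thesis by linarith
qed

text \<open>\<open>arg_min_on\<close> chooses some minimizer; strong convexity makes it unique, so
  that a zero of the gradient identifies the choice.\<close>

lemma minimizer_eq:
  assumes x: "x \<in> supported d" "g x = 0"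
  shows "minimizer d F = prj d x"
proof -
  let ?w = "prj d x"
  have ex: "emb ?w = x" using x by (simp add: emb_prj)
  have min: "is_arg_min F (\<lambda>w. w \<in> carrier_vec d) ?w"
    using gradient_zero_minimizes[OF x(2)] by (auto simp: is_arg_min_def F_eq ex not_less)
  have "w = ?w" if "is_arg_min F (\<lambda>w. w \<in> carrier_vec d) w" for w
  proof -
    have w: "w \<in> carrier_vec d" "F w \<le> F ?w" using that by (auto simp: is_arg_min_def not_less)
    with strong_convexity[of x "emb w - x"] have "lam / 2 * (norm (emb w - x))\<^sup>2 \<le> 0"
      by (simp add: F_eq ex x)
    hence "emb w = x" using lam_pos by (simp add: mult_le_0_iff)
    thus ?thesis using w by (metis prj_emb)
  qed
  with min show ?thesis
    unfolding minimizer_def arg_min_on_def arg_min_def by (metis someI_ex)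
qed

text \<open>
  Gradient descent is a contraction; its limit provides existence of the minimizer and, through
  the explicit iterates, measurability in the data.
\<close>

definition lipschitz_const :: real where
  "lipschitz_const = lam + (\<Sum>j\<in>J. c * (norm (a j))\<^sup>2)"

primrec descent :: "nat \<Rightarrow> fseq" where
  "descent 0 = 0"
| "descent (Suc k) = descent k - (lam / lipschitz_const\<^sup>2) *\<^sub>R g (descent k)"

lemma lam_le_lipschitz: "lam \<le> lipschitz_const"
  using c_nonneg by (auto simp: lipschitz_const_def intro!: sum_nonneg)

lemma grad_lipschitz: "norm (g x - g y) \<le> lipschitz_const * norm (x - y)"
proof -
  have eq: "g x - g y = (\<Sum>j\<in>J. (c * (logistic1 (inner (a j) x) - logistic1 (inner (a j) y))) *\<^sub>R a j) + lam *\<^sub>R (x - y)"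
    by (simp add: reg_grad_def right_diff_distrib scaleR_left_diff_distrib scaleR_right_diff_distrib sum_subtractf)
  have "norm (g x - g y) \<le> (\<Sum>j\<in>J. norm ((c * (logistic1 (inner (a j) x) - logistic1 (inner (a j) y))) *\<^sub>R a j)) + norm (lam *\<^sub>R (x - y))"
    unfolding eq by (intro order_trans[OF norm_triangle_ineq] add_mono norm_sum) auto
  also have "\<dots> \<le> (\<Sum>j\<in>J. c * (norm (a j))\<^sup>2 * norm (x - y)) + lam * norm (x - y)"
  proof (intro add_mono sum_mono)
    fix j
    have "\<bar>logistic1 (inner (a j) x) - logistic1 (inner (a j) y)\<bar> \<le> 1 / 4 * \<bar>inner (a j) x - inner (a j) y\<bar>"
      by (rule logistic1_lipschitz)
    also have "\<dots> \<le> \<bar>inner (a j) (x - y)\<bar>" by (simp add: inner_diff_right)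
    also have "\<dots> \<le> norm (a j) * norm (x - y)" by (rule Cauchy_Schwarz_ineq2)
    finally have "\<bar>logistic1 (inner (a j) x) - logistic1 (inner (a j) y)\<bar> * norm (a j) \<le> norm (a j) * norm (x - y) * norm (a j)"
      by (intro mult_right_mono) auto
    from mult_left_mono[OF this c_nonneg]
    show "norm ((c * (logistic1 (inner (a j) x) - logistic1 (inner (a j) y))) *\<^sub>R a j) \<le> c * (norm (a j))\<^sup>2 * norm (x - y)"
      using c_nonneg by (simp add: abs_mult power2_eq_square mult_ac)
  qed (use lam_pos in auto)
  finally show ?thesis by (simp add: lipschitz_const_def distrib_right sum_distrib_right)
qed

lemma grad_strongly_monotone: "lam * (norm (x - y))\<^sup>2 \<le> inner (g x - g y) (x - y)"
proof -
  have "f x + inner (g x) (y - x) + lam / 2 * (norm (y - x))\<^sup>2 \<le> f y"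
    using strong_convexity[of x "y - x"] by simp
  moreover have "f y + inner (g y) (x - y) + lam / 2 * (norm (x - y))\<^sup>2 \<le> f x"
    using strong_convexity[of y "x - y"] by simp
  moreover have "inner (g x) (y - x) = - inner (g x) (x - y)" by (simp add: inner_diff_right)
  ultimately show ?thesis by (simp add: inner_diff_left norm_minus_commute)
qed

lemma descent_supp: "descent k \<in> supported d"
  by (induction k) (auto intro!: supported_simps g_supp)

text \<open>Consecutive differences decay geometrically, so every coordinate converges as a summable
  telescoping series; this replaces completeness of the space. The limit is stationary because the
  gradients are multiples of these differences.\<close>

lemma descent_converges: "\<exists>x\<in>supported d. descent \<longlonglongrightarrow> x \<and> g x = 0"
proof -
  define K where "K = lipschitz_const"
  \<comment> \<open>This step minimizes 1 - 2 \<tau> lam + \<tau>^2 K^2, the bound on the squared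
    contraction factor, with value 1 - lam^2 / K^2.\<close>
  define \<tau> where "\<tau> = lam / K\<^sup>2"
  have K: "K > 0" "lam \<le> K" using lam_le_lipschitz lam_pos by (auto simp: K_def)
  have \<tau>: "\<tau> > 0" using K lam_pos by (simp add: \<tau>_def)
  define q where "q = sqrt (1 - lam\<^sup>2 / K\<^sup>2)"
  have "lam\<^sup>2 \<le> K\<^sup>2" using K lam_pos by (intro power_mono) auto
  hence q2: "0 \<le> 1 - lam\<^sup>2 / K\<^sup>2" "1 - lam\<^sup>2 / K\<^sup>2 < 1" using K lam_pos by auto
  hence q: "0 \<le> q" "q < 1" by (auto simp: q_def)
  have contr: "norm ((x - \<tau> *\<^sub>R g x) - (y - \<tau> *\<^sub>R g y)) \<le> q * norm (x - y)" for x y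
  proof (rule power2_le_imp_le)
    have "(norm ((x - \<tau> *\<^sub>R g x) - (y - \<tau> *\<^sub>R g y)))\<^sup>2 = (norm ((x - y) - \<tau> *\<^sub>R (g x - g y)))\<^sup>2"
      by (simp add: algebra_simps)
    also have "\<dots> = (norm (x - y))\<^sup>2 - 2 * \<tau> * inner (g x - g y) (x - y) + \<tau>\<^sup>2 * (norm (g x - g y))\<^sup>2"
      unfolding power2_norm_eq_inner
      by (simp add: inner_diff_left inner_diff_right inner_commute power2_eq_square algebra_simps)
    also have "\<dots> \<le> (norm (x - y))\<^sup>2 - 2 * \<tau> * (lam * (norm (x - y))\<^sup>2) + \<tau>\<^sup>2 * (K * norm (x - y))\<^sup>2"
      using \<tau> grad_strongly_monotone[of x y] grad_lipschitz[of x y]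
      by (intro add_mono diff_mono mult_left_mono power_mono) (auto simp: K_def)
    also have "\<dots> = (1 - lam\<^sup>2 / K\<^sup>2) * (norm (x - y))\<^sup>2"
    proof -
      have "\<tau>\<^sup>2 * (K * norm (x - y))\<^sup>2 = lam\<^sup>2 / K\<^sup>2 * (norm (x - y))\<^sup>2"
        using K by (simp add: \<tau>_def power_mult_distrib power_divide power2_eq_square)
      moreover have "2 * \<tau> * (lam * (norm (x - y))\<^sup>2) = 2 * (lam\<^sup>2 / K\<^sup>2 * (norm (x - y))\<^sup>2)"
        by (simp add: \<tau>_def power2_eq_square)
      ultimately show ?thesis by (simp add: algebra_simps)
    qed
    finally show "(norm ((x - \<tau> *\<^sub>R g x) - (y - \<tau> *\<^sub>R g y)))\<^sup>2 \<le> (q * norm (x - y))\<^sup>2"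
      using q2 by (simp add: power_mult_distrib q_def)
  qed (use q in auto)
  have step: "descent (Suc k) = descent k - \<tau> *\<^sub>R g (descent k)" for k
    by (simp add: \<tau>_def K_def)
  define C where "C = norm (descent 1 - descent 0)"
  have diff: "norm (descent (Suc k) - descent k) \<le> C * q ^ k" for k
  proof (induction k)
    case (Suc k)
    have "norm (descent (Suc (Suc k)) - descent (Suc k)) \<le> q * norm (descent (Suc k) - descent k)"
      using contr[of "descent (Suc k)" "descent k"] by (simp only: step)
    also have "\<dots> \<le> q * (C * q ^ k)" using Suc q by (intro mult_left_mono)
    finally show ?case by (simp add: mult_ac)
  qed (simp add: C_def)
  have conv: "convergent (\<lambda>k. coord (descent k) i)" for i
  proof -
    have "summable (\<lambda>k. coord (descent (Suc k)) i - coord (descent k) i)"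
    proof (rule summable_comparison_test)
      show "summable (\<lambda>k. C * q ^ k)" using q by (intro summable_mult summable_geometric) auto
      show "\<exists>N. \<forall>k\<ge>N. norm (coord (descent (Suc k)) i - coord (descent k) i) \<le> C * q ^ k"
      proof (intro exI allI impI)
        fix k
        show "norm (coord (descent (Suc k)) i - coord (descent k) i) \<le> C * q ^ k"
          using order_trans[OF abs_coord_le_norm[of "descent (Suc k) - descent k" i] diff[of k]]
          by (simp only: coord_simps real_norm_def)
      qed
    qed
    hence "convergent (\<lambda>n. \<Sum>k<n. coord (descent (Suc k)) i - coord (descent k) i)"
      by (simp only: summable_iff_convergent)
    moreover have "(\<Sum>k<n. coord (descent (Suc k)) i - coord (descent k) i) = coord (descent n) i" for n
      using sum_lessThan_telescope[of "\<lambda>k. coord (descent k) i" n] by simp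
    ultimately show ?thesis by simp
  qed
  define x where "x = emb (vec d (\<lambda>i. lim (\<lambda>k. coord (descent k) i)))"
  have x: "x \<in> supported d" by (simp add: x_def)
  have lim: "descent \<longlonglongrightarrow> x"
  proof (rule tendsto_fseqI[of _ d])
    fix i assume "i < d"
    thus "(\<lambda>k. coord (descent k) i) \<longlonglongrightarrow> coord x i"
      using conv[of i] by (simp add: x_def coord_emb convergent_LIMSEQ_iff)
  qed (use x descent_supp in auto)
  have "(\<lambda>k. norm (g (descent k) - g x)) \<longlonglongrightarrow> 0"
  proof (rule tendsto_sandwich[OF _ _ tendsto_const])
    have "(\<lambda>k. K * norm (descent k - x)) \<longlonglongrightarrow> K * 0"
      using lim by (intro tendsto_mult tendsto_const) (simp add: tendsto_norm_zero_iff LIM_zero_iff)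
    thus "(\<lambda>k. K * norm (descent k - x)) \<longlonglongrightarrow> 0" by simp
  qed (use grad_lipschitz in \<open>auto simp: K_def\<close>)
  hence g1: "(\<lambda>k. g (descent k)) \<longlonglongrightarrow> g x"
    by (simp add: tendsto_norm_zero_iff flip: LIM_zero_iff[of "\<lambda>k. g (descent k)"])
  have "(\<lambda>k. (1 / \<tau>) *\<^sub>R (descent k - descent (Suc k))) \<longlonglongrightarrow> (1 / \<tau>) *\<^sub>R (x - x)"
    by (intro tendsto_scaleR tendsto_const tendsto_diff lim LIMSEQ_Suc[OF lim])
  moreover have "(1 / \<tau>) *\<^sub>R (descent k - descent (Suc k)) = g (descent k)" for k
    using \<tau> by (simp add: step del: descent.simps)
  ultimately have "(\<lambda>k. g (descent k)) \<longlonglongrightarrow> 0" by simp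
  with g1 have "g x = 0" by (rule LIMSEQ_unique)
  with x lim show ?thesis by blast
qed

lemma minimizer_descent_limit:
  assumes "i < d" shows "(\<lambda>k. coord (descent k) i) \<longlonglongrightarrow> minimizer d F $ i"
proof -
  obtain x where x: "x \<in> supported d" "descent \<longlonglongrightarrow> x" "g x = 0" using descent_converges by blast
  have "(\<lambda>k. \<bar>coord (descent k) i - coord x i\<bar>) \<longlonglongrightarrow> 0"
  proof (rule tendsto_sandwich[OF _ _ tendsto_const])
    show "(\<lambda>k. norm (descent k - x)) \<longlonglongrightarrow> 0" using x(2) by (simp add: tendsto_norm_zero_iff LIM_zero_iff)
    show "eventually (\<lambda>k. \<bar>coord (descent k) i - coord x i\<bar> \<le> norm (descent k - x)) sequentially"
      using abs_coord_le_norm[of "descent _ - x" i] by simp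
  qed auto
  hence "(\<lambda>k. coord (descent k) i) \<longlonglongrightarrow> coord x i"
    by (simp add: tendsto_rabs_zero_iff LIM_zero_iff)
  thus ?thesis using assms by (simp add: minimizer_eq[OF x(1,3)] prj_def)
qed

lemma minimizer_props:
  shows "minimizer d F \<in> carrier_vec d" "g (emb (minimizer d F)) = 0"
    "f (emb (minimizer d F)) \<le> f y"
proof -
  obtain x where x: "x \<in> supported d" "g x = 0" using descent_converges by blast
  show "minimizer d F \<in> carrier_vec d" "g (emb (minimizer d F)) = 0"
    "f (emb (minimizer d F)) \<le> f y"
    using x gradient_zero_minimizes[OF x(2)] by (simp_all add: minimizer_eq[OF x] emb_prj)
qed

end

subsection \<open>Positive definite matrices\<close>

text \<open>Injectivity gives a nonzero determinant and hence an inverse. The last conclusion,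
  Cramer's rule, is there for measurability: it writes the entries of the inverse as quotients of
  polynomials in the entries of \<open>A\<close>.\<close>

lemma mat_inverse_posdef:
  fixes A :: "real mat"
  assumes A: "A \<in> carrier_mat d d"
    and inj: "\<And>v. v \<in> carrier_vec d \<Longrightarrow> A *\<^sub>v v = 0\<^sub>v d \<Longrightarrow> v = 0\<^sub>v d"
  obtains B where "mat_inverse A = Some B" "B \<in> carrier_mat d d" "A * B = 1\<^sub>m d" "B * A = 1\<^sub>m d"
    "det A \<noteq> 0" "B = (1 / det A) \<cdot>\<^sub>m adj_mat A"
proof -
  have det: "det A \<noteq> 0" using det_0_iff_vec_prod_zero[OF A] inj by auto
  have "A \<in> Units (ring_mat TYPE(real) d ())"
    by (rule det_non_zero_imp_unit[OF A det])
  hence "mat_inverse A \<noteq> None" using mat_inverse(1)[OF A, of "()"] by blast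
  then obtain B where B: "mat_inverse A = Some B" by blast
  note B' = mat_inverse(2)[OF A B]
  note adj = adj_mat[OF A]
  have "adj_mat A = (B * A) * adj_mat A" using B' adj by simp
  also have "\<dots> = B * (A * adj_mat A)" using B' adj A by (intro assoc_mult_mat) auto
  also have "A * adj_mat A = det A \<cdot>\<^sub>m 1\<^sub>m d" using adj by simp
  also have "B * (det A \<cdot>\<^sub>m 1\<^sub>m d) = det A \<cdot>\<^sub>m B"
    using B' right_mult_one_mat[of B d d] by (simp add: mult_smult_distrib[of _ d d _ d])
  finally have "(1 / det A) \<cdot>\<^sub>m adj_mat A = (1 / det A) \<cdot>\<^sub>m (det A \<cdot>\<^sub>m B)" by simp
  also have "\<dots> = B" using det by (intro eq_matI) auto
  finally show ?thesis using that B B' det by metis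
qed


subsection \<open>DiSCO for sampled data\<close>

text \<open>With the label absorbed, the margin of a sample is a single inner product.\<close>

definition data_vec :: "nat \<Rightarrow> sample \<Rightarrow> fseq" where
  "data_vec d s = label s *\<^sub>R emb (feature d s)"

lemma feature_carrier [simp]: "feature d s \<in> carrier_vec d"
  by (simp add: feature_def)

lemma data_vec_supported [simp]: "data_vec d s \<in> supported d"
  by (simp add: data_vec_def)

lemma inner_data_vec:
  "w \<in> carrier_vec d \<Longrightarrow> label s * (w \<bullet> feature d s) = inner (data_vec d s) (emb w)"
  by (simp add: data_vec_def emb_inner[of _ d] inner_commute)

lemma scale_eta_pos: "B > 0 \<Longrightarrow> \<gamma> > 0 \<Longrightarrow> scale_eta B \<gamma> > 0"
  by (simp add: scale_eta_def)

lemma const_lambda_eq: "\<gamma> > 0 \<Longrightarrow> const_lambda B \<gamma> = B\<^sup>2 / 4"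
  by (simp add: const_lambda_def scale_eta_def)

locale disco_data =
  fixes d m n :: nat and B \<gamma> :: real and z :: "nat \<times> nat \<Rightarrow> sample"
  assumes d: "d \<ge> 1" and m: "m \<ge> 1" and n: "n \<ge> 1" and B: "B > 0" and \<gamma>: "\<gamma> > 0"
begin

abbreviation "\<eta> \<equiv> scale_eta B \<gamma>"
abbreviation "lam \<equiv> const_lambda B \<gamma>"
abbreviation "a \<equiv> \<lambda>ij. data_vec d (z ij)"

lemma lam_pos: "lam > 0" using B \<gamma> by (simp add: const_lambda_eq)

lemma local_loss_eq:
  assumes "w \<in> carrier_vec d"
  shows "local_loss d n B \<gamma> z i w = reg_logistic {1..n} (\<eta> / n) (\<lambda>j. a (i, j)) lam (emb w)"
  using assms by (simp add: local_loss_def reg_logistic_def inner_data_vec emb_norm sum_distrib_left)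

lemma local_loss_reg_eq:
  assumes "w \<in> carrier_vec d"
  shows "local_loss d n B \<gamma> z i w + \<rho> / 2 * (vec_norm w)\<^sup>2
    = reg_logistic {1..n} (\<eta> / n) (\<lambda>j. a (i, j)) (lam + \<rho>) (emb w)"
  using assms by (simp add: local_loss_eq reg_logistic_def emb_norm algebra_simps add_divide_distrib)

lemma average_obj_eq:
  assumes w: "w \<in> carrier_vec d"
  shows "average_obj m (local_loss d n B \<gamma> z) w
    = reg_logistic ({1..m} \<times> {1..n}) (\<eta> / (m * n)) a lam (emb w)"
proof -
  have "(\<Sum>ij\<in>{1..m} \<times> {1..n}. \<eta> / (real m * real n) * logistic (inner (a ij) (emb w)))
      = \<eta> / (real m * real n) * (\<Sum>i = 1..m. \<Sum>j = 1..n. logistic (inner (a (i, j)) (emb w)))"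
    by (simp add: sum_distrib_left sum.cartesian_product case_prod_beta)
  thus ?thesis
    using w m by (simp add: average_local_loss erm_loss_def reg_logistic_def inner_data_vec emb_norm
        const_lambda_def algebra_simps)
qed

sublocale loc: coordinate_objective "{1..n}" "\<eta> / n" "\<lambda>j. a (i, j)" lam d "local_loss d n B \<gamma> z i" for i
  using scale_eta_pos[OF B \<gamma>] lam_pos by unfold_locales (auto simp: local_loss_eq)

sublocale avg: coordinate_objective "{1..m} \<times> {1..n}" "\<eta> / (m * n)" a lam d
    "average_obj m (local_loss d n B \<gamma> z)"
  using scale_eta_pos[OF B \<gamma>] lam_pos by unfold_locales (auto simp: average_obj_eq)

lemma reg_objective:
  assumes "\<rho> \<ge> 0"
  shows "coordinate_objective {1..n} (\<eta> / n) (\<lambda>j. a (i, j)) (lam + \<rho>) d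
    (\<lambda>w. local_loss d n B \<gamma> z i w + \<rho> / 2 * (vec_norm w)\<^sup>2)"
proof unfold_locales
  show "local_loss d n B \<gamma> z i w + \<rho> / 2 * (vec_norm w)\<^sup>2
      = reg_logistic {1..n} (\<eta> / n) (\<lambda>j. a (i, j)) (lam + \<rho>) (emb w)" if "w \<in> carrier_vec d" for w
    by (rule local_loss_reg_eq[OF that])
qed (use scale_eta_pos[OF B \<gamma>] lam_pos assms in auto)

abbreviation "f \<equiv> reg_logistic ({1..m} \<times> {1..n}) (\<eta> / (m * n)) a lam"
abbreviation "fgrad \<equiv> reg_grad ({1..m} \<times> {1..n}) (\<eta> / (m * n)) a lam"
abbreviation "fhess \<equiv> reg_hess ({1..m} \<times> {1..n}) (\<eta> / (m * n)) a lam"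
abbreviation "lhess i \<equiv> reg_hess {1..n} (\<eta> / n) (\<lambda>j. a (i, j)) lam"
abbreviation "fs \<equiv> local_loss d n B \<gamma> z"
abbreviation "wopt \<equiv> minimizer d (average_obj m fs)"

lemma erm_minimizer_eq: "erm_minimizer d m n B \<gamma> z = wopt"
proof -
  have "(\<lambda>w. \<eta> * erm_loss d m n \<gamma> z w) = average_obj m fs"
    using m by (simp add: average_local_loss fun_eq_iff)
  thus ?thesis by (simp add: erm_minimizer_def)
qed

lemma hess_carrier: "disco_hess d m fs w \<in> carrier_mat d d"
  by (simp add: disco_hess_def)

lemma hess_mult: "w \<in> carrier_vec d \<Longrightarrow> v \<in> carrier_vec d \<Longrightarrow>
    emb (disco_hess d m fs w *\<^sub>v v) = fhess (emb w) (emb v)"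
  by (simp add: disco_hess_def avg.emb_hessian_mult)

lemma precond_carrier: "disco_precond d fs \<mu> w \<in> carrier_mat d d"
  by (simp add: disco_precond_def)

lemma precond_mult:
  assumes "w \<in> carrier_vec d" "v \<in> carrier_vec d"
  shows "emb (disco_precond d fs \<mu> w *\<^sub>v v) = lhess 1 (emb w) (emb v) + \<mu> *\<^sub>R emb v"
proof -
  have "disco_precond d fs \<mu> w *\<^sub>v v = hessian d (fs 1) w *\<^sub>v v + \<mu> \<cdot>\<^sub>v v"
  proof -
    have "(\<mu> \<cdot>\<^sub>m 1\<^sub>m d) *\<^sub>v v = \<mu> \<cdot>\<^sub>v (1\<^sub>m d *\<^sub>v v)"
      using assms by (intro eq_vecI) (auto simp: mult_mat_vec_def scalar_prod_def sum_distrib_left mult.assoc)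
    thus ?thesis using assms
      by (simp add: disco_precond_def add_mult_distrib_mat_vec[of _ d d])
  qed
  moreover have "hessian d (fs 1) w *\<^sub>v v \<in> carrier_vec d"
    using assms by (intro mult_mat_vec_carrier[of _ d d]) auto
  ultimately show ?thesis using assms
    by (simp add: emb_add[of _ d] emb_smult loc.emb_hessian_mult)
qed

lemma grad_emb: "w \<in> carrier_vec d \<Longrightarrow> emb (disco_grad d m fs w) = fgrad (emb w)"
  by (simp add: disco_grad_def avg.emb_gradient)

lemma grad_carrier: "disco_grad d m fs w \<in> carrier_vec d"
  by (simp add: disco_grad_def)

lemma quad_pos:
  assumes "v \<noteq> 0" shows "0 < inner v (fhess w v)" "\<mu> \<ge> 0 \<Longrightarrow> 0 < inner v (lhess i w v + \<mu> *\<^sub>R v)"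
proof -
  have l: "0 < lam * (norm v)\<^sup>2" using assms lam_pos by simp
  with avg.hess_lower[of v w] show "0 < inner v (fhess w v)" by linarith
  have "0 \<le> \<mu> * inner v v" if "\<mu> \<ge> 0" using that by simp
  with l loc.hess_lower[of v i w] show "\<mu> \<ge> 0 \<Longrightarrow> 0 < inner v (lhess i w v + \<mu> *\<^sub>R v)"
    unfolding inner_add_right inner_scaleR_right by linarith
qed

lemma hess_injective:
  assumes "w \<in> carrier_vec d" "v \<in> carrier_vec d" "disco_hess d m fs w *\<^sub>v v = 0\<^sub>v d"
  shows "v = 0\<^sub>v d"
proof -
  have "fhess (emb w) (emb v) = 0" using hess_mult[of w v] assms by (simp del: One_nat_def)
  hence "inner (emb v) (fhess (emb w) (emb v)) = 0" by (simp del: One_nat_def)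
  hence "emb v = 0" using quad_pos(1)[of "emb v" "emb w"] by fastforce
  thus ?thesis using emb_inject[of v d "0\<^sub>v d"] assms by simp
qed

lemma precond_injective:
  assumes "w \<in> carrier_vec d" "v \<in> carrier_vec d" "disco_precond d fs \<mu> w *\<^sub>v v = 0\<^sub>v d" "\<mu> \<ge> 0"
  shows "v = 0\<^sub>v d"
proof -
  have "inner (emb v) (lhess 1 (emb w) (emb v) + \<mu> *\<^sub>R emb v) = 0"
    using assms precond_mult[of w v \<mu>] by simp
  hence "emb v = 0" using quad_pos(2)[of "emb v" \<mu> 1 "emb w"] assms by fastforce
  thus ?thesis using emb_inject[of v d "0\<^sub>v d"] assms by simp
qed

lemma newton_system:
  assumes w: "w \<in> carrier_vec d"
  obtains vh where "vh \<in> supported d" "fhess (emb w) vh = fgrad (emb w)"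
proof -
  let ?H = "disco_hess d m fs w" and ?g = "disco_grad d m fs w"
  obtain Hi where Hi: "Hi \<in> carrier_mat d d" "?H * Hi = 1\<^sub>m d"
    using mat_inverse_posdef[OF hess_carrier[of w]] hess_injective[OF w] by metis
  define v where "v = Hi *\<^sub>v ?g"
  have v: "v \<in> carrier_vec d" unfolding v_def using Hi(1) by (rule mult_mat_vec_carrier) (rule grad_carrier)
  have "?H *\<^sub>v v = (?H * Hi) *\<^sub>v ?g"
    unfolding v_def by (rule assoc_mult_mat_vec[symmetric, OF hess_carrier Hi(1) grad_carrier])
  also have "\<dots> = ?g" using Hi grad_carrier by simp
  finally have "fhess (emb w) (emb v) = fgrad (emb w)" using hess_mult[OF w v] grad_emb[OF w] by simp
  with v show ?thesis using that by (meson emb_supported)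
qed

end

subsection \<open>Deterministic round complexity\<close>

definition pcg_v where "pcg_v d H P g t = fst (pcg_state d H P g t)"
definition pcg_r where "pcg_r d H P g t = fst (snd (pcg_state d H P g t))"
definition pcg_s where "pcg_s d H P g t = fst (snd (snd (pcg_state d H P g t)))"
definition pcg_u where "pcg_u d H P g t = snd (snd (snd (pcg_state d H P g t)))"

lemmas pcg_parts = pcg_v_def pcg_r_def pcg_s_def pcg_u_def

lemma pcg_parts_0:
  "pcg_v d H P g 0 = 0\<^sub>v d" "pcg_r d H P g 0 = g" "pcg_s d H P g 0 = the (mat_inverse P) *\<^sub>v g"
  "pcg_u d H P g 0 = the (mat_inverse P) *\<^sub>v g"
  by (simp_all add: pcg_parts Let_def)

lemma pcg_parts_Suc:
  fixes d H P g t
  defines "v \<equiv> pcg_v d H P g" and "r \<equiv> pcg_r d H P g" and "s \<equiv> pcg_s d H P g" and "u \<equiv> pcg_u d H P g"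
  shows "v (Suc t) = v t + ((r t \<bullet> s t) / (u t \<bullet> (H *\<^sub>v u t))) \<cdot>\<^sub>v u t"
    "r (Suc t) = r t - ((r t \<bullet> s t) / (u t \<bullet> (H *\<^sub>v u t))) \<cdot>\<^sub>v (H *\<^sub>v u t)"
    "s (Suc t) = the (mat_inverse P) *\<^sub>v r (Suc t)"
    "u (Suc t) = s (Suc t) + ((r (Suc t) \<bullet> s (Suc t)) / (r t \<bullet> s t)) \<cdot>\<^sub>v u t"
  unfolding v_def r_def s_def u_def pcg_parts by (simp_all add: Let_def split_beta)

context disco_data
begin

context
  fixes w :: "real vec" and \<mu> :: real
  assumes w: "w \<in> carrier_vec d" and \<mu>: "\<mu> \<ge> 0"
begin

abbreviation "Hm \<equiv> disco_hess d m fs w"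
abbreviation "Pm \<equiv> disco_precond d fs \<mu> w"
abbreviation "gv \<equiv> disco_grad d m fs w"
abbreviation "Pinv \<equiv> the (mat_inverse Pm)"

lemma Pinv: "Pinv \<in> carrier_mat d d" "Pm * Pinv = 1\<^sub>m d"
    "det Pm \<noteq> 0" "Pinv = (1 / det Pm) \<cdot>\<^sub>m adj_mat Pm"
  using mat_inverse_posdef[OF precond_carrier[of \<mu> w]] precond_injective[OF w _ _ \<mu>]
  by (metis option.sel)+

lemma pcg_carrier:
  "pcg_v d Hm Pm gv t \<in> carrier_vec d \<and> pcg_r d Hm Pm gv t \<in> carrier_vec d \<and>
   pcg_s d Hm Pm gv t \<in> carrier_vec d \<and> pcg_u d Hm Pm gv t \<in> carrier_vec d"
proof (induction t)
  case 0
  show ?case using Pinv(1) grad_carrier[of w] mult_mat_vec_carrier[of Pinv d d gv] by (simp add: pcg_parts_0)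
next
  case (Suc t)
  have "Hm *\<^sub>v pcg_u d Hm Pm gv t \<in> carrier_vec d"
    using Suc hess_carrier[of w] by (intro mult_mat_vec_carrier[of _ d d]) auto
  hence v: "pcg_v d Hm Pm gv (Suc t) \<in> carrier_vec d" and r: "pcg_r d Hm Pm gv (Suc t) \<in> carrier_vec d"
    using Suc by (simp_all add: pcg_parts_Suc(1,2))
  have s: "pcg_s d Hm Pm gv (Suc t) \<in> carrier_vec d"
    unfolding pcg_parts_Suc(3) using Pinv(1) r by (rule mult_mat_vec_carrier)
  show ?case using v r s Suc by (simp add: pcg_parts_Suc(4))
qed

lemma pcg_interpretation:
  "pcg (fhess (emb w)) (\<lambda>v. lhess 1 (emb w) v + \<mu> *\<^sub>R v) (\<lambda>x. emb (Pinv *\<^sub>v prj d x)) (fgrad (emb w))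
     (\<lambda>t. emb (pcg_v d Hm Pm gv t)) (\<lambda>t. emb (pcg_r d Hm Pm gv t))
     (\<lambda>t. emb (pcg_s d Hm Pm gv t)) (\<lambda>t. emb (pcg_u d Hm Pm gv t)) (supported d)"
proof -
  let ?Q = "\<lambda>x. emb (Pinv *\<^sub>v prj d x)"
  have c: "pcg_v d Hm Pm gv t \<in> carrier_vec d" "pcg_r d Hm Pm gv t \<in> carrier_vec d"
    "pcg_s d Hm Pm gv t \<in> carrier_vec d" "pcg_u d Hm Pm gv t \<in> carrier_vec d" for t
    using pcg_carrier by auto
  have pc: "Pinv *\<^sub>v v \<in> carrier_vec d" if "v \<in> carrier_vec d" for v
    using Pinv(1) that by (rule mult_mat_vec_carrier)
  have hu: "Hm *\<^sub>v v \<in> carrier_vec d" if "v \<in> carrier_vec d" for v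
    using hess_carrier that by (rule mult_mat_vec_carrier)
  have s_eq: "pcg_s d Hm Pm gv t = Pinv *\<^sub>v pcg_r d Hm Pm gv t" for t
    by (cases t) (simp_all add: pcg_parts_0 pcg_parts_Suc(3))
  have inn: "pcg_u d Hm Pm gv t \<bullet> (Hm *\<^sub>v pcg_u d Hm Pm gv t)
     = inner (emb (pcg_u d Hm Pm gv t)) (fhess (emb w) (emb (pcg_u d Hm Pm gv t)))" for t
    using emb_inner[OF c(4) hu[OF c(4)]] hess_mult[OF w c(4)] by simp
  have rs: "pcg_r d Hm Pm gv t \<bullet> pcg_s d Hm Pm gv t' = inner (emb (pcg_r d Hm Pm gv t)) (emb (pcg_s d Hm Pm gv t'))" for t t'
    using emb_inner[OF c(2,3)] .
  show ?thesis
  proof unfold_locales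
    fix x y :: fseq and k :: real and t :: nat
    show "fhess (emb w) (x + y) = fhess (emb w) x + fhess (emb w) y" by (rule avg.hess_add)
    show "fhess (emb w) (k *\<^sub>R x) = k *\<^sub>R fhess (emb w) x" by (rule avg.hess_scale)
    show "lhess 1 (emb w) (k *\<^sub>R x) + \<mu> *\<^sub>R k *\<^sub>R x = k *\<^sub>R (lhess 1 (emb w) x + \<mu> *\<^sub>R x)"
      using loc.hess_scale[of 1 "emb w" k x] by (simp add: scaleR_right_distrib mult.commute)
    show "inner x (fhess (emb w) y) = inner y (fhess (emb w) x)" by (rule avg.hess.sym)
    show "inner x (lhess 1 (emb w) y + \<mu> *\<^sub>R y) = inner y (lhess 1 (emb w) x + \<mu> *\<^sub>R x)"
      using loc.hess.sym[of x 1 "emb w" y] unfolding inner_add_right inner_scaleR_right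
      by (simp add: inner_commute[of x y])
    show "0 \<le> inner x (fhess (emb w) x)" by (rule avg.hess.nonneg)
    show "x \<noteq> 0 \<Longrightarrow> 0 < inner x (lhess 1 (emb w) x + \<mu> *\<^sub>R x)" using quad_pos(2) \<mu> by blast
    show "x \<noteq> 0 \<Longrightarrow> 0 < inner x (fhess (emb w) x)" by (rule quad_pos(1))
    {
      assume x: "x \<in> supported d"
      have px: "prj d (k *\<^sub>R x) = k \<cdot>\<^sub>v prj d x" by (rule eq_vecI) (auto simp: prj_def)
      show "?Q (k *\<^sub>R x) = k *\<^sub>R ?Q x"
        using mult_mat_vec[OF Pinv(1) prj_carrier] by (simp add: px emb_smult)
      have "Pm *\<^sub>v (Pinv *\<^sub>v prj d x) = (Pm * Pinv) *\<^sub>v prj d x"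
        by (rule assoc_mult_mat_vec[symmetric, OF precond_carrier Pinv(1) prj_carrier])
      also have "\<dots> = prj d x" by (simp add: Pinv(2))
      finally show "lhess 1 (emb w) (?Q x) + \<mu> *\<^sub>R ?Q x = x"
        using precond_mult[OF w pc[OF prj_carrier[of d x]], of \<mu>] x by (simp add: emb_prj del: One_nat_def)
      show "?Q x \<in> supported d" using pc by simp
      show "fhess (emb w) x \<in> supported d" using x by (rule avg.H_supp)
      assume y: "y \<in> supported d"
      have "prj d (x + y) = prj d x + prj d y" by (rule eq_vecI) (auto simp: prj_def)
      thus "?Q (x + y) = ?Q x + ?Q y"
        using mult_add_distrib_mat_vec[OF Pinv(1) prj_carrier prj_carrier]
        by (simp add: emb_add[OF pc pc])
    }
    show "fgrad (emb w) \<in> supported d" using w by (intro avg.g_supp) simp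
    show "emb (pcg_v d Hm Pm gv 0) = 0" by (simp add: pcg_parts_0)
    show "emb (pcg_r d Hm Pm gv 0) = fgrad (emb w)" using grad_emb[OF w] by (simp add: pcg_parts_0)
    show "emb (pcg_u d Hm Pm gv 0) = ?Q (fgrad (emb w))"
      using grad_emb[OF w] prj_emb[OF grad_carrier[of w]] by (simp add: pcg_parts_0)
    show "emb (pcg_s d Hm Pm gv t) = ?Q (emb (pcg_r d Hm Pm gv t))"
      using prj_emb[OF c(2)] by (simp add: s_eq)
    show "emb (pcg_v d Hm Pm gv (Suc t)) = emb (pcg_v d Hm Pm gv t) + (inner (emb (pcg_r d Hm Pm gv t)) (emb (pcg_s d Hm Pm gv t)) /
        inner (emb (pcg_u d Hm Pm gv t)) (fhess (emb w) (emb (pcg_u d Hm Pm gv t)))) *\<^sub>R emb (pcg_u d Hm Pm gv t)"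
      unfolding pcg_parts_Suc(1) inn rs using c by (subst emb_add[of _ d]) (auto simp: emb_smult)
    show "emb (pcg_r d Hm Pm gv (Suc t)) = emb (pcg_r d Hm Pm gv t) - (inner (emb (pcg_r d Hm Pm gv t)) (emb (pcg_s d Hm Pm gv t)) /
        inner (emb (pcg_u d Hm Pm gv t)) (fhess (emb w) (emb (pcg_u d Hm Pm gv t)))) *\<^sub>R fhess (emb w) (emb (pcg_u d Hm Pm gv t))"
      unfolding pcg_parts_Suc(2) inn rs using c hu hess_mult[OF w c(4)]
      by (subst emb_minus[of _ d]) (auto simp: emb_smult)
    show "emb (pcg_u d Hm Pm gv (Suc t)) = emb (pcg_s d Hm Pm gv (Suc t)) + (inner (emb (pcg_r d Hm Pm gv (Suc t))) (emb (pcg_s d Hm Pm gv (Suc t))) /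
        inner (emb (pcg_r d Hm Pm gv t)) (emb (pcg_s d Hm Pm gv t))) *\<^sub>R emb (pcg_u d Hm Pm gv t)"
      unfolding pcg_parts_Suc(4) rs using c by (subst emb_add[of _ d]) (auto simp: emb_smult)
  qed auto
qed

interpretation cg: pcg "fhess (emb w)" "\<lambda>v. lhess 1 (emb w) v + \<mu> *\<^sub>R v" "\<lambda>x. emb (Pinv *\<^sub>v prj d x)" "fgrad (emb w)"
    "\<lambda>t. emb (pcg_v d Hm Pm gv t)" "\<lambda>t. emb (pcg_r d Hm Pm gv t)"
    "\<lambda>t. emb (pcg_s d Hm Pm gv t)" "\<lambda>t. emb (pcg_u d Hm Pm gv t)" "supported d"
  by (rule pcg_interpretation)

lemma pcg_stop_iff:
  "pcg_stop d Hm Pm gv tol t \<longleftrightarrow> norm (emb (pcg_r d Hm Pm gv (Suc t))) \<le> tol"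
  by (simp add: pcg_stop_def pcg_residual_def pcg_r_def emb_norm)

text \<open>Supplies the assumption \<open>inexact\<close> of the Newton step, since the residual of
  the recursion is the true residual g - H v. At a zero gradient the direction 0 is exact.\<close>

lemma pcg_result_residual:
  assumes "gv \<noteq> 0\<^sub>v d \<Longrightarrow> \<exists>t. pcg_stop d Hm Pm gv tol t" "tol \<ge> 0"
  shows "pcg_result d Hm Pm gv tol \<in> carrier_vec d"
    "norm (fhess (emb w) (emb (pcg_result d Hm Pm gv tol)) - fgrad (emb w)) \<le> tol"
proof -
  show "pcg_result d Hm Pm gv tol \<in> carrier_vec d"
    using pcg_carrier by (simp add: pcg_result_def pcg_iterate_def pcg_v_def[symmetric] del: pcg_state.simps)
  show "norm (fhess (emb w) (emb (pcg_result d Hm Pm gv tol)) - fgrad (emb w)) \<le> tol"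
  proof (cases "gv = 0\<^sub>v d")
    case True
    hence "fgrad (emb w) = 0" using grad_emb[OF w] by simp
    moreover have "fhess (emb w) 0 = 0" by (rule cg.H_zero)
    ultimately show ?thesis using True assms by (simp add: pcg_result_def del: One_nat_def)
  next
    case False
    define T where "T = (LEAST t. pcg_stop d Hm Pm gv tol t)"
    have "pcg_stop d Hm Pm gv tol T" unfolding T_def using assms(1)[OF False] by (rule LeastI_ex)
    hence "norm (emb (pcg_r d Hm Pm gv (Suc T))) \<le> tol" by (simp add: pcg_stop_iff)
    thus ?thesis using False
      by (simp add: cg.residual pcg_result_def pcg_iterate_def norm_minus_commute
          del: One_nat_def pcg_state.simps flip: T_def pcg_v_def)
  qed
qed

lemma pcg_stops:
  assumes c: "0 < c1" "0 < c2" "c1 \<le> c2"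
    and low: "\<And>x. c1 * inner x (lhess 1 (emb w) x + \<mu> *\<^sub>R x) \<le> inner x (fhess (emb w) x)"
    and up: "\<And>x. inner x (fhess (emb w) x) \<le> c2 * inner x (lhess 1 (emb w) x + \<mu> *\<^sub>R x)"
    and L: "lam \<le> L" "\<And>x. inner x (fhess (emb w) x) \<le> L * (norm x)\<^sup>2"
    and "gv \<noteq> 0\<^sub>v d" "T > 0" and T: "real T \<ge> sqrt (c2 / c1) * (7 + 2 * ln (L / lam))"
  shows "\<exists>t<T. pcg_stop d Hm Pm gv (disco_tol d m fs lam L w) t"
proof -
  obtain xs where xs: "xs \<in> supported d" "fhess (emb w) xs = fgrad (emb w)"
    using newton_system[OF w] by blast
  have "fgrad (emb w) \<noteq> 0"
    using \<open>gv \<noteq> 0\<^sub>v d\<close> emb_inject[OF grad_carrier[of w], of "0\<^sub>v d"] grad_emb[OF w] by auto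
  from cg.cg_stops[OF xs(2,1) c low up lam_pos avg.hess_lower L this \<open>T > 0\<close> T]
  show ?thesis by (simp add: pcg_stop_iff disco_tol_def emb_norm grad_emb[OF w] del: One_nat_def)
qed

end

end

lemma const_L_eq: "const_L B \<gamma> = const_lambda B \<gamma> + scale_eta B \<gamma> * B\<^sup>2 / 4"
  by (simp add: const_L_def const_lambda_def distrib_left)

text \<open>A bound for f at the initial point, valid for all bounded data: V0 from the regularizer
  and 2 V0 + G^2 / (2 lam) from the losses, see \<open>init_value\<close>.\<close>

definition const_F0 :: "real \<Rightarrow> real \<Rightarrow> real" where
  "const_F0 B \<gamma> = 3 * const_V0 B \<gamma> + (const_G B \<gamma>)\<^sup>2 / (2 * const_lambda B \<gamma>)"

text \<open>The data are fixed here, and the norm bound, which holds almost surely under sampling,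
  is assumed for every sample.\<close>

locale bounded_disco = disco_data +
  fixes \<mu> \<rho> :: real
  assumes bounded: "\<And>ij. ij \<in> {1..m} \<times> {1..n} \<Longrightarrow> norm (data_vec d (z ij)) \<le> B"
    and mu: "0 \<le> \<mu>" "\<mu> \<le> const_L B \<gamma>" and rho: "0 < \<rho>"
begin

abbreviation "L \<equiv> const_L B \<gamma>"

lemma lam_less_L: "lam < L" and L_pos: "0 < L"
  using lam_pos scale_eta_pos[OF B \<gamma>] B by (simp_all add: const_L_eq add_pos_pos)

lemma avg_upper: "inner x (fhess w x) \<le> L * (norm x)\<^sup>2"
proof -
  have "inner x (fhess w x) \<le> (\<eta> / (m * n) * card ({1..m} \<times> {1..n}) * B\<^sup>2 / 4 + lam) * (norm x)\<^sup>2"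
    by (rule avg.hess_upper) (use bounded in auto)
  thus ?thesis using m n by (simp add: const_L_eq add.commute)
qed

lemma loc_upper:
  assumes "i \<in> {1..m}" shows "inner x (lhess i w x) \<le> L * (norm x)\<^sup>2"
proof -
  have "inner x (lhess i w x) \<le> (\<eta> / n * card {1..n} * B\<^sup>2 / 4 + lam) * (norm x)\<^sup>2"
    by (rule loc.hess_upper) (use bounded assms in auto)
  thus ?thesis using n by (simp add: const_L_eq add.commute)
qed

text \<open>If the first local Hessian and the average one differ by at most \<Delta>, then P <= (1
  + (\<Delta> + \<mu>) / lam) H and H <= (1 + \<Delta> / (lam + \<mu>)) P; the product bounds the
  condition number of the preconditioned system.\<close>

definition cond_num :: "real \<Rightarrow> real" where
  "cond_num \<Delta> = (1 + (\<Delta> + \<mu>) / lam) * (1 + \<Delta> / (lam + \<mu>))"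

definition pcg_budget :: "real \<Rightarrow> nat" where
  "pcg_budget \<Delta> = nat \<lceil>sqrt (cond_num \<Delta>) * (7 + 2 * ln (L / lam))\<rceil>"

lemma log_cond_nonneg: "0 \<le> ln (L / lam)"
  using lam_less_L lam_pos by (intro ln_ge_zero) simp

lemma cond_num_ge_1: "\<Delta> \<ge> 0 \<Longrightarrow> cond_num \<Delta> \<ge> 1"
  unfolding cond_num_def using mu lam_pos
  by (intro mult_ge1_I[unfolded]) (auto intro!: divide_nonneg_nonneg)

lemma pcg_budget_bounds:
  assumes "\<Delta> \<ge> 0"
  shows "pcg_budget \<Delta> > 0" "real (pcg_budget \<Delta>) \<ge> sqrt (cond_num \<Delta>) * (7 + 2 * ln (L / lam))"
    "real (pcg_budget \<Delta>) \<le> sqrt (cond_num \<Delta>) * (7 + 2 * ln (L / lam)) + 1"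
proof -
  have "0 < sqrt (cond_num \<Delta>) * (7 + 2 * ln (L / lam))"
    using cond_num_ge_1[OF assms] log_cond_nonneg by (intro mult_pos_pos) auto
  thus "pcg_budget \<Delta> > 0" "real (pcg_budget \<Delta>) \<ge> sqrt (cond_num \<Delta>) * (7 + 2 * ln (L / lam))"
    "real (pcg_budget \<Delta>) \<le> sqrt (cond_num \<Delta>) * (7 + 2 * ln (L / lam)) + 1"
    unfolding pcg_budget_def by linarith+
qed

lemma pcg_stops_budget:
  assumes w: "w \<in> carrier_vec d" and g: "disco_grad d m fs w \<noteq> 0\<^sub>v d" and \<Delta>: "\<Delta> \<ge> 0"
    and diff: "\<And>x. \<bar>inner x (lhess 1 (emb w) x) - inner x (fhess (emb w) x)\<bar> \<le> \<Delta> * (norm x)\<^sup>2"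
  shows "\<exists>t<pcg_budget \<Delta>. pcg_stop d (disco_hess d m fs w) (disco_precond d fs \<mu> w) (disco_grad d m fs w)
    (disco_tol d m fs lam L w) t"
proof (rule pcg_stops[OF w mu(1)])
  let ?c1 = "1 / (1 + (\<Delta> + \<mu>) / lam)" and ?c2 = "1 + \<Delta> / (lam + \<mu>)"
  have A: "0 \<le> (\<Delta> + \<mu>) / lam" "0 \<le> \<Delta> / (lam + \<mu>)" using \<Delta> mu lam_pos by auto
  show "0 < ?c1" "0 < ?c2" using A by auto
  have "?c1 \<le> 1" using A by simp
  with A show "?c1 \<le> ?c2" by linarith
  have P: "inner x (lhess 1 (emb w) x + \<mu> *\<^sub>R x) = inner x (lhess 1 (emb w) x) + \<mu> * (norm x)\<^sup>2" for x
    by (simp add: inner_add_right power2_norm_eq_inner)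
  show "?c1 * inner x (lhess 1 (emb w) x + \<mu> *\<^sub>R x) \<le> inner x (fhess (emb w) x)" for x
  proof -
    have "inner x (lhess 1 (emb w) x) + \<mu> * (norm x)\<^sup>2 \<le> inner x (fhess (emb w) x) + (\<Delta> + \<mu>) * (norm x)\<^sup>2"
      using diff[of x] by (simp add: algebra_simps)
    also have "(\<Delta> + \<mu>) * (norm x)\<^sup>2 = (\<Delta> + \<mu>) / lam * (lam * (norm x)\<^sup>2)" using lam_pos by simp
    also have "\<dots> \<le> (\<Delta> + \<mu>) / lam * inner x (fhess (emb w) x)"
      using A by (intro mult_left_mono avg.hess_lower) auto
    finally have "inner x (lhess 1 (emb w) x) + \<mu> * (norm x)\<^sup>2 \<le> (1 + (\<Delta> + \<mu>) / lam) * inner x (fhess (emb w) x)"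
      by (simp add: distrib_right)
    thus ?thesis using A unfolding P by (simp add: field_simps)
  qed
  show "inner x (fhess (emb w) x) \<le> ?c2 * inner x (lhess 1 (emb w) x + \<mu> *\<^sub>R x)" for x
  proof -
    let ?P = "inner x (lhess 1 (emb w) x) + \<mu> * (norm x)\<^sup>2"
    have "0 \<le> \<mu> * (norm x)\<^sup>2" using mu by simp
    hence "inner x (fhess (emb w) x) \<le> ?P + \<Delta> * (norm x)\<^sup>2" using diff[of x] by linarith
    also have "\<Delta> * (norm x)\<^sup>2 = \<Delta> / (lam + \<mu>) * ((lam + \<mu>) * (norm x)\<^sup>2)" using lam_pos mu by simp
    also have "\<dots> \<le> \<Delta> / (lam + \<mu>) * ?P"
      using A loc.hess_lower[of x 1 "emb w"] by (intro mult_left_mono) (auto simp: distrib_right)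
    finally show ?thesis unfolding P by (simp add: distrib_right)
  qed
  show "sqrt (?c2 / ?c1) * (7 + 2 * ln (L / lam)) \<le> real (pcg_budget \<Delta>)"
    using pcg_budget_bounds(2)[OF \<Delta>] by (simp add: cond_num_def mult.commute)
qed (use g lam_less_L avg_upper pcg_budget_bounds(1)[OF \<Delta>] in auto)

text \<open>Both Hessians lie between lam and L. This crude bound shows that conjugate gradients
  always stop, and it provides the cost on the exceptional event.\<close>

lemma crude_diff: "\<bar>inner x (lhess 1 w x) - inner x (fhess w x)\<bar> \<le> (L - lam) * (norm x)\<^sup>2"
  using avg_upper[of x w] loc_upper[of 1 x w] avg.hess_lower[of x w] loc.hess_lower[of x 1 w] m
  by (simp add: abs_le_iff left_diff_distrib)

lemma pcg_stops_always:
  assumes "w \<in> carrier_vec d" "disco_grad d m fs w \<noteq> 0\<^sub>v d"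
  shows "\<exists>t. pcg_stop d (disco_hess d m fs w) (disco_precond d fs \<mu> w) (disco_grad d m fs w)
    (disco_tol d m fs lam L w) t"
  using pcg_stops_budget[OF assms _ crude_diff] lam_less_L by auto

lemma pcg_rounds_le:
  assumes w: "w \<in> carrier_vec d" and \<Delta>: "\<Delta> \<ge> 0"
    and diff: "\<And>x. \<bar>inner x (lhess 1 (emb w) x) - inner x (fhess (emb w) x)\<bar> \<le> \<Delta> * (norm x)\<^sup>2"
  shows "disco_pcg_rounds d m fs lam L \<mu> w \<le> enat (Suc (pcg_budget \<Delta>))"
proof (cases "disco_grad d m fs w = 0\<^sub>v d")
  case True
  thus ?thesis by (simp add: disco_pcg_rounds_def pcg_rounds_def one_enat_def)
next
  case False
  let ?stop = "pcg_stop d (disco_hess d m fs w) (disco_precond d fs \<mu> w) (disco_grad d m fs w)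
    (disco_tol d m fs lam L w)"
  obtain t where t: "t < pcg_budget \<Delta>" "?stop t"
    using pcg_stops_budget[OF w False \<Delta> diff] by blast
  have "(LEAST t. ?stop t) \<le> t" by (rule Least_le) (rule t(2))
  hence "1 + enat (Suc (LEAST t. ?stop t)) \<le> enat (Suc (pcg_budget \<Delta>))"
    using t(1) by (simp add: one_enat_def)
  thus ?thesis using False t(2) by (auto simp: disco_pcg_rounds_def pcg_rounds_def)
qed

section \<open>Outer iterations of DiSCO\<close>

abbreviation "it \<equiv> disco_iterate d m fs lam L \<rho> \<mu>"

text \<open>Identifies the vector step with the abstract damped Newton step; the exact direction
  comes from \<open>newton_system\<close>.\<close>

lemma disco_step:
  fixes w
  defines "v \<equiv> disco_dir d m fs lam L \<mu> w"
  defines "w' \<equiv> w - (1 / (1 + sqrt (v \<bullet> (disco_hess d m fs w *\<^sub>v v)))) \<cdot>\<^sub>v v"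
  assumes w: "w \<in> carrier_vec d"
  shows "w' \<in> carrier_vec d" "f (emb w') \<le> f (emb w)"
    "f (emb w') - f (emb wopt) \<le> f (emb w) - f (emb wopt) - 1 / 50 \<or>
     f (emb w') - f (emb wopt) \<le> 93 / 100 * (f (emb w) - f (emb wopt))"
proof -
  have tol: "disco_tol d m fs lam L w = 1 / 20 * sqrt (lam / L) * norm (fgrad (emb w))"
    by (simp add: disco_tol_def emb_norm grad_emb[OF w] del: One_nat_def)
  have tol0: "0 \<le> disco_tol d m fs lam L w" unfolding tol using lam_pos L_pos by simp
  note res = pcg_result_residual[OF w mu(1) pcg_stops_always[OF w] tol0, folded disco_dir_def, folded v_def]
  have v: "v \<in> carrier_vec d" by (rule res(1))
  show w': "w' \<in> carrier_vec d" using w v by (simp add: w'_def)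
  have "disco_hess d m fs w *\<^sub>v v \<in> carrier_vec d"
    using hess_carrier v by (rule mult_mat_vec_carrier)
  hence "v \<bullet> (disco_hess d m fs w *\<^sub>v v) = inner (emb v) (fhess (emb w) (emb v))"
    using emb_inner[OF v] hess_mult[OF w v] by simp
  hence ew: "emb w' = emb w - (1 / (1 + avg.hess.enorm (emb w) (emb v))) *\<^sub>R emb v"
    using w v by (simp add: w'_def avg.hess.enorm_def emb_minus[of _ d] emb_smult del: One_nat_def of_nat_mult)
  obtain vh where vh: "fhess (emb w) vh = fgrad (emb w)" using newton_system[OF w] by blast
  have sc: "B\<^sup>2 = 4 * lam" using const_lambda_eq[OF \<gamma>, of B] by simp
  note prems = bounded sc L_pos avg_upper vh res(2)[unfolded tol]
  show "f (emb w') \<le> f (emb w)"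
    unfolding ew by (rule avg.newton_monotone[OF prems])
  show "f (emb w') - f (emb wopt) \<le> f (emb w) - f (emb wopt) - 1 / 50 \<or>
     f (emb w') - f (emb wopt) \<le> 93 / 100 * (f (emb w) - f (emb wopt))"
    unfolding ew by (rule avg.newton_progress[OF prems avg.minimizer_props(3)])
qed

lemma iterate_Suc:
  "it (Suc k) = it k - (1 / (1 + sqrt (disco_dir d m fs lam L \<mu> (it k) \<bullet>
    (disco_hess d m fs (it k) *\<^sub>v disco_dir d m fs lam L \<mu> (it k))))) \<cdot>\<^sub>v disco_dir d m fs lam L \<mu> (it k)"
  by (simp add: Let_def)

lemma iterate_carrier: "it k \<in> carrier_vec d"
proof (induction k)
  case 0 show ?case by (simp add: disco_init_def)
next
  case (Suc k) thus ?case unfolding iterate_Suc by (rule disco_step(1))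
qed

lemma iterate_descends: "f (emb (it k)) \<le> f (emb (it 0))"
proof (induction k)
  case (Suc k)
  have "f (emb (it (Suc k))) \<le> f (emb (it k))"
    unfolding iterate_Suc by (rule disco_step(2)[OF iterate_carrier])
  with Suc show ?case by linarith
qed simp

definition gap :: "nat \<Rightarrow> real" where
  "gap k = f (emb (it k)) - f (emb wopt)"

lemma gap_nonneg: "0 \<le> gap k"
  using avg.minimizer_props(3) by (simp add: gap_def del: One_nat_def)

lemma gap_step: "gap (Suc k) \<le> gap k - 1 / 50 \<or> gap (Suc k) \<le> 93 / 100 * gap k"
  unfolding gap_def iterate_Suc by (rule disco_step(3)[OF iterate_carrier])

lemma accurate_iff: "disco_accurate d m fs lam L \<rho> \<mu> \<epsilon> k \<longleftrightarrow> gap k \<le> \<epsilon>"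
  using average_obj_eq[OF iterate_carrier] average_obj_eq[OF avg.minimizer_props(1)]
  by (simp add: disco_accurate_def gap_def del: One_nat_def disco_iterate.simps)

text \<open>One round is spent on the initial point. Each Newton step costs one round for the
  gradient and at most \<open>pcg_budget\<close> further ones, where rounding up costs another 1;
  hence the 2.\<close>

lemma total_rounds_le:
  assumes eps: "\<epsilon> > 0" and \<Delta>: "\<Delta> \<ge> 0"
    and diff: "\<And>k x. \<bar>inner x (lhess 1 (emb (it k)) x) - inner x (fhess (emb (it k)) x)\<bar> \<le> \<Delta> * (norm x)\<^sup>2"
  shows "\<exists>N. disco_total_rounds d m fs lam L \<rho> \<mu> \<epsilon> = enat N \<and>
    real N \<le> 1 + (65 * gap 0 + 15 * max 1 (ln (1 / \<epsilon>)) + 1) * (2 + sqrt (cond_num \<Delta>) * (7 + 2 * ln (L / lam)))"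
proof -
  let ?acc = "disco_accurate d m fs lam L \<rho> \<mu> \<epsilon>"
  let ?b = "65 * gap 0 + 15 * max 1 (ln (1 / \<epsilon>)) + 1"
  have count: "real K \<le> ?b" if "\<And>k. k < K \<Longrightarrow> \<not> ?acc k" for K
  proof (rule newton_iteration_count[OF eps])
    show "gap k > \<epsilon>" if "k < K" for k using \<open>k < K \<Longrightarrow> \<not> ?acc k\<close> that by (simp add: accurate_iff)
  qed (use gap_step gap_nonneg in auto)
  \<comment> \<open>Otherwise all iterates are inaccurate, and \<open>count\<close> applied to more
    than \<open>?b\<close> of them is contradictory.\<close>
  have "\<exists>k. ?acc k"
  proof (rule ccontr)
    assume "\<nexists>k. ?acc k"
    hence "real (Suc (nat \<lceil>?b\<rceil>)) \<le> ?b" by (intro count) auto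
    thus False by linarith
  qed
  define K where "K = (LEAST k. ?acc k)"
  have K: "real K \<le> ?b" by (rule count) (auto simp: K_def dest: not_less_Least)
  have total: "disco_total_rounds d m fs lam L \<rho> \<mu> \<epsilon> = disco_rounds_upto d m fs lam L \<rho> \<mu> K"
    using \<open>\<exists>k. ?acc k\<close> by (simp add: disco_total_rounds_def K_def)
  have sum: "(\<Sum>j<k. disco_pcg_rounds d m fs lam L \<mu> (it j)) \<le> enat (k * Suc (pcg_budget \<Delta>))" for k
  proof (induction k)
    case (Suc k)
    have "disco_pcg_rounds d m fs lam L \<mu> (it k) \<le> enat (Suc (pcg_budget \<Delta>))"
      by (rule pcg_rounds_le[OF iterate_carrier \<Delta> diff])
    from add_mono[OF Suc this] show ?case by (simp add: algebra_simps)
  qed (simp add: zero_enat_def)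
  have "disco_rounds_upto d m fs lam L \<rho> \<mu> K \<le> 1 + enat (K * Suc (pcg_budget \<Delta>))"
    unfolding disco_rounds_upto_def by (intro add_left_mono sum)
  also have "\<dots> = enat (Suc (K * Suc (pcg_budget \<Delta>)))" by (simp add: one_enat_def)
  finally obtain N where N: "disco_rounds_upto d m fs lam L \<rho> \<mu> K = enat N" "N \<le> Suc (K * Suc (pcg_budget \<Delta>))"
    by (cases "disco_rounds_upto d m fs lam L \<rho> \<mu> K") auto
  have "real N \<le> 1 + real K * (1 + real (pcg_budget \<Delta>))"
    using of_nat_mono[OF N(2), where 'a = real] by (simp add: algebra_simps)
  also have "\<dots> \<le> 1 + ?b * (1 + (sqrt (cond_num \<Delta>) * (7 + 2 * ln (L / lam)) + 1))"
    using K pcg_budget_bounds(3)[OF \<Delta>] gap_nonneg[of 0] by (intro add_left_mono mult_mono) auto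
  finally show ?thesis using N(1) total by (auto simp: algebra_simps)
qed

section \<open>Bounds at the initial point and for all iterates\<close>

abbreviation "lmin i \<equiv> minimizer d (\<lambda>w. fs i w + \<rho> / 2 * (vec_norm w)\<^sup>2)"
abbreviation "freg i \<equiv> reg_logistic {1..n} (\<eta> / n) (\<lambda>j. a (i, j)) (lam + \<rho>)"

lemma lmin_carrier: "lmin i \<in> carrier_vec d" and lmin_le: "freg i (emb (lmin i)) \<le> freg i y"
  using coordinate_objective.minimizer_props(1,3)[OF reg_objective[of \<rho> i]] rho by auto

lemma init_emb: "emb (it 0) = (1 / m) *\<^sub>R (\<Sum>i = 1..m. emb (lmin i))"
proof (rule fseq_eqI)
  fix k
  have "dim_vec (lmin i) = d" for i using lmin_carrier by (simp add: carrier_vecD)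
  thus "coord (emb (it 0)) k = coord ((1 / m) *\<^sub>R (\<Sum>i = 1..m. emb (lmin i))) k"
    by (simp add: coord_emb disco_init_def coord_sum del: One_nat_def)
qed

lemma reg_logistic_at_0: "freg i 0 = const_V0 B \<gamma>" "f 0 = const_V0 B \<gamma>"
  using n m by (simp_all add: reg_logistic_def logistic_zero const_V0_def)

text \<open>Comparison with the point 0, where the regularized local objective equals V0.\<close>

lemma lmin_norm: "(norm (emb (lmin i)))\<^sup>2 \<le> 2 * const_V0 B \<gamma> / lam"
proof -
  have "0 \<le> (\<Sum>j = 1..n. \<eta> / n * logistic (inner (a (i, j)) (emb (lmin i))))"
    using scale_eta_pos[OF B \<gamma>] by (intro sum_nonneg mult_nonneg_nonneg logistic_nonneg) auto
  hence "(lam + \<rho>) / 2 * (norm (emb (lmin i)))\<^sup>2 \<le> const_V0 B \<gamma>"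
    using lmin_le[of i 0] unfolding reg_logistic_at_0 by (simp add: reg_logistic_def del: One_nat_def)
  moreover have "0 \<le> \<rho> / 2 * (norm (emb (lmin i)))\<^sup>2" using rho by simp
  ultimately have "lam / 2 * (norm (emb (lmin i)))\<^sup>2 \<le> const_V0 B \<gamma>"
    by (simp add: add_divide_distrib distrib_right)
  thus ?thesis using lam_pos by (simp add: field_simps)
qed

lemma init_norm: "norm (emb (it 0)) \<le> sqrt (2 * const_V0 B \<gamma> / lam)"
proof -
  have "norm (emb (lmin i)) \<le> sqrt (2 * const_V0 B \<gamma> / lam)" for i
    using real_sqrt_le_mono[OF lmin_norm[of i]] by simp
  hence "(\<Sum>i = 1..m. norm (emb (lmin i))) \<le> real m * sqrt (2 * const_V0 B \<gamma> / lam)"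
    using sum_mono[of "{1..m}" "\<lambda>i. norm (emb (lmin i))" "\<lambda>_. sqrt (2 * const_V0 B \<gamma> / lam)"] by simp
  hence "norm (\<Sum>i = 1..m. emb (lmin i)) \<le> real m * sqrt (2 * const_V0 B \<gamma> / lam)"
    using norm_sum[of "\<lambda>i. emb (lmin i)" "{1..m}"] by linarith
  thus ?thesis unfolding init_emb using m by (simp add: field_simps)
qed

text \<open>Convexity in the form of the tangent plane at the average, whose linear parts sum to
  zero.\<close>

lemma init_jensen: "f (emb (it 0)) \<le> (1 / m) * (\<Sum>i = 1..m. f (emb (lmin i)))"
proof -
  let ?w = "emb (it 0)"
  have "f ?w + inner (fgrad ?w) (emb (lmin i) - ?w) \<le> f (emb (lmin i))" for i
  proof -
    have "0 \<le> lam / 2 * (norm (emb (lmin i) - ?w))\<^sup>2" using lam_pos by simp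
    with avg.strong_convexity[of ?w "emb (lmin i) - ?w"] show ?thesis by simp
  qed
  hence "(\<Sum>i = 1..m. f ?w + inner (fgrad ?w) (emb (lmin i) - ?w)) \<le> (\<Sum>i = 1..m. f (emb (lmin i)))"
    by (intro sum_mono)
  also have "(\<Sum>i = 1..m. f ?w + inner (fgrad ?w) (emb (lmin i) - ?w))
      = real m * f ?w + inner (fgrad ?w) ((\<Sum>i = 1..m. emb (lmin i)) - real m *\<^sub>R ?w)"
    by (simp add: sum.distrib inner_diff_right sum_subtractf inner_sum_right del: One_nat_def)
  also have "real m *\<^sub>R ?w = (\<Sum>i = 1..m. emb (lmin i))" unfolding init_emb using m by simp
  finally show ?thesis using m by (simp add: field_simps)
qed

lemma f_nonneg: "0 \<le> f x" and norm_le_f: "lam / 2 * (norm x)\<^sup>2 \<le> f x"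
proof -
  have "0 \<le> (\<Sum>ij\<in>{1..m} \<times> {1..n}. \<eta> / (m * n) * logistic (inner (a ij) x))"
    using scale_eta_pos[OF B \<gamma>] by (intro sum_nonneg mult_nonneg_nonneg logistic_nonneg) auto
  moreover have "0 \<le> lam / 2 * (norm x)\<^sup>2" using lam_pos by simp
  ultimately show "0 \<le> f x" "lam / 2 * (norm x)\<^sup>2 \<le> f x" unfolding reg_logistic_def by linarith+
qed

lemma data_lipschitz:
  assumes "ij \<in> {1..m} \<times> {1..n}"
  shows "\<bar>logistic (inner (a ij) x) - logistic (inner (a ij) y)\<bar> \<le> B * norm (x - y)"
proof -
  have "\<bar>logistic (inner (a ij) x) - logistic (inner (a ij) y)\<bar> \<le> \<bar>inner (a ij) (x - y)\<bar>"
    using logistic_lipschitz by (simp add: inner_diff_right)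
  also have "\<dots> \<le> norm (a ij) * norm (x - y)" by (rule Cauchy_Schwarz_ineq2)
  also have "\<dots> \<le> B * norm (x - y)" using bounded[OF assms] by (intro mult_right_mono) auto
  finally show ?thesis .
qed

lemma init_value: "f (emb (it 0)) \<le> const_F0 B \<gamma>"
proof -
  let ?x = "emb (it 0)" and ?V = "const_V0 B \<gamma>" and ?G = "const_G B \<gamma>"
  have V: "?V > 0" using scale_eta_pos[OF B \<gamma>] by (simp add: const_V0_def)
  have G: "?G > 0" using scale_eta_pos[OF B \<gamma>] B by (simp add: const_G_def)
  have "(\<Sum>ij\<in>{1..m} \<times> {1..n}. \<eta> / (m * n) * logistic (inner (a ij) ?x))
      \<le> (\<Sum>ij\<in>{1..m} \<times> {1..n}. \<eta> / (m * n) * (ln 2 + B * norm ?x))"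
  proof (intro sum_mono mult_left_mono)
    fix ij assume "ij \<in> {1..m} \<times> {1..n}"
    from data_lipschitz[OF this, of ?x 0] show "logistic (inner (a ij) ?x) \<le> ln 2 + B * norm ?x"
      by (simp add: logistic_zero del: disco_iterate.simps)
  qed (use scale_eta_pos[OF B \<gamma>] in auto)
  also have "\<dots> = ?V + ?G * norm ?x"
    using m n by (simp add: const_V0_def const_G_def algebra_simps)
  also have "?G * norm ?x \<le> ?V + ?G\<^sup>2 / (2 * lam)"
  proof -
    let ?s = "sqrt (2 * ?V / lam)"
    have s2: "?s\<^sup>2 = 2 * ?V / lam" using V lam_pos by simp
    have "?G * norm ?x \<le> ?G * ?s" using G init_norm by (intro mult_left_mono) auto
    \<comment> \<open>Young's inequality; by the value of \<open>?s\<close> the first term on the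
      right is V0.\<close>
    also have "\<dots> \<le> lam / 2 * ?s\<^sup>2 + ?G\<^sup>2 / (2 * lam)"
    proof -
      have "0 \<le> (lam * ?s - ?G)\<^sup>2 / (2 * lam)" using lam_pos by simp
      also have "\<dots> = lam / 2 * ?s\<^sup>2 + ?G\<^sup>2 / (2 * lam) - ?G * ?s"
        using lam_pos by (simp add: power2_eq_square field_simps)
      finally show ?thesis by linarith
    qed
    finally show ?thesis unfolding s2 using lam_pos by simp
  qed
  finally have "(\<Sum>ij\<in>{1..m} \<times> {1..n}. \<eta> / (m * n) * logistic (inner (a ij) ?x)) \<le> 2 * ?V + ?G\<^sup>2 / (2 * lam)"
    by simp
  moreover have "lam / 2 * (norm ?x)\<^sup>2 \<le> ?V"
  proof -
    have "(norm ?x)\<^sup>2 \<le> (sqrt (2 * ?V / lam))\<^sup>2" by (intro power_mono init_norm) auto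
    thus ?thesis using lam_pos V by (simp add: field_simps)
  qed
  ultimately show ?thesis unfolding reg_logistic_def const_F0_def by linarith
qed

text \<open>No step increases f, and f dominates lam / 2 times the squared norm. The resulting ball
  depends on the constants only and not on the data; it is the region that the grid of points has to
  cover.\<close>

lemma iterate_norm: "norm (emb (it k)) \<le> sqrt (2 * const_F0 B \<gamma> / lam)"
proof -
  have "lam / 2 * (norm (emb (it k)))\<^sup>2 \<le> const_F0 B \<gamma>"
    using norm_le_f[of "emb (it k)"] iterate_descends[of k] init_value by linarith
  hence "(norm (emb (it k)))\<^sup>2 \<le> 2 * const_F0 B \<gamma> / lam" using lam_pos by (simp add: field_simps)
  from real_sqrt_le_mono[OF this] show ?thesis by simp
qed

lemma gap_le_F0: "gap 0 \<le> const_F0 B \<gamma>"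
  using init_value f_nonneg[of "emb wopt"] by (simp add: gap_def del: One_nat_def disco_iterate.simps)

end

subsection \<open>Measurability of the round count\<close>

text \<open>Measurability of vectors is taken coordinatewise, and the dimension is required to be
  \<open>d\<close> for every argument, not just almost everywhere.\<close>

definition vmeas :: "'z measure \<Rightarrow> nat \<Rightarrow> ('z \<Rightarrow> real vec) \<Rightarrow> bool" where
  "vmeas M d V \<longleftrightarrow> (\<forall>z. V z \<in> carrier_vec d) \<and> (\<forall>i<d. (\<lambda>z. V z $ i) \<in> borel_measurable M)"

definition mmeas :: "'z measure \<Rightarrow> nat \<Rightarrow> ('z \<Rightarrow> real mat) \<Rightarrow> bool" where
  "mmeas M d A \<longleftrightarrow> (\<forall>z. A z \<in> carrier_mat d d) \<and> (\<forall>i<d. \<forall>j<d. (\<lambda>z. A z $$ (i, j)) \<in> borel_measurable M)"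

definition fmeas :: "'z measure \<Rightarrow> nat \<Rightarrow> ('z \<Rightarrow> fseq) \<Rightarrow> bool" where
  "fmeas M d X \<longleftrightarrow> (\<forall>z. X z \<in> supported d) \<and> (\<forall>i<d. (\<lambda>z. coord (X z) i) \<in> borel_measurable M)"

lemma vmeasD: "vmeas M d V \<Longrightarrow> V z \<in> carrier_vec d" "vmeas M d V \<Longrightarrow> i < d \<Longrightarrow> (\<lambda>z. V z $ i) \<in> borel_measurable M"
  by (auto simp: vmeas_def)

lemma mmeasD: "mmeas M d A \<Longrightarrow> A z \<in> carrier_mat d d"
    "mmeas M d A \<Longrightarrow> i < d \<Longrightarrow> j < d \<Longrightarrow> (\<lambda>z. A z $$ (i, j)) \<in> borel_measurable M"
  by (auto simp: mmeas_def)

lemma fmeasD: "fmeas M d X \<Longrightarrow> X z \<in> supported d" "fmeas M d X \<Longrightarrow> i < d \<Longrightarrow> (\<lambda>z. coord (X z) i) \<in> borel_measurable M"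
  by (auto simp: fmeas_def)

lemma vmeas_dim: "vmeas M d V \<Longrightarrow> dim_vec (V z) = d"
  using vmeasD(1)[of M d V z] by auto

lemma vmeasI:
  assumes "\<And>z. V z \<in> carrier_vec d" "\<And>z i. i < d \<Longrightarrow> V z $ i = X i z"
    "\<And>i. i < d \<Longrightarrow> X i \<in> borel_measurable M"
  shows "vmeas M d V"
  using assms by (auto simp: vmeas_def)

lemma vmeas_add:
  assumes V: "vmeas M d V" and W: "vmeas M d W" shows "vmeas M d (\<lambda>z. V z + W z)"
proof (rule vmeasI)
  show "(V z + W z) $ i = V z $ i + W z $ i" if "i < d" for z i
    using that vmeas_dim[OF W] by simp
qed (use vmeasD[OF V] vmeasD[OF W] in \<open>auto intro: borel_measurable_add\<close>)

lemma vmeas_minus: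
  assumes V: "vmeas M d V" and W: "vmeas M d W" shows "vmeas M d (\<lambda>z. V z - W z)"
proof (rule vmeasI)
  show "(V z - W z) $ i = V z $ i - W z $ i" if "i < d" for z i
    using that vmeas_dim[OF W] by simp
qed (use vmeasD[OF V] vmeasD[OF W] in \<open>auto intro: borel_measurable_diff\<close>)

lemma vmeas_smult:
  assumes c: "c \<in> borel_measurable M" and V: "vmeas M d V" shows "vmeas M d (\<lambda>z. c z \<cdot>\<^sub>v V z)"
proof (rule vmeasI)
  show "(c z \<cdot>\<^sub>v V z) $ i = c z * V z $ i" if "i < d" for z i
    using that vmeas_dim[OF V] by simp
qed (use vmeasD[OF V] c in \<open>auto intro: borel_measurable_times\<close>)

lemma vmeas_zero: "vmeas M d (\<lambda>z. 0\<^sub>v d)"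
  by (auto simp: vmeas_def)

lemma vmeas_scalar_prod:
  assumes "vmeas M d V" "vmeas M d W" shows "(\<lambda>z. V z \<bullet> W z) \<in> borel_measurable M"
  using vmeasD(2)[OF assms(1)] vmeasD(2)[OF assms(2)] vmeas_dim[OF assms(2)]
  by (auto simp: scalar_prod_def intro!: borel_measurable_sum borel_measurable_times)

lemma vmeas_mult:
  assumes A: "mmeas M d A" and V: "vmeas M d V" shows "vmeas M d (\<lambda>z. A z *\<^sub>v V z)"
proof -
  have "A z *\<^sub>v V z \<in> carrier_vec d" for z
    using mmeasD(1)[OF A] vmeasD(1)[OF V] by (rule mult_mat_vec_carrier)
  moreover have "(A z *\<^sub>v V z) $ i = (\<Sum>j<d. A z $$ (i, j) * V z $ j)" if "i < d" for z i
    using mmeasD(1)[OF A, of z] vmeas_dim[OF V, of z] that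
    by (auto simp: mult_mat_vec_def scalar_prod_def atLeast0LessThan intro!: sum.cong)
  ultimately show ?thesis
    using mmeasD(2)[OF A] vmeasD(2)[OF V] by (auto simp: vmeas_def intro!: borel_measurable_sum borel_measurable_times)
qed

lemma measurable_det:
  fixes A :: "'z \<Rightarrow> real mat"
  assumes "\<And>z. A z \<in> carrier_mat k k" "\<And>i j. i < k \<Longrightarrow> j < k \<Longrightarrow> (\<lambda>z. A z $$ (i, j)) \<in> borel_measurable M"
  shows "(\<lambda>z. det (A z)) \<in> borel_measurable (M :: 'z measure)"
  unfolding det_def'[OF assms(1)]
proof (intro borel_measurable_sum borel_measurable_times borel_measurable_prod borel_measurable_const)
  fix p i assume "p \<in> {p. p permutes {0..<k}}" "i \<in> {0..<k}"
  hence "p i < k" using permutes_in_image[of p "{0..<k}" i] by auto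
  thus "(\<lambda>z. A z $$ (i, p i)) \<in> borel_measurable M" using \<open>i \<in> {0..<k}\<close> assms(2) by auto
qed

text \<open>By Cramer's rule the entries are quotients of determinants in the entries of
  \<open>A z\<close>.\<close>

lemma mmeas_mat_inverse:
  fixes A :: "'z \<Rightarrow> real mat"
  assumes A: "mmeas M d A" and inj: "\<And>z v. v \<in> carrier_vec d \<Longrightarrow> A z *\<^sub>v v = 0\<^sub>v d \<Longrightarrow> v = 0\<^sub>v d"
  shows "mmeas M d (\<lambda>z. the (mat_inverse (A z)))"
proof -
  have c: "A z \<in> carrier_mat d d" for z by (rule mmeasD(1)[OF A])
  have dims: "dim_row (A z) = d" "dim_col (A z) = d" for z using c[of z] by auto
  have inv: "the (mat_inverse (A z)) = (1 / det (A z)) \<cdot>\<^sub>m adj_mat (A z)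
      \<and> the (mat_inverse (A z)) \<in> carrier_mat d d" for z
  proof -
    obtain B where "mat_inverse (A z) = Some B" "B \<in> carrier_mat d d" "B = (1 / det (A z)) \<cdot>\<^sub>m adj_mat (A z)"
      using mat_inverse_posdef[OF c[of z] inj[of _ z]] by blast
    thus ?thesis by simp
  qed
  have del: "(\<lambda>z. det (mat_delete (A z) i j)) \<in> borel_measurable M" if "i < d" "j < d" for i j
  proof (rule measurable_det[where k = "d - 1"])
    show "mat_delete (A z) i j \<in> carrier_mat (d - 1) (d - 1)" for z
      using mat_delete_carrier[OF c[of z]] by simp
    fix k l assume kl: "k < d - 1" "l < d - 1"
    have "mat_delete (A z) i j $$ (k, l) = A z $$ (if k < i then k else Suc k, if l < j then l else Suc l)" for z
      using kl dims[of z] by (simp add: mat_delete_def)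
    thus "(\<lambda>z. mat_delete (A z) i j $$ (k, l)) \<in> borel_measurable M"
      using kl by (auto intro!: mmeasD(2)[OF A])
  qed
  have "the (mat_inverse (A z)) $$ (i, j) = 1 / det (A z) * ((-1) ^ (j + i) * det (mat_delete (A z) j i))"
    if "i < d" "j < d" for z i j
    using that inv[of z] dims[of z] by (simp add: adj_mat_def cofactor_def)
  moreover have "(\<lambda>z. det (A z)) \<in> borel_measurable M"
    by (rule measurable_det[OF c mmeasD(2)[OF A]])
  ultimately have "(\<lambda>z. the (mat_inverse (A z)) $$ (i, j)) \<in> borel_measurable M" if "i < d" "j < d" for i j
    using that del by (auto intro!: borel_measurable_times borel_measurable_divide)
  moreover have "the (mat_inverse (A z)) \<in> carrier_mat d d" for z using inv by blast
  ultimately show ?thesis unfolding mmeas_def by blast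
qed

lemma fmeas_add: "fmeas M d X \<Longrightarrow> fmeas M d Y \<Longrightarrow> fmeas M d (\<lambda>z. X z + Y z)"
  and fmeas_diff: "fmeas M d X \<Longrightarrow> fmeas M d Y \<Longrightarrow> fmeas M d (\<lambda>z. X z - Y z)"
  and fmeas_scale: "c \<in> borel_measurable M \<Longrightarrow> fmeas M d X \<Longrightarrow> fmeas M d (\<lambda>z. c z *\<^sub>R X z)"
  by (auto simp: fmeas_def intro!: borel_measurable_add borel_measurable_diff borel_measurable_times)

lemma fmeas_sum: "(\<And>j. j \<in> J \<Longrightarrow> fmeas M d (X j)) \<Longrightarrow> fmeas M d (\<lambda>z. \<Sum>j\<in>J. X j z)"
  by (auto simp: fmeas_def coord_sum intro!: supported_sum borel_measurable_sum)

lemma fmeas_const: "x \<in> supported d \<Longrightarrow> fmeas M d (\<lambda>z. x)"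
  by (auto simp: fmeas_def)

lemma fmeas_inner:
  assumes "fmeas M d X" "fmeas M d Y" shows "(\<lambda>z. inner (X z) (Y z)) \<in> borel_measurable M"
  using assms by (auto simp: inner_supported[OF fmeasD(1)[OF assms(1)]] fmeas_def
      intro!: borel_measurable_sum borel_measurable_times)

lemma fmeas_norm: "fmeas M d X \<Longrightarrow> (\<lambda>z. norm (X z)) \<in> borel_measurable M"
  unfolding norm_eq_sqrt_inner
  by (rule measurable_compose[OF fmeas_inner borel_measurable_sqrt])

lemma vmeas_norm: "vmeas M d V \<Longrightarrow> (\<lambda>z. vec_norm (V z)) \<in> borel_measurable M"
  unfolding vec_norm_def
  by (rule measurable_compose[OF vmeas_scalar_prod borel_measurable_sqrt])

lemma fmeas_emb:
  assumes V: "vmeas M d V" shows "fmeas M d (\<lambda>z. emb (V z))"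
proof -
  have "coord (emb (V z)) i = V z $ i" if "i < d" for z i
    using that vmeas_dim[OF V] by (simp add: coord_emb)
  thus ?thesis using vmeasD[OF V] by (auto simp: fmeas_def)
qed

lemma logistic_measurable [measurable]:
  "logistic \<in> borel_measurable borel" "logistic1 \<in> borel_measurable borel" "logistic2 \<in> borel_measurable borel"
  unfolding logistic_def[abs_def] logistic1_def[abs_def] logistic2_def[abs_def] by measurable

context
  fixes M :: "'z measure" and d :: nat and J :: "'j set" and a :: "'z \<Rightarrow> 'j \<Rightarrow> fseq" and x v :: "'z \<Rightarrow> fseq"
  assumes a: "\<And>j. j \<in> J \<Longrightarrow> fmeas M d (\<lambda>z. a z j)" and x: "fmeas M d x"
begin

lemma measurable_inner_ax: "j \<in> J \<Longrightarrow> (\<lambda>z. inner (a z j) (x z)) \<in> borel_measurable M"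
  by (rule fmeas_inner[OF a x])

lemma measurable_reg_logistic: "(\<lambda>z. reg_logistic J c (a z) lam (x z)) \<in> borel_measurable M"
  unfolding reg_logistic_def using fmeas_norm[OF x] measurable_inner_ax
  by (intro borel_measurable_add borel_measurable_sum borel_measurable_times borel_measurable_power
      measurable_compose[OF _ logistic_measurable(1)]) auto

lemma fmeas_reg_grad: "fmeas M d (\<lambda>z. reg_grad J c (a z) lam (x z))"
proof -
  have "fmeas M d (\<lambda>z. (c * logistic1 (inner (a z j) (x z))) *\<^sub>R a z j)" if "j \<in> J" for j
    by (rule fmeas_scale[OF borel_measurable_times[OF borel_measurable_const
          measurable_compose[OF measurable_inner_ax[OF that] logistic_measurable(2)]] a[OF that]])
  from fmeas_add[OF fmeas_sum[OF this] fmeas_scale[OF borel_measurable_const x]]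
  show ?thesis by (simp only: reg_grad_def)
qed

lemma fmeas_reg_hess:
  assumes v: "fmeas M d v" shows "fmeas M d (\<lambda>z. reg_hess J c (a z) lam (x z) (v z))"
proof -
  have "fmeas M d (\<lambda>z. (c * logistic2 (inner (a z j) (x z)) * inner (a z j) (v z)) *\<^sub>R a z j)" if "j \<in> J" for j
    by (rule fmeas_scale[OF borel_measurable_times[OF borel_measurable_times[OF borel_measurable_const
          measurable_compose[OF measurable_inner_ax[OF that] logistic_measurable(3)]]
          fmeas_inner[OF a[OF that] v]] a[OF that]])
  from fmeas_add[OF fmeas_sum[OF this] fmeas_scale[OF borel_measurable_const v]]
  show ?thesis by (simp only: reg_hess_def)
qed

end

text \<open>A pointwise limit of the descent iterates, each of which is an explicit measurable
  function of the data.\<close>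

lemma vmeas_minimizer:
  assumes obj: "\<And>z. coordinate_objective J c (a z) lam d (F z)"
    and a: "\<And>j. j \<in> J \<Longrightarrow> fmeas M d (\<lambda>z. a z j)"
  shows "vmeas M d (\<lambda>z. minimizer d (F z))"
proof -
  let ?D = "\<lambda>z. coordinate_objective.descent J c (a z) lam"
  have K: "(\<lambda>z. coordinate_objective.lipschitz_const J c (a z) lam) \<in> borel_measurable M"
    unfolding coordinate_objective.lipschitz_const_def[OF obj]
    by (intro borel_measurable_add borel_measurable_sum borel_measurable_times borel_measurable_power
        borel_measurable_const fmeas_norm[OF a])
  have "fmeas M d (\<lambda>z. ?D z k)" for k
  proof (induction k)
    case 0 show ?case by (simp add: coordinate_objective.descent.simps[OF obj] fmeas_const)
  next
    case (Suc k)
    show ?case unfolding coordinate_objective.descent.simps[OF obj]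
      by (rule fmeas_diff[OF Suc fmeas_scale[OF borel_measurable_divide[OF borel_measurable_const
          borel_measurable_power[OF K]] fmeas_reg_grad[OF a Suc]]])
  qed
  hence D: "(\<lambda>z. coord (?D z k) i) \<in> borel_measurable M" if "i < d" for i k
    using that fmeasD(2) by blast
  have "(\<lambda>z. minimizer d (F z) $ i) \<in> borel_measurable M" if "i < d" for i
    by (rule borel_measurable_LIMSEQ_real[where u = "\<lambda>k z. coord (?D z k) i"])
      (rule coordinate_objective.minimizer_descent_limit[OF obj that], rule D[OF that])
  thus ?thesis unfolding vmeas_def using coordinate_objective.minimizer_props(1)[OF obj] by blast
qed

lemma vmeas_pcg_state:
  assumes H: "mmeas M d H" and P: "mmeas M d (\<lambda>z. the (mat_inverse (P z)))" and g: "vmeas M d g"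
  shows "vmeas M d (\<lambda>z. pcg_v d (H z) (P z) (g z) t) \<and> vmeas M d (\<lambda>z. pcg_r d (H z) (P z) (g z) t) \<and>
    vmeas M d (\<lambda>z. pcg_s d (H z) (P z) (g z) t) \<and> vmeas M d (\<lambda>z. pcg_u d (H z) (P z) (g z) t)"
proof (induction t)
  case 0
  show ?case using vmeas_mult[OF P g] g by (simp add: pcg_parts_0 vmeas_zero)
next
  case (Suc t)
  have Hu: "vmeas M d (\<lambda>z. H z *\<^sub>v pcg_u d (H z) (P z) (g z) t)"
    using Suc by (intro vmeas_mult[OF H]) simp
  have v: "vmeas M d (\<lambda>z. pcg_v d (H z) (P z) (g z) (Suc t))"
    unfolding pcg_parts_Suc(1) using Suc Hu
    by (intro vmeas_add vmeas_smult borel_measurable_divide vmeas_scalar_prod) auto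
  have r: "vmeas M d (\<lambda>z. pcg_r d (H z) (P z) (g z) (Suc t))"
    unfolding pcg_parts_Suc(2) using Suc Hu
    by (intro vmeas_minus vmeas_smult borel_measurable_divide vmeas_scalar_prod) auto
  have s: "vmeas M d (\<lambda>z. pcg_s d (H z) (P z) (g z) (Suc t))"
    unfolding pcg_parts_Suc(3) by (rule vmeas_mult[OF P r])
  have u: "vmeas M d (\<lambda>z. pcg_u d (H z) (P z) (g z) (Suc t))"
    unfolding pcg_parts_Suc(4) using Suc r s
    by (intro vmeas_add vmeas_smult borel_measurable_divide vmeas_scalar_prod) auto
  show ?case using v r s u by blast
qed

section \<open>Measurability of every stage of the algorithm\<close>

locale measurable_data =
  fixes M :: "(nat \<times> nat \<Rightarrow> sample) measure" and d m n :: nat and B \<gamma> :: real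
  assumes d: "d \<ge> 1" and m: "m \<ge> 1" and n: "n \<ge> 1" and B: "B > 0" and \<gamma>: "\<gamma> > 0"
    and fst_measurable: "\<And>ij k. ij \<in> {1..m} \<times> {1..n} \<Longrightarrow> k < d \<Longrightarrow> (\<lambda>z. fst (z ij) k) \<in> borel_measurable M"
    and snd_measurable: "\<And>ij. ij \<in> {1..m} \<times> {1..n} \<Longrightarrow> (\<lambda>z. snd (z ij)) \<in> borel_measurable M"
begin

sublocale disco_data d m n B \<gamma> z for z
  using d m n B \<gamma> by unfold_locales

lemma fmeas_data:
  assumes "ij \<in> {1..m} \<times> {1..n}" shows "fmeas M d (\<lambda>z. data_vec d (z ij))"
proof -
  have "vmeas M d (\<lambda>z. feature d (z ij))"
    by (rule vmeasI[where X = "\<lambda>k z. fst (z ij) k"]) (use fst_measurable[OF assms] in \<open>simp_all add: feature_def\<close>)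
  from fmeas_scale[OF snd_measurable[OF assms] fmeas_emb[OF this]]
  show ?thesis by (simp only: data_vec_def label_def)
qed

lemma vmeas_lmin:
  assumes i: "i \<in> {1..m}" and rho: "\<rho> \<ge> 0"
  shows "vmeas M d (\<lambda>z. minimizer d (\<lambda>w. local_loss d n B \<gamma> z i w + \<rho> / 2 * (vec_norm w)\<^sup>2))"
  by (rule vmeas_minimizer[OF reg_objective[OF rho] fmeas_data]) (use i in simp)

lemma vmeas_wopt: "vmeas M d (\<lambda>z. minimizer d (average_obj m (local_loss d n B \<gamma> z)))"
  by (rule vmeas_minimizer[OF avg.coordinate_objective_axioms fmeas_data])

lemma vmeas_init:
  assumes "\<rho> \<ge> 0" shows "vmeas M d (\<lambda>z. disco_init d m (local_loss d n B \<gamma> z) \<rho>)"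
proof (rule vmeasI)
  show "disco_init d m (local_loss d n B \<gamma> z) \<rho> $ k = 1 / m * (\<Sum>i = 1..m.
      minimizer d (\<lambda>w. local_loss d n B \<gamma> z i w + \<rho> / 2 * (vec_norm w)\<^sup>2) $ k)" if "k < d" for z k
    using that by (simp add: disco_init_def)
  show "(\<lambda>z. 1 / m * (\<Sum>i = 1..m. minimizer d (\<lambda>w. local_loss d n B \<gamma> z i w + \<rho> / 2 * (vec_norm w)\<^sup>2) $ k))
      \<in> borel_measurable M" if "k < d" for k
    by (intro borel_measurable_times borel_measurable_const borel_measurable_sum vmeasD(2)[OF vmeas_lmin] assms that)
qed (simp add: disco_init_def)

lemma mmeas_hess:
  assumes w: "vmeas M d w"
  shows "mmeas M d (\<lambda>z. disco_hess d m (local_loss d n B \<gamma> z) (w z))"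
proof -
  have e: "disco_hess d m (local_loss d n B \<gamma> z) (w z) $$ (i, j) = coord (fhess z (emb (w z)) (axis_seq d j)) i"
    if "i < d" "j < d" for z i j
    unfolding disco_hess_def by (rule avg.hessian_entry[OF vmeasD(1)[OF w] that])
  have fm: "fmeas M d (\<lambda>z. fhess z (emb (w z)) (axis_seq d j))" for j
    by (rule fmeas_reg_hess[OF fmeas_data fmeas_emb[OF w] fmeas_const]) simp_all
  have "(\<lambda>z. disco_hess d m (local_loss d n B \<gamma> z) (w z) $$ (i, j)) \<in> borel_measurable M"
    if "i < d" "j < d" for i j
    unfolding e[OF that] by (rule fmeasD(2)[OF fm that(1)])
  thus ?thesis unfolding mmeas_def using hess_carrier by blast
qed

lemma mmeas_precond:
  assumes w: "vmeas M d w"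
  shows "mmeas M d (\<lambda>z. disco_precond d (local_loss d n B \<gamma> z) \<mu> (w z))"
proof -
  have e: "disco_precond d (local_loss d n B \<gamma> z) \<mu> (w z) $$ (i, j)
      = coord (lhess z 1 (emb (w z)) (axis_seq d j)) i + \<mu> * (if i = j then 1 else 0)"
    if "i < d" "j < d" for z i j
    using loc.hessian_entry[OF vmeasD(1)[OF w] that, of z 1 z] that
    by (simp add: disco_precond_def hessian_def)
  have fm: "fmeas M d (\<lambda>z. lhess z 1 (emb (w z)) (axis_seq d j))" for j
    by (rule fmeas_reg_hess[OF fmeas_data fmeas_emb[OF w] fmeas_const]) (use m in simp_all)
  have "(\<lambda>z. disco_precond d (local_loss d n B \<gamma> z) \<mu> (w z) $$ (i, j)) \<in> borel_measurable M"
    if "i < d" "j < d" for i j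
    unfolding e[OF that]
    by (rule borel_measurable_add[OF fmeasD(2)[OF fm that(1)] borel_measurable_const])
  thus ?thesis unfolding mmeas_def using precond_carrier by blast
qed

lemma vmeas_grad:
  assumes w: "vmeas M d w"
  shows "vmeas M d (\<lambda>z. disco_grad d m (local_loss d n B \<gamma> z) (w z))"
proof -
  have "disco_grad d m (local_loss d n B \<gamma> z) (w z) = prj d (fgrad z (emb (w z)))" for z
    unfolding disco_grad_def by (rule avg.gradient_eq[OF vmeasD(1)[OF w]])
  moreover have "fmeas M d (\<lambda>z. fgrad z (emb (w z)))"
    by (rule fmeas_reg_grad[OF fmeas_data fmeas_emb[OF w]])
  ultimately show ?thesis by (auto simp: vmeas_def fmeas_def prj_def)
qed

context
  fixes \<mu> L :: real and w :: "(nat \<times> nat \<Rightarrow> sample) \<Rightarrow> real vec"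
  assumes mu: "\<mu> \<ge> 0" and w: "vmeas M d w"
begin

abbreviation (input) "Hz z \<equiv> disco_hess d m (local_loss d n B \<gamma> z) (w z)"
abbreviation (input) "Pz z \<equiv> disco_precond d (local_loss d n B \<gamma> z) \<mu> (w z)"
abbreviation (input) "gz z \<equiv> disco_grad d m (local_loss d n B \<gamma> z) (w z)"
abbreviation (input) "tz z \<equiv> disco_tol d m (local_loss d n B \<gamma> z) (const_lambda B \<gamma>) L (w z)"

lemma vmeas_pcg:
  "vmeas M d (\<lambda>z. pcg_v d (Hz z) (Pz z) (gz z) t)" "vmeas M d (\<lambda>z. pcg_r d (Hz z) (Pz z) (gz z) t)"
proof -
  have inv: "mmeas M d (\<lambda>z. the (mat_inverse (Pz z)))"
    by (rule mmeas_mat_inverse[OF mmeas_precond[OF w]]) (rule precond_injective[OF vmeasD(1)[OF w] _ _ mu])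
  show "vmeas M d (\<lambda>z. pcg_v d (Hz z) (Pz z) (gz z) t)" "vmeas M d (\<lambda>z. pcg_r d (Hz z) (Pz z) (gz z) t)"
    using vmeas_pcg_state[OF mmeas_hess[OF w] inv vmeas_grad[OF w], of t] by simp_all
qed

lemma pred_stop: "Measurable.pred M (\<lambda>z. pcg_stop d (Hz z) (Pz z) (gz z) (tz z) t)"
proof -
  have 1: "(\<lambda>z. vec_norm (pcg_r d (Hz z) (Pz z) (gz z) (Suc t))) \<in> borel_measurable M"
    by (rule vmeas_norm[OF vmeas_pcg(2)])
  have 2: "tz \<in> borel_measurable M"
    unfolding disco_tol_def by (intro borel_measurable_times borel_measurable_const vmeas_norm[OF vmeas_grad[OF w]])
  show ?thesis
    unfolding pcg_stop_def pcg_residual_def pcg_r_def[symmetric] pred_def by (rule borel_measurable_le[OF 1 2])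
qed

lemma pred_grad_zero: "Measurable.pred M (\<lambda>z. gz z = 0\<^sub>v d)"
proof -
  have eq: "gz z = 0\<^sub>v d \<longleftrightarrow> (\<forall>i\<in>{..<d}. gz z $ i = 0)" for z
    using vmeas_dim[OF vmeas_grad[OF w]] by (auto intro!: eq_vecI)
  have "Measurable.pred M (\<lambda>z. gz z $ i = 0)" if "i < d" for i
    unfolding pred_def by (intro borel_measurable_eq vmeasD(2)[OF vmeas_grad[OF w] that] borel_measurable_const)
  hence "Measurable.pred M (\<lambda>z. \<forall>i\<in>{..<d}. gz z $ i = 0)"
    unfolding pred_def by (intro sets.sets_Collect_finite_All) simp_all
  thus ?thesis by (simp only: eq)
qed

lemma measurable_stop_index:
  "(\<lambda>z. LEAST t. pcg_stop d (Hz z) (Pz z) (gz z) (tz z) t) \<in> measurable M (count_space UNIV)"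
  by (rule measurable_Least[OF pred_stop])

text \<open>The stopping index takes countably many values, so the result is glued from countably
  many measurable iterates. Data on which the run never stops are included; there the index is the
  fixed value of an unsatisfiable \<open>LEAST\<close>.\<close>

lemma vmeas_dir:
  "vmeas M d (\<lambda>z. disco_dir d m (local_loss d n B \<gamma> z) (const_lambda B \<gamma>) L \<mu> (w z))"
proof -
  let ?T = "\<lambda>z. LEAST t. pcg_stop d (Hz z) (Pz z) (gz z) (tz z) t"
  have eq: "disco_dir d m (local_loss d n B \<gamma> z) (const_lambda B \<gamma>) L \<mu> (w z)
      = (if gz z = 0\<^sub>v d then 0\<^sub>v d else pcg_v d (Hz z) (Pz z) (gz z) (Suc (?T z)))" for z
    by (simp add: disco_dir_def pcg_result_def pcg_iterate_def pcg_v_def del: pcg_state.simps)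
  have "(\<lambda>z. pcg_v d (Hz z) (Pz z) (gz z) (Suc (?T z)) $ i) \<in> borel_measurable M" if "i < d" for i
    by (rule measurable_compose_countable[OF vmeasD(2)[OF vmeas_pcg(1) that] measurable_stop_index])
  hence "(\<lambda>z. (if gz z = 0\<^sub>v d then 0\<^sub>v d else pcg_v d (Hz z) (Pz z) (gz z) (Suc (?T z))) $ i) \<in> borel_measurable M"
    if "i < d" for i
    using that pred_grad_zero unfolding if_distrib[of "\<lambda>v. v $ i"] by (intro measurable_If) (auto simp: pred_def)
  thus ?thesis unfolding eq using vmeasD(1)[OF vmeas_pcg(1)] by (auto simp: vmeas_def)
qed

lemma measurable_pcg_rounds:
  "(\<lambda>z. disco_pcg_rounds d m (local_loss d n B \<gamma> z) (const_lambda B \<gamma>) L \<mu> (w z)) \<in> measurable M (count_space UNIV)"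
proof -
  have "Measurable.pred M (\<lambda>z. \<exists>t. pcg_stop d (Hz z) (Pz z) (gz z) (tz z) t)"
    using pred_stop unfolding pred_def by (rule sets.sets_Collect_countable_Ex)
  moreover have "(\<lambda>z. 1 + enat (Suc (LEAST t. pcg_stop d (Hz z) (Pz z) (gz z) (tz z) t))) \<in> measurable M (count_space UNIV)"
    by (rule measurable_compose[OF measurable_stop_index]) simp
  ultimately show ?thesis
    unfolding disco_pcg_rounds_def pcg_rounds_def using pred_grad_zero
    by (intro measurable_If) (auto simp: pred_def)
qed

end

lemma vmeas_iterate:
  assumes "\<mu> \<ge> 0" "\<rho> \<ge> 0"
  shows "vmeas M d (\<lambda>z. disco_iterate d m (local_loss d n B \<gamma> z) (const_lambda B \<gamma>) L \<rho> \<mu> k)"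
proof (induction k)
  case 0 show ?case using vmeas_init[OF assms(2)] by simp
next
  case (Suc k)
  note dir = vmeas_dir[OF assms(1) Suc, of L]
  note prod = vmeas_scalar_prod[OF dir vmeas_mult[OF mmeas_hess[OF Suc] dir]]
  show ?case unfolding disco_iterate.simps Let_def
    by (intro vmeas_minus Suc vmeas_smult dir borel_measurable_divide borel_measurable_add
        borel_measurable_const measurable_compose[OF prod borel_measurable_sqrt])
qed

lemma pred_accurate:
  assumes "\<mu> \<ge> 0" "\<rho> \<ge> 0"
  shows "Measurable.pred M (\<lambda>z. disco_accurate d m (local_loss d n B \<gamma> z) (const_lambda B \<gamma>) L \<rho> \<mu> \<epsilon> k)"
proof -
  have obj: "(\<lambda>z. average_obj m (local_loss d n B \<gamma> z) (v z)) \<in> borel_measurable M" if v: "vmeas M d v" for v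
    unfolding average_obj_eq[OF vmeasD(1)[OF v]]
    by (rule measurable_reg_logistic[OF fmeas_data fmeas_emb[OF v]])
  show ?thesis unfolding disco_accurate_def pred_def
    by (intro borel_measurable_le borel_measurable_diff borel_measurable_const obj vmeas_iterate assms vmeas_wopt)
qed

lemma measurable_rounds_upto:
  assumes "\<mu> \<ge> 0" "\<rho> \<ge> 0"
  shows "(\<lambda>z. disco_rounds_upto d m (local_loss d n B \<gamma> z) (const_lambda B \<gamma>) L \<rho> \<mu> k) \<in> measurable M (count_space UNIV)"
proof -
  have plus: "(\<lambda>z. f z + g z) \<in> measurable M (count_space UNIV)"
    if f: "f \<in> measurable M (count_space UNIV)" and g: "g \<in> measurable M (count_space UNIV)"
    for f g :: "_ \<Rightarrow> enat"
  proof (rule measurable_compose_countable[where g = f, OF _ f])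
    show "(\<lambda>z. i + g z) \<in> measurable M (count_space UNIV)" for i
      by (rule measurable_compose[OF g]) simp
  qed
  have "(\<lambda>z. \<Sum>j<k. disco_pcg_rounds d m (local_loss d n B \<gamma> z) (const_lambda B \<gamma>) L \<mu>
      (disco_iterate d m (local_loss d n B \<gamma> z) (const_lambda B \<gamma>) L \<rho> \<mu> j)) \<in> measurable M (count_space UNIV)"
  proof (induction k)
    case (Suc k)
    show ?case unfolding sum.lessThan_Suc
      by (intro plus Suc measurable_pcg_rounds vmeas_iterate assms)
  qed simp
  thus ?thesis unfolding disco_rounds_upto_def by (intro plus) auto
qed

theorem measurable_comm_rounds:
  assumes "const_mu d m n B \<gamma> D \<ge> 0" "const_rho n B \<gamma> D \<ge> 0"
  shows "(\<lambda>z. ennreal_of_enat (comm_rounds d m n B \<gamma> D \<epsilon> z)) \<in> borel_measurable M"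
proof -
  let ?acc = "\<lambda>z k. disco_accurate d m (local_loss d n B \<gamma> z) (const_lambda B \<gamma>) (const_L B \<gamma>)
    (const_rho n B \<gamma> D) (const_mu d m n B \<gamma> D) \<epsilon> k"
  note acc = pred_accurate[OF assms, of "const_L B \<gamma>" \<epsilon>]
  have "Measurable.pred M (\<lambda>z. \<exists>k. ?acc z k)" using acc unfolding pred_def by (rule sets.sets_Collect_countable_Ex)
  moreover have "(\<lambda>z. LEAST k. ?acc z k) \<in> measurable M (count_space UNIV)"
    by (rule measurable_Least[OF acc])
  ultimately have "comm_rounds d m n B \<gamma> D \<epsilon> \<in> measurable M (count_space UNIV)"
    unfolding comm_rounds_def[abs_def] disco_total_rounds_def
    by (intro measurable_If measurable_compose_countable[OF measurable_rounds_upto[OF assms]])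
      (auto simp: pred_def)
  from measurable_compose[OF this, of ennreal_of_enat borel] show ?thesis by simp
qed

end

subsection \<open>Quality of the initial point\<close>

text \<open>Replacing one sample changes one summand of the gradient, by at most 2 c B in norm;
  strong monotonicity with modulus \<open>l\<close> divides this by \<open>l\<close>.\<close>

lemma minimizer_stability:
  assumes o: "coordinate_objective J c a l d F" and o': "coordinate_objective J c a' l d F'"
    and j0: "j0 \<in> J" and eq: "\<And>j. j \<in> J \<Longrightarrow> j \<noteq> j0 \<Longrightarrow> a j = a' j"
    and bd: "norm (a j0) \<le> B" "norm (a' j0) \<le> B"
  shows "norm (emb (minimizer d F) - emb (minimizer d F')) \<le> 2 * c * B / l"
proof -
  interpret o: coordinate_objective J c a l d F by fact
  interpret o': coordinate_objective J c a' l d F' by fact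
  let ?x = "emb (minimizer d F)" and ?y = "emb (minimizer d F')"
  let ?r = "norm (?x - ?y)"
  have gx: "o.g ?x = 0" and gy: "o'.g ?y = 0" by (rule o.minimizer_props o'.minimizer_props)+
  have "o'.g ?y - o.g ?y = (\<Sum>j\<in>J. (c * logistic1 (inner (a' j) ?y)) *\<^sub>R a' j - (c * logistic1 (inner (a j) ?y)) *\<^sub>R a j)"
    by (simp add: reg_grad_def sum_subtractf)
  also have "\<dots> = (\<Sum>j\<in>{j0}. (c * logistic1 (inner (a' j) ?y)) *\<^sub>R a' j - (c * logistic1 (inner (a j) ?y)) *\<^sub>R a j)"
    using o.finite_J j0 eq by (intro sum.mono_neutral_right) auto
  finally have diff: "o'.g ?y - o.g ?y = (c * logistic1 (inner (a' j0) ?y)) *\<^sub>R a' j0 - (c * logistic1 (inner (a j0) ?y)) *\<^sub>R a j0"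
    by simp
  have one: "norm ((c * logistic1 t) *\<^sub>R v) \<le> c * B" if "norm v \<le> B" for t and v :: fseq
  proof -
    have "\<bar>logistic1 t\<bar> * norm v \<le> 1 * B"
      using that by (intro mult_mono abs_logistic1_le) auto
    from mult_left_mono[OF this o.c_nonneg] show ?thesis
      using o.c_nonneg by (simp add: abs_mult mult.assoc)
  qed
  have "norm (o'.g ?y - o.g ?y) \<le> c * B + c * B"
    unfolding diff by (rule order_trans[OF norm_triangle_ineq4 add_mono[OF one[OF bd(2)] one[OF bd(1)]]])
  hence nd: "norm (o'.g ?y - o.g ?y) \<le> 2 * c * B" by linarith
  have "l * ?r\<^sup>2 \<le> inner (o.g ?x - o.g ?y) (?x - ?y)" by (rule o.grad_strongly_monotone)
  also have "\<dots> = inner (o'.g ?y - o.g ?y) (?x - ?y)" by (simp add: gx gy)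
  also have "\<dots> \<le> norm (o'.g ?y - o.g ?y) * ?r" by (rule norm_cauchy_schwarz)
  also have "\<dots> \<le> 2 * c * B * ?r" using nd by (intro mult_right_mono) auto
  finally have "?r * (l * ?r) \<le> ?r * (2 * c * B)" by (simp add: power2_eq_square mult_ac)
  moreover have "0 \<le> 2 * c * B" using nd norm_ge_zero order_trans by blast
  ultimately have "l * ?r \<le> 2 * c * B" by (cases "?r = 0") auto
  thus ?thesis using o.lam_pos by (simp add: field_simps)
qed

context bounded_disco
begin

abbreviation "floc k \<equiv> reg_logistic {1..n} (\<eta> / n) (\<lambda>j. a (k, j)) lam"

lemma f_average: "f x = (1 / m) * (\<Sum>k = 1..m. floc k x)"
proof -
  have "(\<Sum>k = 1..m. floc k x) = (\<Sum>k = 1..m. \<Sum>j = 1..n. \<eta> / n * logistic (inner (a (k, j)) x)) + real m * (lam / 2 * (norm x)\<^sup>2)"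
    by (simp add: reg_logistic_def sum.distrib del: One_nat_def)
  moreover have "(1 / m) * (\<Sum>k = 1..m. \<Sum>j = 1..n. \<eta> / n * logistic (inner (a (k, j)) x))
      = (\<Sum>ij\<in>{1..m} \<times> {1..n}. \<eta> / (m * n) * logistic (inner (a ij) x))"
    by (simp add: sum.cartesian_product sum_distrib_left case_prod_beta field_simps del: One_nat_def)
  ultimately show ?thesis using m by (simp add: reg_logistic_def[of "_ \<times> _"] distrib_left del: One_nat_def of_nat_mult)
qed

text \<open>Optimality bounds the local loss of machine i at its own minimizer by its value at
  \<open>wopt\<close> plus the regularizer there. Passing from this local loss to f adds the
  difference of foreign and own losses. Averaging over i recovers f at \<open>wopt\<close>, and
  convexity handles the averaged initial point.\<close>

lemma init_gap_le:
  "gap 0 \<le> \<rho> / 2 * (norm (emb wopt))\<^sup>2 + (1 / m) * (\<Sum>i = 1..m. (1 / m) * (\<Sum>k = 1..m. \<Sum>j = 1..n.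
     \<eta> / n * (logistic (inner (a (k, j)) (emb (lmin i))) - logistic (inner (a (i, j)) (emb (lmin i))))))"
proof -
  let ?ws = "emb wopt"
  let ?D = "\<lambda>i. (1 / m) * (\<Sum>k = 1..m. \<Sum>j = 1..n.
     \<eta> / n * (logistic (inner (a (k, j)) (emb (lmin i))) - logistic (inner (a (i, j)) (emb (lmin i)))))"
  have reg: "freg i x = floc i x + \<rho> / 2 * (norm x)\<^sup>2" for i x
    by (simp add: reg_logistic_def add_divide_distrib distrib_right)
  have main: "f (emb (lmin i)) \<le> floc i ?ws + \<rho> / 2 * (norm ?ws)\<^sup>2 + ?D i" for i
  proof -
    let ?x = "emb (lmin i)"
    have "floc k ?x - floc i ?x = (\<Sum>j = 1..n. \<eta> / n * (logistic (inner (a (k, j)) ?x) - logistic (inner (a (i, j)) ?x)))" for k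
      by (simp add: reg_logistic_def sum_subtractf right_diff_distrib del: One_nat_def)
    hence "?D i = (1 / m) * (\<Sum>k = 1..m. floc k ?x - floc i ?x)" by presburger
    also have "\<dots> = f ?x - floc i ?x"
      unfolding f_average[of ?x] using m by (simp add: sum_subtractf right_diff_distrib del: One_nat_def)
    finally have "f ?x = floc i ?x + ?D i" by simp
    moreover have "0 \<le> \<rho> / 2 * (norm ?x)\<^sup>2" using rho by simp
    ultimately show ?thesis using lmin_le[of i ?ws] unfolding reg by linarith
  qed
  have "f (emb (it 0)) \<le> (1 / m) * (\<Sum>i = 1..m. f (emb (lmin i)))" by (rule init_jensen)
  also have "\<dots> \<le> (1 / m) * (\<Sum>i = 1..m. floc i ?ws + \<rho> / 2 * (norm ?ws)\<^sup>2 + ?D i)"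
    by (intro mult_left_mono sum_mono main) auto
  also have "\<dots> = (1 / m) * (\<Sum>i = 1..m. floc i ?ws) + (1 / m) * (\<Sum>i = 1..m. \<rho> / 2 * (norm ?ws)\<^sup>2) + (1 / m) * (\<Sum>i = 1..m. ?D i)"
    by (simp only: sum.distrib distrib_left)
  also have "(1 / m) * (\<Sum>i = 1..m. floc i ?ws) = f ?ws" by (rule f_average[symmetric])
  also have "(1 / m) * (\<Sum>i = 1..m. \<rho> / 2 * (norm ?ws)\<^sup>2) = \<rho> / 2 * (norm ?ws)\<^sup>2" using m by simp
  finally show ?thesis unfolding gap_def by linarith
qed

end

locale erm_sampling =
  fixes d m n :: nat and B \<gamma> :: real and X :: "real vec set" and Q :: "sample measure"
  assumes d1: "d \<ge> 1" and m1: "m \<ge> 1" and n1: "n \<ge> 1" and B0: "B > 0" and \<gamma>0: "\<gamma> > 0"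
    and X_bound: "\<And>x. x \<in> X \<Longrightarrow> vec_norm x \<le> B"
    and prob_Q: "prob_space Q" and sets_Q: "sets Q = sets (sample_space d)"
    and AE_Q: "AE s in Q. feature d s \<in> X \<and> label s \<in> {-1, 1}"
begin

abbreviation "I \<equiv> {1..m} \<times> {1..n}"
abbreviation "M \<equiv> data_measure m n Q"

lemma measurable_component: "ij \<in> I \<Longrightarrow> (\<lambda>z. z ij) \<in> measurable M Q"
  unfolding data_measure_def by (rule measurable_component_singleton)

lemma measurable_sample:
  shows "k < d \<Longrightarrow> (\<lambda>s. fst s k) \<in> borel_measurable Q" "snd \<in> borel_measurable Q"
proof -
  have Q: "measurable Q N = measurable (sample_space d) N" for N :: "real measure"
    by (rule measurable_cong_sets[OF sets_Q refl])
  show "(\<lambda>s. fst s k) \<in> borel_measurable Q" if "k < d"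
  proof -
    have "(\<lambda>x. x k) \<in> borel_measurable (\<Pi>\<^sub>M k\<in>{..<d}. (borel :: real measure))"
      using that by (intro measurable_component_singleton) simp
    from measurable_compose[OF measurable_fst this] show ?thesis
      unfolding Q sample_space_def .
  qed
  show "snd \<in> borel_measurable Q" unfolding Q sample_space_def by (rule measurable_snd)
qed

sublocale measurable_data M d m n B \<gamma>
proof unfold_locales
  fix ij k assume ij: "ij \<in> I"
  show "(\<lambda>z. fst (z ij) k) \<in> borel_measurable M" if "k < d"
    by (rule measurable_compose[OF measurable_component[OF ij] measurable_sample(1)[OF that]])
  show "(\<lambda>z. snd (z ij)) \<in> borel_measurable M"
    by (rule measurable_compose[OF measurable_component[OF ij] measurable_sample(2)])
qed (use d1 m1 n1 B0 \<gamma>0 in auto)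

sublocale prob_space M
  unfolding data_measure_def by (intro prob_space_PiM prob_Q)

lemma AE_sample_bounded: "AE s in Q. norm (data_vec d s) \<le> B"
  using AE_Q
proof (rule AE_mp, intro AE_I2 impI)
  fix s assume s: "feature d s \<in> X \<and> label s \<in> {-1, 1}"
  hence "\<bar>label s\<bar> = 1" by auto
  thus "norm (data_vec d s) \<le> B" using X_bound s by (simp add: data_vec_def emb_norm)
qed

lemma AE_component: "ij \<in> I \<Longrightarrow> AE s in Q. P s \<Longrightarrow> AE z in M. P (z ij)"
  unfolding data_measure_def by (rule AE_PiM_component) (auto simp: prob_Q)

lemma AE_bounded: "AE z in M. \<forall>ij\<in>I. norm (data_vec d (z ij)) \<le> B"
  by (intro AE_finite_allI AE_component AE_sample_bounded) auto

lemma bounded_disco_iff: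
  assumes "0 \<le> \<mu>" "\<mu> \<le> const_L B \<gamma>" "0 < \<rho>"
  shows "bounded_disco d m n B \<gamma> z \<mu> \<rho> \<longleftrightarrow> (\<forall>ij\<in>I. norm (data_vec d (z ij)) \<le> B)"
  using assms d1 m1 n1 B0 \<gamma>0
  by (auto simp: bounded_disco_def bounded_disco_axioms_def disco_data_def)

text \<open>
  Exchanging sample \<open>j\<close> of machines \<open>i\<close> and \<open>k\<close> preserves the law of the data. It turns the
  loss of the local minimizer of machine \<open>i\<close> on foreign data into its loss on own data,
  evaluated at a minimizer with one sample replaced.
\<close>

definition swap :: "nat \<times> nat \<Rightarrow> nat \<times> nat \<Rightarrow> (nat \<times> nat \<Rightarrow> sample) \<Rightarrow> (nat \<times> nat \<Rightarrow> sample)" where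
  "swap p q z = (\<lambda>x\<in>I. z (Transposition.transpose p q x))"

lemma distr_swap:
  assumes "p \<in> I" "q \<in> I" shows "distr M M (swap p q) = M"
proof -
  have "Transposition.transpose p q \<in> I \<rightarrow> I" using assms by (auto simp: Transposition.transpose_def)
  moreover have "inj_on (Transposition.transpose p q) I" by (rule inj_on_subset[OF inj_transpose]) simp
  ultimately have "distr (PiM I (\<lambda>_. Q)) (PiM I (\<lambda>_. Q)) (\<lambda>\<omega>. \<lambda>n\<in>I. \<omega> (Transposition.transpose p q n)) = PiM I (\<lambda>_. Q)"
    using distr_PiM_reindex[of I "\<lambda>_. Q" "Transposition.transpose p q" I] prob_Q by blast
  thus ?thesis unfolding data_measure_def swap_def[abs_def] .
qed

lemma measurable_swap: "p \<in> I \<Longrightarrow> q \<in> I \<Longrightarrow> swap p q \<in> measurable M M"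
  unfolding data_measure_def swap_def[abs_def]
  by (intro measurable_restrict measurable_component_singleton) (auto simp: Transposition.transpose_def)

context
  fixes \<rho> :: real
  assumes rho: "\<rho> > 0"
begin

definition lminimizer :: "nat \<Rightarrow> (nat \<times> nat \<Rightarrow> sample) \<Rightarrow> fseq" where
  "lminimizer i z = emb (minimizer d (\<lambda>w. local_loss d n B \<gamma> z i w + \<rho> / 2 * (vec_norm w)\<^sup>2))"

definition cross_loss :: "nat \<Rightarrow> nat \<Rightarrow> nat \<Rightarrow> (nat \<times> nat \<Rightarrow> sample) \<Rightarrow> real" where
  "cross_loss i k j z = logistic (inner (data_vec d (z (k, j))) (lminimizer i z))"

lemma fmeas_lminimizer: "i \<in> {1..m} \<Longrightarrow> fmeas M d (lminimizer i)"
  unfolding lminimizer_def[abs_def] by (rule fmeas_emb[OF vmeas_lmin]) (use rho in auto)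

lemma measurable_cross_loss:
  "i \<in> {1..m} \<Longrightarrow> k \<in> {1..m} \<Longrightarrow> j \<in> {1..n} \<Longrightarrow> cross_loss i k j \<in> borel_measurable M"
  unfolding cross_loss_def[abs_def]
  by (rule measurable_compose[OF fmeas_inner[OF fmeas_data fmeas_lminimizer] logistic_measurable(1)]) auto

lemma const_L_nonneg: "0 \<le> const_L B \<gamma>"
  using B0 \<gamma>0 by (simp add: const_L_def scale_eta_def)

text \<open>\<open>bounded_disco\<close> needs a value for \<mu>, and 0 stands in for it: the
  initial point does not depend on \<mu>, see \<open>init_gap_eq\<close>.\<close>

lemma AE_disco: "AE z in M. bounded_disco d m n B \<gamma> z 0 \<rho>"
  using AE_bounded bounded_disco_iff[of 0 \<rho>] const_L_nonneg rho by auto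

lemma cross_loss_bound:
  assumes "bounded_disco d m n B \<gamma> z 0 \<rho>" "k \<in> {1..m}" "j \<in> {1..n}"
  shows "\<bar>cross_loss i k j z\<bar> \<le> ln 2 + B * sqrt (2 * const_V0 B \<gamma> / const_lambda B \<gamma>)"
proof -
  interpret bounded_disco d m n B \<gamma> z 0 \<rho> by fact
  have "norm (lminimizer i z) \<le> sqrt (2 * const_V0 B \<gamma> / const_lambda B \<gamma>)"
    using real_sqrt_le_mono[OF lmin_norm[of i]] by (simp add: lminimizer_def)
  hence "B * norm (lminimizer i z) \<le> B * sqrt (2 * const_V0 B \<gamma> / const_lambda B \<gamma>)"
    using B by simp
  moreover have "\<bar>logistic (inner (data_vec d (z (k, j))) (lminimizer i z)) - logistic (inner (data_vec d (z (k, j))) 0)\<bar>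
      \<le> B * norm (lminimizer i z - 0)"
    by (rule data_lipschitz) (use assms in auto)
  ultimately show ?thesis
    using logistic_nonneg[of "inner (data_vec d (z (k, j))) (lminimizer i z)"]
    by (simp add: cross_loss_def logistic_zero)
qed

lemma integrable_cross_loss:
  assumes "i \<in> {1..m}" "k \<in> {1..m}" "j \<in> {1..n}"
  shows "integrable M (cross_loss i k j)"
proof (rule integrable_const_bound)
  show "AE z in M. norm (cross_loss i k j z) \<le> ln 2 + B * sqrt (2 * const_V0 B \<gamma> / const_lambda B \<gamma>)"
    using AE_disco by (rule AE_mp) (use cross_loss_bound assms in \<open>auto intro!: AE_I2\<close>)
qed (rule measurable_cross_loss[OF assms])

lemma expectation_cross_loss:
  assumes i: "i \<in> {1..m}" and k: "k \<in> {1..m}" and j: "j \<in> {1..n}"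
  shows "expectation (cross_loss i k j) \<le> expectation (cross_loss i i j) + 2 * B * const_G B \<gamma> / (n * \<rho>)"
proof (cases "k = i")
  case True
  thus ?thesis using B0 \<gamma>0 rho by (simp add: const_G_def scale_eta_def)
next
  case False
  let ?p = "(i, j)" and ?q = "(k, j)"
  let ?s = "swap ?p ?q" and ?K = "2 * B * const_G B \<gamma> / (n * \<rho>)"
  have pq: "?p \<in> I" "?q \<in> I" using i j k by auto
  have "expectation (cross_loss i k j) = integral\<^sup>L (distr M M ?s) (cross_loss i k j)"
    by (simp only: distr_swap[OF pq])
  also have "\<dots> = expectation (\<lambda>z. cross_loss i k j (?s z))"
    by (rule integral_distr[OF measurable_swap[OF pq] measurable_cross_loss[OF i k j]])
  also have "\<dots> \<le> expectation (\<lambda>z. cross_loss i i j z + ?K)"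
  proof (rule integral_mono_AE)
    have "integrable (distr M M ?s) (cross_loss i k j)"
      unfolding distr_swap[OF pq] by (rule integrable_cross_loss[OF i k j])
    thus "integrable M (\<lambda>z. cross_loss i k j (?s z))"
      by (rule integrable_distr[OF measurable_swap[OF pq]])
    show "integrable M (\<lambda>z. cross_loss i i j z + ?K)"
      by (intro Bochner_Integration.integrable_add integrable_cross_loss i j integrable_const)
    show "AE z in M. cross_loss i k j (?s z) \<le> cross_loss i i j z + ?K"
      using AE_bounded
    proof (rule AE_mp, intro AE_I2 impI)
      fix z assume bd: "\<forall>ij\<in>I. norm (data_vec d (z ij)) \<le> B"
      \<comment> \<open>After the exchange the loss is taken at a sample that machine i held
        originally, whereas its minimizer is trained with the foreign sample in that place.\<close>
      have sk: "?s z ?q = z ?p" "?s z ?p = z ?q" using pq by (auto simp: swap_def)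
      have so: "?s z (i, j') = z (i, j')" if "j' \<in> {1..n}" "j' \<noteq> j" for j'
        using that i False by (auto simp: swap_def Transposition.transpose_def)
      have "norm (lminimizer i (?s z) - lminimizer i z) \<le> 2 * (scale_eta B \<gamma> / n) * B / (const_lambda B \<gamma> + \<rho>)"
        unfolding lminimizer_def
        by (rule minimizer_stability[OF reg_objective reg_objective, where ?j0.0 = j])
          (use rho j so sk bd pq in auto)
      also have "\<dots> \<le> 2 * (scale_eta B \<gamma> / n) * B / \<rho>"
        using rho lam_pos scale_eta_pos[OF B0 \<gamma>0] B0
        by (intro divide_left_mono mult_nonneg_nonneg mult_pos_pos) auto
      finally have st: "norm (lminimizer i (?s z) - lminimizer i z) \<le> 2 * (scale_eta B \<gamma> / n) * B / \<rho>" .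
      have "\<bar>logistic (inner (data_vec d (z ?p)) (lminimizer i (?s z))) - logistic (inner (data_vec d (z ?p)) (lminimizer i z))\<bar>
          \<le> norm (data_vec d (z ?p)) * norm (lminimizer i (?s z) - lminimizer i z)"
        using order_trans[OF logistic_lipschitz] Cauchy_Schwarz_ineq2 by (metis inner_diff_right)
      also have "\<dots> \<le> B * (2 * (scale_eta B \<gamma> / n) * B / \<rho>)"
        using bd pq st B0 by (intro mult_mono) auto
      also have "\<dots> = ?K" by (simp add: const_G_def)
      finally show "cross_loss i k j (?s z) \<le> cross_loss i i j z + ?K"
        unfolding cross_loss_def sk by linarith
    qed
  qed
  also have "\<dots> = expectation (cross_loss i i j) + ?K"
    using integrable_cross_loss[OF i i j] by (simp add: prob_space)
  finally show ?thesis .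
qed

definition init_gap :: "(nat \<times> nat \<Rightarrow> sample) \<Rightarrow> real" where
  "init_gap z = f z (emb (disco_init d m (local_loss d n B \<gamma> z) \<rho>))
     - f z (emb (minimizer d (average_obj m (local_loss d n B \<gamma> z))))"

lemma measurable_init_gap: "init_gap \<in> borel_measurable M"
proof -
  have "(\<lambda>z. f z (emb (v z))) \<in> borel_measurable M" if "vmeas M d v" for v
    by (rule measurable_reg_logistic[OF fmeas_data fmeas_emb[OF that]])
  thus ?thesis unfolding init_gap_def[abs_def]
    using vmeas_init vmeas_wopt rho by (intro borel_measurable_diff) auto
qed

lemma init_gap_eq:
  assumes "bounded_disco d m n B \<gamma> z \<mu> \<rho>"
  shows "init_gap z = bounded_disco.gap d m n B \<gamma> z \<mu> \<rho> 0"
  using bounded_disco.gap_def[OF assms] by (simp add: init_gap_def)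

lemma AE_init_gap: "AE z in M. 0 \<le> init_gap z \<and> init_gap z \<le> const_F0 B \<gamma>"
  using AE_disco
  by (rule AE_mp) (auto intro!: AE_I2 simp: init_gap_eq[of _ 0] bounded_disco.gap_nonneg bounded_disco.gap_le_F0)

lemma integrable_init_gap: "integrable M init_gap"
proof (rule integrable_const_bound)
  show "AE z in M. norm (init_gap z) \<le> const_F0 B \<gamma>"
    using AE_init_gap by (rule AE_mp) (auto intro!: AE_I2)
qed (rule measurable_init_gap)

text \<open>The first term is the bias of the regularizer, the second the stability error. Their sum
  is smallest at \<rho> = 2 G / (sqrt(n) D), from which the prescribed \<rho> differs by a constant
  factor only.\<close>

lemma expectation_init_gap:
  assumes D: "(\<integral>\<^sup>+ z. ennreal ((vec_norm (erm_minimizer d m n B \<gamma> z))\<^sup>2) \<partial>M) \<le> ennreal (D\<^sup>2)"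
  shows "expectation init_gap \<le> \<rho> / 2 * D\<^sup>2 + 2 * (const_G B \<gamma>)\<^sup>2 / (n * \<rho>)"
proof -
  let ?N = "\<lambda>z. (vec_norm (erm_minimizer d m n B \<gamma> z))\<^sup>2"
  let ?K = "2 * B * const_G B \<gamma> / (n * \<rho>)"
  have measN: "?N \<in> borel_measurable M"
    unfolding erm_minimizer_eq by (intro borel_measurable_power vmeas_norm[OF vmeas_wopt])
  have intN: "integrable M ?N"
  proof (rule integrableI_nonneg[OF measN])
    show "(\<integral>\<^sup>+ z. ennreal (?N z) \<partial>M) < \<infinity>" using D ennreal_less_top le_less_trans by fastforce
  qed auto
  have EN: "expectation ?N \<le> D\<^sup>2"
  proof -
    have "ennreal (expectation ?N) \<le> ennreal (D\<^sup>2)"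
      using D nn_integral_eq_integral[OF intN] by simp
    thus ?thesis by (subst (asm) ennreal_le_iff) auto
  qed
  let ?S = "\<lambda>z. (1 / m) * (\<Sum>i = 1..m. (1 / m) * (\<Sum>k = 1..m. \<Sum>j = 1..n.
     scale_eta B \<gamma> / n * (cross_loss i k j z - cross_loss i i j z)))"
  have intS: "integrable M ?S"
    by (intro integrable_mult_right Bochner_Integration.integrable_sum Bochner_Integration.integrable_diff
        integrable_cross_loss) auto
  have "expectation init_gap \<le> expectation (\<lambda>z. \<rho> / 2 * ?N z + ?S z)"
  proof (rule integral_mono_AE)
    show "integrable M (\<lambda>z. \<rho> / 2 * ?N z + ?S z)"
      by (rule Bochner_Integration.integrable_add[OF integrable_mult_right[OF intN] intS])
    show "AE z in M. init_gap z \<le> \<rho> / 2 * ?N z + ?S z"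
      using AE_disco
    proof (rule AE_mp, intro AE_I2 impI)
      fix z assume bd: "bounded_disco d m n B \<gamma> z 0 \<rho>"
      from bounded_disco.init_gap_le[OF bd]
      show "init_gap z \<le> \<rho> / 2 * ?N z + ?S z"
        unfolding init_gap_eq[OF bd] cross_loss_def lminimizer_def erm_minimizer_eq emb_norm .
    qed
  qed (rule integrable_init_gap)
  also have "\<dots> = \<rho> / 2 * expectation ?N + expectation ?S"
    by (subst Bochner_Integration.integral_add[OF integrable_mult_right[OF intN] intS]) simp
  also have "expectation ?S = (1 / m) * (\<Sum>i = 1..m. (1 / m) * (\<Sum>k = 1..m. \<Sum>j = 1..n.
     scale_eta B \<gamma> / n * (expectation (cross_loss i k j) - expectation (cross_loss i i j))))"
  proof -
    let ?t = "\<lambda>i k j z. scale_eta B \<gamma> / n * (cross_loss i k j z - cross_loss i i j z)"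
    let ?e = "\<lambda>i k j. scale_eta B \<gamma> / n * (expectation (cross_loss i k j) - expectation (cross_loss i i j))"
    have it: "integrable M (?t i k j)" and et: "expectation (?t i k j) = ?e i k j"
      if "i \<in> {1..m}" "k \<in> {1..m}" "j \<in> {1..n}" for i k j
    proof -
      note ic = integrable_cross_loss[OF that] integrable_cross_loss[OF that(1,1,3)]
      show "integrable M (?t i k j)"
        by (rule integrable_mult_right[OF Bochner_Integration.integrable_diff[OF ic]])
      show "expectation (?t i k j) = ?e i k j"
        by (simp only: integral_mult_right_zero Bochner_Integration.integral_diff[OF ic])
    qed
    have i1: "integrable M (\<lambda>z. \<Sum>k = 1..m. \<Sum>j = 1..n. ?t i k j z)" if "i \<in> {1..m}" for i
      by (intro Bochner_Integration.integrable_sum it that)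
    have e1: "expectation (\<lambda>z. \<Sum>k = 1..m. \<Sum>j = 1..n. ?t i k j z) = (\<Sum>k = 1..m. \<Sum>j = 1..n. ?e i k j)"
      if "i \<in> {1..m}" for i
    proof -
      have "expectation (\<lambda>z. \<Sum>k = 1..m. \<Sum>j = 1..n. ?t i k j z) = (\<Sum>k = 1..m. expectation (\<lambda>z. \<Sum>j = 1..n. ?t i k j z))"
        by (rule Bochner_Integration.integral_sum) (intro Bochner_Integration.integrable_sum it that)
      also have "\<dots> = (\<Sum>k = 1..m. \<Sum>j = 1..n. expectation (?t i k j))"
        by (intro sum.cong refl Bochner_Integration.integral_sum it that)
      also have "\<dots> = (\<Sum>k = 1..m. \<Sum>j = 1..n. ?e i k j)"
        by (intro sum.cong refl et that)
      finally show ?thesis .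
    qed
    have "expectation ?S = (1 / m) * (\<Sum>i = 1..m. expectation (\<lambda>z. (1 / m) * (\<Sum>k = 1..m. \<Sum>j = 1..n. ?t i k j z)))"
      unfolding integral_mult_right_zero
      by (subst Bochner_Integration.integral_sum) (intro integrable_mult_right i1, simp_all only: integral_mult_right_zero)
    also have "\<dots> = (1 / m) * (\<Sum>i = 1..m. (1 / m) * (\<Sum>k = 1..m. \<Sum>j = 1..n. ?e i k j))"
      unfolding integral_mult_right_zero by (intro arg_cong2[of _ _ _ _ "(*)"] sum.cong refl e1)
    finally show ?thesis .
  qed
  also have "\<dots> \<le> (1 / m) * (\<Sum>i = 1..m. (1 / m) * (\<Sum>k = 1..m. \<Sum>j = 1..n. scale_eta B \<gamma> / n * ?K))"
  proof (intro mult_left_mono sum_mono)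
    fix i k j assume "i \<in> {1..m}" "k \<in> {1..m}" "j \<in> {1..n}"
    from expectation_cross_loss[OF this]
    show "expectation (cross_loss i k j) - expectation (cross_loss i i j) \<le> ?K" by simp
  qed (use scale_eta_pos[OF B0 \<gamma>0] in auto)
  also have "\<dots> = scale_eta B \<gamma> * ?K" using m1 n1 by simp
  also have "\<dots> = 2 * (const_G B \<gamma>)\<^sup>2 / (n * \<rho>)" by (simp add: const_G_def power2_eq_square)
  also have "\<rho> / 2 * expectation ?N \<le> \<rho> / 2 * D\<^sup>2" using EN rho by simp
  finally show ?thesis by simp
qed

end

end

subsection \<open>Uniform concentration of the local Hessians\<close>

definition grid :: "nat \<Rightarrow> real \<Rightarrow> nat \<Rightarrow> fseq set" where
  "grid d h N = (\<lambda>c. emb (vec d (\<lambda>k. h * real_of_int (c k)))) ` ({..<d} \<rightarrow>\<^sub>E {- int N..int N})"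

lemma grid_finite: "finite (grid d h N)"
  and grid_card: "card (grid d h N) \<le> (2 * N + 1) ^ d"
  and grid_supported: "x \<in> grid d h N \<Longrightarrow> x \<in> supported d"
proof -
  have fin: "finite ({..<d} \<rightarrow>\<^sub>E {- int N..int N})" by (intro finite_PiE) auto
  thus "finite (grid d h N)" by (simp add: grid_def)
  have "card (grid d h N) \<le> card ({..<d} \<rightarrow>\<^sub>E {- int N..int N})"
    unfolding grid_def by (rule card_image_le[OF fin])
  also have "\<dots> = (2 * N + 1) ^ d"
  proof -
    have "nat (int N - - int N + 1) = 2 * N + 1" by linarith
    thus ?thesis by (simp add: card_PiE)
  qed
  finally show "card (grid d h N) \<le> (2 * N + 1) ^ d" .
  show "x \<in> supported d" if "x \<in> grid d h N"
    using that unfolding grid_def by (elim imageE) simp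
qed

text \<open>Coordinates are rounded down. The crude error h d instead of h sqrt(d) only enters
  logarithms, through the fineness of the grids.\<close>

lemma grid_cover:
  assumes x: "x \<in> supported d" and h: "h > 0" and N: "norm x \<le> h * real N"
  obtains y where "y \<in> grid d h N" "norm (x - y) \<le> h * real d"
proof -
  define c where "c = (\<lambda>k\<in>{..<d}. \<lfloor>coord x k / h\<rfloor>)"
  define y where "y = emb (vec d (\<lambda>k. h * real_of_int (c k)))"
  have "c \<in> {..<d} \<rightarrow>\<^sub>E {- int N..int N}"
  proof (intro PiE_I)
    fix k assume "k \<in> {..<d}"
    have "\<bar>coord x k\<bar> \<le> h * real N" using abs_coord_le_norm[of x k] N by linarith
    hence "\<bar>coord x k / h\<bar> \<le> real N" using h by (simp add: abs_divide field_simps)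
    hence "- real N \<le> coord x k / h" "coord x k / h \<le> real N" by linarith+
    hence "- int N \<le> \<lfloor>coord x k / h\<rfloor>" "\<lfloor>coord x k / h\<rfloor> \<le> int N"
      by (simp_all add: le_floor_iff floor_le_iff)
    thus "c k \<in> {- int N..int N}" using \<open>k \<in> {..<d}\<close> by (simp add: c_def)
  qed (simp add: c_def)
  hence y: "y \<in> grid d h N" unfolding grid_def y_def by (rule imageI)
  have small: "\<bar>coord (x - y) k\<bar> \<le> h" if "k < d" for k
  proof -
    have "coord (x - y) k = h * (coord x k / h - real_of_int \<lfloor>coord x k / h\<rfloor>)"
      using that h by (simp add: y_def coord_emb c_def field_simps)
    moreover have "\<bar>coord x k / h - real_of_int \<lfloor>coord x k / h\<rfloor>\<bar> \<le> 1" by linarith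
    ultimately show ?thesis using h by (simp add: abs_mult)
  qed
  have "x - y \<in> supported d" using x grid_supported[OF y] by simp
  hence "norm (x - y) = norm (\<Sum>k<d. coord (x - y) k *\<^sub>R axis_seq d k)"
    by (rule arg_cong[OF axis_expansion])
  also have "\<dots> \<le> (\<Sum>k<d. norm (coord (x - y) k *\<^sub>R axis_seq d k))" by (rule norm_sum)
  also have "\<dots> \<le> (\<Sum>k<d. h)"
  proof (intro sum_mono)
    fix k assume "k \<in> {..<d}"
    hence "norm (axis_seq d k) = 1" by (simp add: norm_eq_sqrt_inner inner_axis coord_emb)
    thus "norm (coord (x - y) k *\<^sub>R axis_seq d k) \<le> h" using small \<open>k \<in> {..<d}\<close> by (simp del: coord_simps)
  qed
  finally have "norm (x - y) \<le> h * real d" by (simp add: mult.commute)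
  with y show ?thesis using that by blast
qed

text \<open>The contribution of one sample to the quadratic form of the Hessian at \<open>w\<close>
  in direction \<open>u\<close>, without the factor \<eta>.\<close>

definition curvature :: "nat \<Rightarrow> fseq \<Rightarrow> fseq \<Rightarrow> sample \<Rightarrow> real" where
  "curvature d w u s = logistic2 (inner (data_vec d s) w) * (inner (data_vec d s) u)\<^sup>2"

lemma curvature_nonneg: "0 \<le> curvature d w u s"
  using logistic2_pos[of "inner (data_vec d s) w"] by (simp add: curvature_def)

lemma data_inner_le: "norm (data_vec d s) \<le> B \<Longrightarrow> \<bar>inner (data_vec d s) u\<bar> \<le> B * norm u"
  by (rule order_trans[OF Cauchy_Schwarz_ineq2]) (simp add: mult_right_mono)

lemma curvature_le:
  assumes "norm (data_vec d s) \<le> B" "norm u \<le> 2"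
  shows "curvature d w u s \<le> B\<^sup>2"
proof -
  have "0 \<le> B" using assms(1) norm_ge_zero order_trans by blast
  hence "\<bar>inner (data_vec d s) u\<bar> \<le> B * 2"
    using order_trans[OF data_inner_le[OF assms(1)] mult_left_mono[OF assms(2)]] by simp
  hence "\<bar>inner (data_vec d s) u\<bar>\<^sup>2 \<le> (B * 2)\<^sup>2" by (intro power_mono) auto
  hence "(inner (data_vec d s) u)\<^sup>2 \<le> (B * 2)\<^sup>2" by (simp only: power2_abs)
  hence "curvature d w u s \<le> 1 / 4 * (B * 2)\<^sup>2"
    unfolding curvature_def using logistic2_pos logistic2_le by (intro mult_mono) (auto intro: less_imp_le)
  thus ?thesis by (simp add: power_mult_distrib)
qed

text \<open>The difference of products is split, with |<a, u>| <= B, |<a, u + u'>| <= 3 B and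
  \<open>logistic2\<close> <= 1/4, so that 3/4 is rounded up to 1. \<open>u'\<close> may have norm
  2, because a grid point near a vector of the unit ball need not lie in the ball.\<close>

lemma curvature_lipschitz:
  assumes b: "norm (data_vec d s) \<le> B" and u: "norm u \<le> 1" "norm u' \<le> 2"
  shows "\<bar>curvature d w u s - curvature d w' u' s\<bar> \<le> B ^ 3 * norm (w - w') + B\<^sup>2 * norm (u - u')"
proof -
  let ?a = "data_vec d s"
  have B: "0 \<le> B" using b norm_ge_zero order_trans by blast
  have au: "\<bar>inner ?a v\<bar> \<le> B * norm v" for v by (rule data_inner_le[OF b])
  have 1: "\<bar>logistic2 (inner ?a w) - logistic2 (inner ?a w')\<bar> \<le> B * norm (w - w')"
    using order_trans[OF logistic2_lipschitz[of "inner ?a w" "inner ?a w'"]] au[of "w - w'"]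
    by (simp add: inner_diff_right)
  have "\<bar>inner ?a u\<bar> \<le> B" using au[of u] mult_left_mono[OF u(1) B] by simp
  hence 2: "(inner ?a u)\<^sup>2 \<le> B\<^sup>2" by (simp add: abs_le_square_iff[symmetric] B)
  have 3: "\<bar>(inner ?a u)\<^sup>2 - (inner ?a u')\<^sup>2\<bar> \<le> B\<^sup>2 * (3 * norm (u - u'))"
  proof -
    have "(inner ?a u)\<^sup>2 - (inner ?a u')\<^sup>2 = inner ?a (u - u') * inner ?a (u + u')"
      by (simp add: inner_diff_right inner_add_right power2_eq_square algebra_simps)
    hence "\<bar>(inner ?a u)\<^sup>2 - (inner ?a u')\<^sup>2\<bar> = \<bar>inner ?a (u - u')\<bar> * \<bar>inner ?a (u + u')\<bar>"
      by (simp only: abs_mult)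
    also have "\<dots> \<le> (B * norm (u - u')) * (B * 3)"
      using au[of "u - u'"] order_trans[OF au[of "u + u'"] mult_left_mono[of "norm (u + u')" 3 B]]
        norm_triangle_ineq[of u u'] u B by (intro mult_mono) auto
    finally show ?thesis by (simp add: power2_eq_square mult_ac)
  qed
  have "curvature d w u s - curvature d w' u' s = (logistic2 (inner ?a w) - logistic2 (inner ?a w')) * (inner ?a u)\<^sup>2
      + logistic2 (inner ?a w') * ((inner ?a u)\<^sup>2 - (inner ?a u')\<^sup>2)"
    by (simp add: curvature_def algebra_simps)
  hence "\<bar>curvature d w u s - curvature d w' u' s\<bar> \<le> \<bar>logistic2 (inner ?a w) - logistic2 (inner ?a w')\<bar> * (inner ?a u)\<^sup>2
      + logistic2 (inner ?a w') * \<bar>(inner ?a u)\<^sup>2 - (inner ?a u')\<^sup>2\<bar>"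
    using abs_triangle_ineq logistic2_pos[of "inner ?a w'"] by (metis abs_mult abs_of_pos abs_power2)
  also have "\<dots> \<le> (B * norm (w - w')) * B\<^sup>2 + 1 / 4 * (B\<^sup>2 * (3 * norm (u - u')))"
    using 1 2 3 B logistic2_le[of "inner ?a w'"] logistic2_pos[of "inner ?a w'"]
    by (intro add_mono mult_mono) (auto intro: less_imp_le)
  also have "\<dots> \<le> B ^ 3 * norm (w - w') + B\<^sup>2 * norm (u - u')"
    using B by (simp add: power2_eq_square power3_eq_cube)
  finally show ?thesis .
qed

section \<open>Hoeffding's inequality and the union over the grids\<close>

context erm_sampling
begin

lemma fmeas_sample: "fmeas Q d (data_vec d)"
proof -
  have "vmeas Q d (feature d)"
    by (rule vmeasI[where X = "\<lambda>k s. fst s k"]) (use measurable_sample(1) in \<open>simp_all add: feature_def\<close>)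
  from fmeas_scale[OF measurable_sample(2) fmeas_emb[OF this]]
  show ?thesis by (simp only: data_vec_def[abs_def] label_def)
qed

lemma measurable_curvature:
  assumes "w \<in> supported d" "u \<in> supported d" shows "curvature d w u \<in> borel_measurable Q"
  unfolding curvature_def[abs_def]
  by (rule borel_measurable_times[OF measurable_compose[OF fmeas_inner[OF fmeas_sample fmeas_const[OF assms(1)]]
      logistic_measurable(3)] borel_measurable_power[OF fmeas_inner[OF fmeas_sample fmeas_const[OF assms(2)]]]])

lemma distr_component: "ij \<in> I \<Longrightarrow> distr M Q (\<lambda>z. z ij) = Q"
  unfolding data_measure_def by (rule distr_PiM_component[OF prob_Q])

lemma indep_samples:
  assumes J: "J \<subseteq> I" "J \<noteq> {}"
  shows "indep_vars (\<lambda>_. Q) (\<lambda>ij z. z ij) J"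
proof (subst indep_vars_iff_distr_eq_PiM'[OF J(2)])
  show "(\<lambda>z. z ij) \<in> measurable M Q" if "ij \<in> J" for ij using that J by (intro measurable_component) auto
  have "distr (PiM I (\<lambda>_. Q)) (PiM J (\<lambda>_. Q)) (\<lambda>\<omega>. \<lambda>n\<in>J. \<omega> n) = PiM J (\<lambda>_. Q)"
    using distr_PiM_reindex[of I "\<lambda>_. Q" "\<lambda>x. x" J] prob_Q J by auto
  moreover have "PiM J (\<lambda>ij. distr M Q (\<lambda>z. z ij)) = PiM J (\<lambda>_. Q)"
    using J distr_component by (intro PiM_cong) auto
  ultimately show "distr M (PiM J (\<lambda>_. Q)) (\<lambda>x. \<lambda>i\<in>J. x i) = PiM J (\<lambda>i. distr M Q (\<lambda>z. z i))"
    unfolding data_measure_def by simp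
qed

definition deviation :: "nat \<Rightarrow> fseq \<Rightarrow> fseq \<Rightarrow> real \<Rightarrow> (nat \<times> nat \<Rightarrow> sample) set" where
  "deviation i w u \<tau> = {z \<in> space M. \<bar>(\<Sum>ij\<in>{i} \<times> {1..n}. curvature d w u (z ij)) - real n * (\<integral>s. curvature d w u s \<partial>Q)\<bar> \<ge> real n * \<tau>}"

lemma measurable_curvature_component:
  assumes "ij \<in> I" "w \<in> supported d" "u \<in> supported d"
  shows "(\<lambda>z. curvature d w u (z ij)) \<in> borel_measurable M"
  by (rule measurable_compose[OF measurable_component[OF assms(1)] measurable_curvature[OF assms(2,3)]])

lemma deviation_sets:
  assumes "i \<in> {1..m}" "w \<in> supported d" "u \<in> supported d" shows "deviation i w u \<tau> \<in> sets M"
proof -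
  have "(\<lambda>z. \<Sum>ij\<in>{i} \<times> {1..n}. curvature d w u (z ij)) \<in> borel_measurable M"
    by (rule borel_measurable_sum) (rule measurable_curvature_component, use assms in auto)
  from borel_measurable_abs[OF borel_measurable_diff[OF this borel_measurable_const]]
  show ?thesis unfolding deviation_def by (rule borel_measurable_le[OF borel_measurable_const])
qed

text \<open>Hoeffding's inequality for n independent terms. Their range [0, B^2] is what directions
  of norm up to 2 allow, as (2 B)^2 / 4 = B^2.\<close>

lemma deviation_prob:
  assumes i: "i \<in> {1..m}" and w: "w \<in> supported d" and u: "u \<in> supported d" "norm u \<le> 2" and \<tau>: "\<tau> \<ge> 0"
  shows "prob (deviation i w u \<tau>) \<le> 2 * exp (- 2 * real n * \<tau>\<^sup>2 / B ^ 4)"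
proof -
  let ?J = "{i} \<times> {1..n}"
  have J: "?J \<subseteq> I" "?J \<noteq> {}" using i n1 by auto
  interpret H: Hoeffding_ineq M ?J "\<lambda>ij z. curvature d w u (z ij)" "\<lambda>_. 0" "\<lambda>_. B\<^sup>2"
    "\<Sum>ij\<in>?J. expectation (\<lambda>z. curvature d w u (z ij))"
  proof unfold_locales
    show "indep_vars (\<lambda>_. borel) (\<lambda>ij z. curvature d w u (z ij)) ?J"
      by (rule indep_vars_compose2[OF indep_samples[OF J]]) (rule measurable_curvature[OF w u(1)])
    show "AE z in M. curvature d w u (z ij) \<in> {0..B\<^sup>2}" if "ij \<in> ?J" for ij
    proof -
      have "AE s in Q. curvature d w u s \<in> {0..B\<^sup>2}"
        using AE_sample_bounded by (rule AE_mp) (use curvature_nonneg curvature_le u(2) in \<open>auto intro!: AE_I2\<close>)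
      thus ?thesis using that J by (intro AE_component) auto
    qed
  qed auto
  have E: "expectation (\<lambda>z. curvature d w u (z ij)) = (\<integral>s. curvature d w u s \<partial>Q)" if "ij \<in> ?J" for ij
  proof -
    have ij: "ij \<in> I" using that J by auto
    have "(\<integral>s. curvature d w u s \<partial>Q) = (\<integral>s. curvature d w u s \<partial>distr M Q (\<lambda>z. z ij))"
      by (simp only: distr_component[OF ij])
    also have "\<dots> = expectation (\<lambda>z. curvature d w u (z ij))"
      by (rule integral_distr[OF measurable_component[OF ij] measurable_curvature[OF w u(1)]])
    finally show ?thesis ..
  qed
  have S: "(\<Sum>ij\<in>?J. expectation (\<lambda>z. curvature d w u (z ij))) = real n * (\<integral>s. curvature d w u s \<partial>Q)"
    by (simp only: E cong: sum.cong) (simp add: card_cartesian_product)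
  have B4: "(\<Sum>ij\<in>?J. (B\<^sup>2 - 0)\<^sup>2) = real n * B ^ 4" by (simp add: card_cartesian_product)
  have "prob (deviation i w u \<tau>) \<le> 2 * exp (- 2 * (real n * \<tau>)\<^sup>2 / (real n * B ^ 4))"
    unfolding deviation_def S[symmetric] B4[symmetric]
    by (rule H.Hoeffding_ineq_abs_ge) (use \<tau> B0 n1 in \<open>auto simp: card_cartesian_product\<close>)
  also have "- 2 * (real n * \<tau>)\<^sup>2 / (real n * B ^ 4) = - 2 * real n * \<tau>\<^sup>2 / B ^ 4"
    using n1 by (simp add: power2_eq_square)
  finally show ?thesis .
qed

context
  fixes R pf :: real
  assumes R: "R \<ge> 0" and pf: "0 < pf" "pf \<le> 1"
begin

text \<open>\<open>N1\<close> and \<open>N2\<close> make the grids reach the ball of radius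
  \<open>R\<close> and the unit ball. The spacings 1 / (B n d) and 1 / (n d) in \<open>Gw\<close>
  and \<open>Gu\<close> shrink each of the two terms of \<open>curvature_lipschitz\<close> to B^2 /
  n.\<close>

definition "N1 = nat \<lceil>R * B * n * d\<rceil>"
definition "N2 = n * d"
text \<open>The first two logarithms, times d, count the two grids; the last one covers the m
  machines, the two sides of the deviation and the target probability \<open>pf\<close>.
  \<open>tau\<close> solves 2 n tau^2 / B^4 = d \<open>log_cover\<close>.\<close>

definition "log_cover = ln (2 * real N1 + 1) + ln (2 * real N2 + 1) + ln (2 * m / pf)"
definition "tau = B\<^sup>2 * sqrt (d * log_cover / (2 * n))"
definition "Gw = grid d (1 / (B * n * d)) N1"
definition "Gu = {u \<in> grid d (1 / (n * d)) N2. norm u \<le> 2}"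
definition "bad_event = (\<Union>(i, w, u)\<in>{1..m} \<times> Gw \<times> Gu. deviation i w u tau)"
definition "hess_dev = scale_eta B \<gamma> * (2 * tau + 4 * B\<^sup>2 / n)"

lemma log_cover_pos: "0 \<le> log_cover" and log_pf_nonneg: "0 \<le> ln (2 * m / pf)"
proof -
  show p: "0 \<le> ln (2 * m / pf)" using pf m1 by (intro ln_ge_zero) (simp add: field_simps)
  show "0 \<le> log_cover" unfolding log_cover_def using p by simp
qed

lemma tau_nonneg: "0 \<le> tau"
  using log_cover_pos by (simp add: tau_def)

lemma finite_grids: "finite ({1..m} \<times> Gw \<times> Gu)"
  by (simp add: Gw_def Gu_def grid_finite)

lemma bad_event_sets: "bad_event \<in> sets M"
  unfolding bad_event_def
  by (rule sets.finite_UN[OF finite_grids]) (auto simp: Gw_def Gu_def intro!: deviation_sets dest: grid_supported)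

lemma bad_event_prob: "prob bad_event \<le> pf"
proof -
  let ?G = "{1..m} \<times> Gw \<times> Gu"
  have "prob bad_event \<le> (\<Sum>p\<in>?G. prob (case p of (i, w, u) \<Rightarrow> deviation i w u tau))"
    unfolding bad_event_def
    by (rule finite_measure_subadditive_finite[OF finite_grids])
      (auto simp: Gw_def Gu_def intro!: deviation_sets dest: grid_supported)
  also have "\<dots> \<le> (\<Sum>p\<in>?G. 2 * exp (- 2 * real n * tau\<^sup>2 / B ^ 4))"
  proof (intro sum_mono)
    fix p assume "p \<in> ?G"
    then obtain i w u where p: "p = (i, w, u)" "i \<in> {1..m}" "w \<in> supported d" "u \<in> supported d" "norm u \<le> 2"
      unfolding Gw_def Gu_def using grid_supported by blast
    show "prob (case p of (i, w, u) \<Rightarrow> deviation i w u tau) \<le> 2 * exp (- 2 * real n * tau\<^sup>2 / B ^ 4)"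
      unfolding p(1) prod.case by (rule deviation_prob[OF p(2-5) tau_nonneg])
  qed
  also have "\<dots> = real (card ?G) * (2 * exp (- (d * log_cover)))"
  proof -
    have "tau\<^sup>2 = B ^ 4 * (d * log_cover / (2 * n))"
      using log_cover_pos by (simp add: tau_def power_mult_distrib flip: power_mult)
    hence "- 2 * real n * tau\<^sup>2 / B ^ 4 = - (d * log_cover)" using B0 n1 by (simp add: field_simps)
    thus ?thesis by simp
  qed
  also have "\<dots> \<le> (real m * ((2 * real N1 + 1) ^ d * (2 * real N2 + 1) ^ d)) * (2 * exp (- (d * log_cover)))"
  proof (intro mult_right_mono)
    have "real (card Gw) \<le> (2 * real N1 + 1) ^ d"
      using of_nat_mono[OF grid_card[of d "1 / (B * n * d)" N1], where 'a = real] by (simp add: Gw_def add.commute)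
    moreover have "real (card Gu) \<le> (2 * real N2 + 1) ^ d"
    proof -
      have "card Gu \<le> card (grid d (1 / (n * d)) N2)" unfolding Gu_def by (rule card_mono[OF grid_finite]) auto
      also have "\<dots> \<le> (2 * N2 + 1) ^ d" by (rule grid_card)
      finally have "real (card Gu) \<le> real ((2 * N2 + 1) ^ d)" by (rule of_nat_mono)
      thus ?thesis by (simp add: add.commute)
    qed
    ultimately show "real (card ?G) \<le> real m * ((2 * real N1 + 1) ^ d * (2 * real N2 + 1) ^ d)"
      by (simp add: card_cartesian_product mult_mono mult_left_mono)
  qed simp
  also have "exp (- (d * log_cover)) \<le> inverse ((2 * real N1 + 1) ^ d) * inverse ((2 * real N2 + 1) ^ d) * (pf / (2 * m))"
  proof -
    \<comment> \<open>The exponent contains d copies of the last logarithm, of which one is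
      enough.\<close>
    have "ln (2 * m / pf) \<le> d * ln (2 * m / pf)" using log_pf_nonneg d1 by (simp add: mult_le_cancel_right1)
    hence "- (d * log_cover) \<le> - (d * ln (2 * real N1 + 1)) + - (d * ln (2 * real N2 + 1)) + - ln (2 * m / pf)"
      by (simp add: log_cover_def distrib_left)
    hence "exp (- (d * log_cover)) \<le> exp (- (d * ln (2 * real N1 + 1)) + - (d * ln (2 * real N2 + 1)) + - ln (2 * m / pf))"
      by simp
    also have "\<dots> = inverse (exp (d * ln (2 * real N1 + 1))) * inverse (exp (d * ln (2 * real N2 + 1))) * inverse (exp (ln (2 * m / pf)))"
      by (simp only: exp_add exp_minus)
    also have "exp (d * ln (2 * real N1 + 1)) = (2 * real N1 + 1) ^ d" by (simp add: exp_of_nat_mult)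
    also have "exp (d * ln (2 * real N2 + 1)) = (2 * real N2 + 1) ^ d" by (simp add: exp_of_nat_mult)
    also have "inverse (exp (ln (2 * m / pf))) = pf / (2 * m)" using pf m1 by simp
    finally show ?thesis .
  qed
  also have "(real m * ((2 * real N1 + 1) ^ d * (2 * real N2 + 1) ^ d)) *
      (2 * (inverse ((2 * real N1 + 1) ^ d) * inverse ((2 * real N2 + 1) ^ d) * (pf / (2 * m)))) = pf"
  proof -
    have "(2 * real N1 + 1) ^ d > 0" "(2 * real N2 + 1) ^ d > 0" by simp_all
    thus ?thesis using m1 by (simp add: field_simps)
  qed
  finally show ?thesis by (simp add: mult_left_mono)
qed

definition mean_curv :: "(nat \<times> nat \<Rightarrow> sample) \<Rightarrow> nat \<Rightarrow> fseq \<Rightarrow> fseq \<Rightarrow> real" where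
  "mean_curv z i w u = (1 / n) * (\<Sum>j = 1..n. curvature d w u (z (i, j)))"

lemma hess_mean_curv:
  shows "inner x (lhess z i w x) = scale_eta B \<gamma> * mean_curv z i w x + const_lambda B \<gamma> * (norm x)\<^sup>2"
    and "inner x (fhess z w x) = scale_eta B \<gamma> * ((1 / m) * (\<Sum>i = 1..m. mean_curv z i w x)) + const_lambda B \<gamma> * (norm x)\<^sup>2"
proof -
  show "inner x (lhess z i w x) = scale_eta B \<gamma> * mean_curv z i w x + const_lambda B \<gamma> * (norm x)\<^sup>2"
    by (simp add: loc.hess_quadratic[of x z i w] mean_curv_def curvature_def sum_distrib_left mult.assoc del: One_nat_def)
  have "(\<Sum>ij\<in>I. \<eta> / (m * n) * logistic2 (inner (data_vec d (z ij)) w) * (inner (data_vec d (z ij)) x)\<^sup>2)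
      = scale_eta B \<gamma> * ((1 / m) * (\<Sum>i = 1..m. mean_curv z i w x))"
    by (simp add: mean_curv_def curvature_def sum_distrib_left sum.cartesian_product case_prod_beta mult.assoc
        del: One_nat_def)
  thus "inner x (fhess z w x) = scale_eta B \<gamma> * ((1 / m) * (\<Sum>i = 1..m. mean_curv z i w x)) + const_lambda B \<gamma> * (norm x)\<^sup>2"
    by (simp only: avg.hess_quadratic[of x z w])
qed

lemma mean_curv_scale: "mean_curv z i w (c *\<^sub>R u) = c\<^sup>2 * mean_curv z i w u"
  by (simp add: mean_curv_def curvature_def power_mult_distrib sum_distrib_left mult_ac del: One_nat_def)

lemma abs_average_le:
  assumes "\<And>i. i \<in> {1..m} \<Longrightarrow> \<bar>x i\<bar> \<le> K" shows "\<bar>(1 / m) * (\<Sum>i = 1..m. x i)\<bar> \<le> K"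
proof -
  have "\<bar>\<Sum>i = 1..m. x i\<bar> \<le> (\<Sum>i = 1..m. K)" by (rule order_trans[OF sum_abs sum_mono]) (rule assms)
  thus ?thesis using m1 by (simp add: abs_mult field_simps)
qed

text \<open>Machines 1 and i are both compared with the expectation at a nearby grid pair: twice
  \<open>tau\<close> for the deviations, twice 2 B^2 / n for the way from the given pair to the
  grid.\<close>

lemma mean_curv_deviation:
  assumes z: "z \<in> space M" "z \<notin> bad_event" and bd: "\<forall>ij\<in>I. norm (data_vec d (z ij)) \<le> B"
    and w: "w \<in> supported d" "norm w \<le> R" and u: "u \<in> supported d" "norm u \<le> 1"
  shows "\<bar>mean_curv z 1 w u - (1 / m) * (\<Sum>i = 1..m. mean_curv z i w u)\<bar> \<le> 2 * tau + 4 * B\<^sup>2 / n"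
proof -
  have dn: "real d > 0" "real n > 0" using d1 n1 by auto
  have "R \<le> 1 / (B * n * d) * real N1"
  proof -
    have "R * B * n * d \<le> real N1" unfolding N1_def by linarith
    thus ?thesis using B0 dn by (simp add: field_simps)
  qed
  then obtain w' where w': "w' \<in> Gw" "norm (w - w') \<le> 1 / (B * n * d) * d"
    using grid_cover[OF w(1), of "1 / (B * n * d)" N1] w(2) B0 dn unfolding Gw_def by force
  have wd: "norm (w - w') \<le> 1 / (B * n)" using w'(2) dn B0 by simp
  have "norm u \<le> 1 / (n * d) * real N2" using u(2) dn by (simp add: N2_def)
  then obtain u' where u': "u' \<in> grid d (1 / (n * d)) N2" "norm (u - u') \<le> 1 / (n * d) * d"
    using grid_cover[OF u(1), of "1 / (n * d)" N2] dn by force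
  have ud: "norm (u - u') \<le> 1 / n" using u'(2) dn by simp
  also have "1 / real n \<le> 1" using n1 by simp
  finally have "norm (u - u') \<le> 1" .
  hence nu': "norm u' \<le> 2" using norm_triangle_ineq4[of u "u - u'"] u(2) by simp
  hence uG: "u' \<in> Gu" using u'(1) by (simp add: Gu_def)
  have lip: "\<bar>mean_curv z i w u - mean_curv z i w' u'\<bar> \<le> 2 * B\<^sup>2 / n" if i: "i \<in> {1..m}" for i
  proof -
    have one: "\<bar>curvature d w u (z (i, j)) - curvature d w' u' (z (i, j))\<bar> \<le> 2 * B\<^sup>2 / n" if "j \<in> {1..n}" for j
    proof -
      have "\<bar>curvature d w u (z (i, j)) - curvature d w' u' (z (i, j))\<bar> \<le> B ^ 3 * norm (w - w') + B\<^sup>2 * norm (u - u')"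
        by (rule curvature_lipschitz) (use bd i that u nu' in auto)
      also have "\<dots> \<le> B ^ 3 * (1 / (B * n)) + B\<^sup>2 * (1 / n)"
        using wd ud B0 by (intro add_mono mult_left_mono) auto
      also have "\<dots> = 2 * B\<^sup>2 / n" using B0 dn by (simp add: field_simps power2_eq_square power3_eq_cube)
      finally show ?thesis .
    qed
    have "\<bar>\<Sum>j = 1..n. curvature d w u (z (i, j)) - curvature d w' u' (z (i, j))\<bar> \<le> (\<Sum>j = 1..n. 2 * B\<^sup>2 / n)"
      by (rule order_trans[OF sum_abs sum_mono]) (rule one)
    hence "\<bar>(\<Sum>j = 1..n. curvature d w u (z (i, j))) - (\<Sum>j = 1..n. curvature d w' u' (z (i, j)))\<bar> \<le> 2 * B\<^sup>2"
      using dn by (simp add: sum_subtractf)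
    hence "\<bar>(1 / n) * ((\<Sum>j = 1..n. curvature d w u (z (i, j))) - (\<Sum>j = 1..n. curvature d w' u' (z (i, j))))\<bar> \<le> (1 / n) * (2 * B\<^sup>2)"
      unfolding abs_mult using dn by (intro mult_mono) auto
    thus ?thesis by (simp add: mean_curv_def right_diff_distrib)
  qed
  have dev: "\<bar>mean_curv z i w' u' - (\<integral>s. curvature d w' u' s \<partial>Q)\<bar> \<le> tau" if i: "i \<in> {1..m}" for i
  proof -
    have "z \<notin> deviation i w' u' tau" using z i w'(1) uG unfolding bad_event_def by blast
    hence "\<bar>(\<Sum>ij\<in>{i} \<times> {1..n}. curvature d w' u' (z ij)) - real n * (\<integral>s. curvature d w' u' s \<partial>Q)\<bar> \<le> real n * tau"
      using z(1) by (simp add: deviation_def)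
    moreover have "(\<Sum>ij\<in>{i} \<times> {1..n}. curvature d w' u' (z ij)) = real n * mean_curv z i w' u'"
    proof -
      have "(\<Sum>ij\<in>{i} \<times> {1..n}. curvature d w' u' (z ij)) = (\<Sum>j = 1..n. curvature d w' u' (z (i, j)))"
        by (rule sum.reindex_bij_witness[of _ "\<lambda>j. (i, j)" snd]) auto
      thus ?thesis using dn by (simp add: mean_curv_def)
    qed
    ultimately have "real n * \<bar>mean_curv z i w' u' - (\<integral>s. curvature d w' u' s \<partial>Q)\<bar> \<le> real n * tau"
      by (simp add: abs_mult flip: right_diff_distrib)
    thus ?thesis using dn by simp
  qed
  have one: "\<bar>mean_curv z 1 w u - mean_curv z i w u\<bar> \<le> 2 * tau + 4 * B\<^sup>2 / n" if i: "i \<in> {1..m}" for i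
  proof -
    have "1 \<in> {1..m}" using m1 by simp
    from lip[OF this] dev[OF this] lip[OF i] dev[OF i] show ?thesis by linarith
  qed
  have "mean_curv z 1 w u - (1 / m) * (\<Sum>i = 1..m. mean_curv z i w u)
      = (1 / m) * (\<Sum>i = 1..m. mean_curv z 1 w u - mean_curv z i w u)"
    using m1 by (simp add: sum_subtractf right_diff_distrib)
  thus ?thesis using abs_average_le[OF one] by presburger
qed

text \<open>The conjugate gradient analysis asks for the bound at all sequences \<open>x\<close>,
  not only at supported ones; coordinates from \<open>d\<close> on are cut off, since the data do
  not see them. Homogeneity then reduces the claim to directions in the unit ball.\<close>

theorem hessian_concentration:
  assumes z: "z \<in> space M" "z \<notin> bad_event" and bd: "\<forall>ij\<in>I. norm (data_vec d (z ij)) \<le> B"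
    and w: "w \<in> supported d" "norm w \<le> R"
  shows "\<bar>inner x (lhess z 1 w x) - inner x (fhess z w x)\<bar> \<le> hess_dev * (norm x)\<^sup>2"
proof -
  define p where "p = emb (prj d x)"
  have p: "p \<in> supported d" by (simp add: p_def)
  have ip: "inner y x = inner y p" if "y \<in> supported d" for y
    by (simp add: inner_supported[OF that] p_def coord_emb prj_def)
  have mp: "mean_curv z i w x = mean_curv z i w p" for i
    by (simp add: mean_curv_def curvature_def ip)
  have np: "(norm p)\<^sup>2 \<le> (norm x)\<^sup>2"
  proof -
    have "(norm p)\<^sup>2 = inner p x" using ip[OF p] by (simp add: power2_norm_eq_inner)
    also have "\<dots> \<le> norm p * norm x" by (rule norm_cauchy_schwarz)
    finally have "norm p * norm p \<le> norm p * norm x" by (simp add: power2_eq_square)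
    hence "norm p \<le> norm x" by (cases "p = 0") auto
    thus ?thesis by (intro power_mono) auto
  qed
  let ?K = "2 * tau + 4 * B\<^sup>2 / n"
  have K: "0 \<le> ?K" using tau_nonneg by simp
  have main: "\<bar>mean_curv z 1 w p - (1 / m) * (\<Sum>i = 1..m. mean_curv z i w p)\<bar> \<le> ?K * (norm p)\<^sup>2"
  proof (cases "p = 0")
    case True
    thus ?thesis by (simp add: mean_curv_def curvature_def)
  next
    case False
    define u where "u = (1 / norm p) *\<^sub>R p"
    have pu: "p = norm p *\<^sub>R u" using False by (simp add: u_def)
    have u: "u \<in> supported d" "norm u \<le> 1" using p False by (simp_all add: u_def)
    have sc: "mean_curv z i w p = (norm p)\<^sup>2 * mean_curv z i w u" for i
      using mean_curv_scale[of z i w "norm p" u] pu by simp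
    have "mean_curv z 1 w p - (1 / m) * (\<Sum>i = 1..m. mean_curv z i w p)
        = (norm p)\<^sup>2 * (mean_curv z 1 w u - (1 / m) * (\<Sum>i = 1..m. mean_curv z i w u))"
      by (simp add: sc right_diff_distrib mult.left_commute flip: sum_distrib_left)
    thus ?thesis
      using mult_left_mono[OF mean_curv_deviation[OF z bd w u], of "(norm p)\<^sup>2"]
      by (simp add: abs_mult mult.commute)
  qed
  have "inner x (lhess z 1 w x) - inner x (fhess z w x)
      = scale_eta B \<gamma> * (mean_curv z 1 w p - (1 / m) * (\<Sum>i = 1..m. mean_curv z i w p))"
    unfolding hess_mean_curv mp by (simp add: right_diff_distrib)
  hence "\<bar>inner x (lhess z 1 w x) - inner x (fhess z w x)\<bar>
      = scale_eta B \<gamma> * \<bar>mean_curv z 1 w p - (1 / m) * (\<Sum>i = 1..m. mean_curv z i w p)\<bar>"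
    using scale_eta_pos[OF B0 \<gamma>0] by (simp add: abs_mult)
  also have "\<dots> \<le> scale_eta B \<gamma> * (?K * (norm x)\<^sup>2)"
    using order_trans[OF main mult_left_mono[OF np K]] scale_eta_pos[OF B0 \<gamma>0] by (intro mult_left_mono) auto
  finally show ?thesis by (simp add: hess_dev_def mult.assoc)
qed

end

end

subsection \<open>Logarithms of polynomially bounded quantities\<close>

text \<open>
  In the proofs below, \<open>K\<close> is found by unification and then weakened to a numeral, so that it does
  not depend on the parameters.
\<close>

definition logb :: "real \<Rightarrow> real \<Rightarrow> real \<Rightarrow> bool" where
  "logb LF K x \<longleftrightarrow> 0 < x \<and> 0 \<le> K \<and> ln x \<le> K * LF"

lemma logb_mono: "logb LF K y \<Longrightarrow> x \<le> y \<Longrightarrow> 0 < x \<Longrightarrow> logb LF K x"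
  unfolding logb_def using ln_mono[of x y] by linarith

lemma logb_mult: "logb LF K x \<Longrightarrow> logb LF K' y \<Longrightarrow> logb LF (K + K') (x * y)"
  by (simp add: logb_def ln_mult_pos distrib_right)

context
  fixes LF :: real assumes LF: "LF \<ge> 1"
begin

lemma logb_weaken: assumes "logb LF K x" "K \<le> K'" shows "logb LF K' x"
proof -
  have "K * LF \<le> K' * LF" using assms LF by (intro mult_right_mono) auto
  hence "ln x \<le> K' * LF" using assms(1) unfolding logb_def by linarith
  thus ?thesis using assms by (simp add: logb_def)
qed

lemma logb_const: assumes "c > 0" shows "logb LF c c"
proof -
  have "c * 1 \<le> c * LF" using assms LF by (intro mult_left_mono) auto
  hence "ln c \<le> c * LF" using ln_le_minus_one[OF assms] by linarith
  thus ?thesis using assms by (simp add: logb_def)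
qed

lemma logb_power: "logb LF K x \<Longrightarrow> logb LF (real k * K) (x ^ k)"
  unfolding logb_def by (simp add: ln_realpow mult.assoc mult_left_mono)

lemma logb_sqrt: "logb LF K x \<Longrightarrow> logb LF K (sqrt x)"
proof -
  assume x: "logb LF K x"
  hence "0 \<le> K * LF" using LF by (simp add: logb_def)
  thus ?thesis using x by (simp add: logb_def ln_sqrt)
qed

lemma logb_add: "logb LF K x \<Longrightarrow> logb LF K' y \<Longrightarrow> logb LF (K + K' + 1) (x + y)"
proof -
  assume x: "logb LF K x" and y: "logb LF K' y"
  let ?S = "(K + K' + 1) * LF"
  have nn: "0 \<le> K * LF" "0 \<le> K' * LF" using x y LF by (auto simp: logb_def)
  have le: "x + y \<le> 2 * max x y" by simp
  have "ln (x + y) \<le> ln (2 * max x y)"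
    using x y le by (intro ln_mono) (auto simp: logb_def)
  also have "\<dots> = ln 2 + ln (max x y)" using x by (intro ln_mult_pos) (auto simp: logb_def)
  also have "ln (max x y) \<le> (K + K') * LF"
    using x y nn by (auto simp: max_def logb_def distrib_right)
  also have "ln 2 \<le> (1 :: real)" using ln_le_minus_one[of "2 :: real"] by simp
  finally have "ln (x + y) \<le> ?S" using LF by (simp add: distrib_right)
  thus ?thesis using x y by (auto simp: logb_def)
qed

lemmas logb_intros = logb_mult logb_power logb_sqrt logb_add

end

section \<open>Logarithmic size of the constants of the algorithm\<close>

context
  fixes d m n :: nat and B \<gamma> D :: real
  assumes d: "d \<ge> 1" and m: "m \<ge> 1" and n: "n \<ge> 1" and B: "B > 0" and \<gamma>: "\<gamma> > 0" and D: "D > 0"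
begin

abbreviation "LF \<equiv> log_factor d m n B \<gamma> D"

lemma log_factor_ge_1: "1 \<le> LF"
  using d m n by (simp add: log_factor_def)

lemma logb_base:
  "logb LF 1 (real d)" "logb LF 1 (real m)" "logb LF 1 (real n)" "logb LF 1 B" "logb LF 1 (1 / B)"
  "logb LF 1 \<gamma>" "logb LF 1 (1 / \<gamma>)" "logb LF 1 (1 / D)"
proof -
  have "0 \<le> ln (real d)" "0 \<le> ln (real m)" "0 \<le> ln (real n)" using d m n by simp_all
  hence le: "ln (real d) \<le> LF" "ln (real m) \<le> LF" "ln (real n) \<le> LF" "\<bar>ln B\<bar> \<le> LF" "\<bar>ln \<gamma>\<bar> \<le> LF" "\<bar>ln D\<bar> \<le> LF"
    by (simp_all add: log_factor_def)
  hence "ln B \<le> LF" "ln (1 / B) \<le> LF" "ln \<gamma> \<le> LF" "ln (1 / \<gamma>) \<le> LF" "ln (1 / D) \<le> LF"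
    using B \<gamma> D by (simp_all add: ln_div abs_le_iff)
  thus "logb LF 1 (real d)" "logb LF 1 (real m)" "logb LF 1 (real n)" "logb LF 1 B" "logb LF 1 (1 / B)"
    "logb LF 1 \<gamma>" "logb LF 1 (1 / \<gamma>)" "logb LF 1 (1 / D)"
    using le d m n B \<gamma> D by (simp_all add: logb_def)
qed

lemmas logb_rules = logb_intros[OF log_factor_ge_1] logb_const[OF log_factor_ge_1] logb_base

lemma const_V0_eq: "const_V0 B \<gamma> = ln 2 * B\<^sup>2 / (4 * \<gamma>)"
  by (simp add: const_V0_def scale_eta_def)

lemma const_G_eq: "const_G B \<gamma> = B ^ 3 / (4 * \<gamma>)"
  by (simp add: const_G_def scale_eta_def power2_eq_square power3_eq_cube)

lemma G_sq_over_lambda: "(const_G B \<gamma>)\<^sup>2 / const_lambda B \<gamma> = B ^ 4 / (4 * \<gamma>\<^sup>2)"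
  using B \<gamma> by (simp add: const_G_eq const_lambda_eq power_divide power_mult_distrib field_simps)

lemma ln2_bounds: "1 / 2 \<le> ln (2 :: real)" "ln (2 :: real) \<le> 1"
  using ln_le_minus_one[of "1 / 2 :: real"] ln_le_minus_one[of "2 :: real"] by (simp_all add: ln_div)

lemma cond_eq: "const_L B \<gamma> / const_lambda B \<gamma> = 1 + B\<^sup>2 / (4 * \<gamma>)"
  using B \<gamma> by (simp add: const_L_def const_lambda_def scale_eta_def field_simps)

lemma logb_cond: "logb LF 6 (const_L B \<gamma> / const_lambda B \<gamma>)"
proof -
  have "logb LF 6 (1 + B ^ 2 * (1 / \<gamma>) * (1 / 4))"
    by (rule logb_weaken[OF log_factor_ge_1], (rule logb_rules | simp)+)
  thus ?thesis by (simp add: cond_eq mult.commute)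
qed

lemma logb_value: "logb LF 10 (B ^ 2 * (1 / \<gamma>) + B ^ 4 * (1 / \<gamma>) ^ 2)"
  by (rule logb_weaken[OF log_factor_ge_1], (rule logb_rules | simp)+)

lemma const_F0_bounds: "0 < const_F0 B \<gamma>" "const_F0 B \<gamma> \<le> B ^ 2 * (1 / \<gamma>) + B ^ 4 * (1 / \<gamma>) ^ 2"
proof -
  have eq: "const_F0 B \<gamma> = 3 * ln 2 / 4 * (B\<^sup>2 / \<gamma>) + 1 / 8 * (B ^ 4 / \<gamma>\<^sup>2)"
  proof -
    have "(const_G B \<gamma>)\<^sup>2 / (2 * const_lambda B \<gamma>) = (const_G B \<gamma>)\<^sup>2 / const_lambda B \<gamma> / 2" by simp
    thus ?thesis unfolding const_F0_def const_V0_eq G_sq_over_lambda by simp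
  qed
  have p: "0 < B\<^sup>2 / \<gamma>" "0 < B ^ 4 / \<gamma>\<^sup>2" using B \<gamma> by simp_all
  show "0 < const_F0 B \<gamma>" unfolding eq using p ln2_bounds by (intro add_pos_pos mult_pos_pos) auto
  have "3 * ln 2 / 4 * (B\<^sup>2 / \<gamma>) \<le> 1 * (B\<^sup>2 / \<gamma>)" using p ln2_bounds by (intro mult_right_mono) auto
  moreover have "1 / 8 * (B ^ 4 / \<gamma>\<^sup>2) \<le> 1 * (B ^ 4 / \<gamma>\<^sup>2)" using p by (intro mult_right_mono) auto
  ultimately show "const_F0 B \<gamma> \<le> B ^ 2 * (1 / \<gamma>) + B ^ 4 * (1 / \<gamma>) ^ 2"
    unfolding eq by (simp add: power_divide)
qed

lemma logb_F0: "logb LF 10 (const_F0 B \<gamma>)"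
  by (rule logb_mono[OF logb_value const_F0_bounds(2,1)])

definition "radius = sqrt (2 * const_F0 B \<gamma> / const_lambda B \<gamma>)"
text \<open>Reciprocal of the worst-case cost up to logarithms: L / lam is the order of the crude
  bound on the length of a conjugate gradient run, 1 + F0 that of the number of Newton steps apart
  from the accuracy.\<close>

definition "fail_prob = 1 / (const_L B \<gamma> / const_lambda B \<gamma> * (1 + const_F0 B \<gamma>))"

lemma cond_ge_1: "1 \<le> const_L B \<gamma> / const_lambda B \<gamma>"
  unfolding cond_eq using \<gamma> by simp

lemma fail_prob_bounds: "0 < fail_prob" "fail_prob \<le> 1"
proof -
  have "1 * 1 \<le> const_L B \<gamma> / const_lambda B \<gamma> * (1 + const_F0 B \<gamma>)"
    using cond_ge_1 const_F0_bounds(1) by (intro mult_mono) auto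
  moreover have "0 < 1 / x \<and> 1 / x \<le> 1" if "1 * 1 \<le> x" for x :: real using that by simp
  ultimately show "0 < fail_prob" "fail_prob \<le> 1" unfolding fail_prob_def by blast+
qed

lemma radius_nonneg: "0 \<le> radius"
  using const_F0_bounds B \<gamma> by (simp add: radius_def const_lambda_eq)

lemma logb_radius: "logb LF 20 radius"
proof -
  have eq: "2 * const_F0 B \<gamma> / const_lambda B \<gamma> = 8 * const_F0 B \<gamma> * (1 / B) ^ 2"
    using \<gamma> by (simp add: const_lambda_eq power_divide)
  show ?thesis unfolding radius_def eq
    by (rule logb_weaken[OF log_factor_ge_1], (rule logb_rules logb_F0 | simp)+)
qed

text \<open>The three logarithms contribute 30 + 6 + 21 = 57. The last one is logarithmic because 1
  / \<open>fail_prob\<close> is polynomially bounded in the parameters.\<close>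

lemma log_cover_le:
  assumes "real N1 \<le> radius * B * n * d + 1" "N2 = n * d"
  shows "ln (2 * real N1 + 1) + ln (2 * real N2 + 1) + ln (2 * m / fail_prob) \<le> 57 * LF"
proof -
  have "logb LF 30 (2 * (radius * B * n * d) + 3)"
    by (rule logb_weaken[OF log_factor_ge_1], (rule logb_rules logb_radius | simp)+)
  moreover have "2 * real N1 + 1 \<le> 2 * (radius * B * n * d) + 3" using assms(1) by simp
  ultimately have 1: "logb LF 30 (2 * real N1 + 1)" by (rule logb_mono) simp
  have "logb LF 6 (2 * (real n * real d) + 1)"
    by (rule logb_weaken[OF log_factor_ge_1], (rule logb_rules | simp)+)
  hence 2: "logb LF 6 (2 * real N2 + 1)" using assms(2) by simp
  have "logb LF 21 (2 * real m * (const_L B \<gamma> / const_lambda B \<gamma> * (1 + const_F0 B \<gamma>)))"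
    by (rule logb_weaken[OF log_factor_ge_1], (rule logb_cond logb_F0 logb_rules | simp)+)
  hence 3: "logb LF 21 (2 * m / fail_prob)" by (simp add: fail_prob_def)
  show ?thesis using 1 2 3 unfolding logb_def by linarith
qed

definition "mu_log = ln (1 + const_r B \<gamma> * const_M B \<gamma> * sqrt (2 * real n) / const_L B \<gamma>)
  + ln (real m * real d / const_delta n B \<gamma> D) / real d"

lemma const_mu_eq: "const_mu d m n B \<gamma> D = min (const_L B \<gamma>) (sqrt (32 * (const_L B \<gamma>)\<^sup>2 * d / n) * sqrt mu_log)"
  by (simp add: const_mu_def mu_log_def Let_def)

lemma const_L_pos: "0 < const_L B \<gamma>"
  using B \<gamma> by (simp add: const_L_def scale_eta_def add_pos_pos)

lemma M_over_L: "const_M B \<gamma> / const_L B \<gamma> = B ^ 3 / 10 / (B\<^sup>2 / 4 + \<gamma>)"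
proof -
  have "const_M B \<gamma> / const_L B \<gamma> = scale_eta B \<gamma> * (B ^ 3 / 10) / (scale_eta B \<gamma> * (B\<^sup>2 / 4 + \<gamma>))"
    by (simp add: const_M_def const_L_def)
  thus ?thesis using scale_eta_pos[OF B \<gamma>] by simp
qed

lemma const_r_eq: "const_r B \<gamma> = sqrt (2 * ln 2 / \<gamma> + 2 * B / \<gamma> * sqrt (2 * ln 2 / \<gamma>))"
proof -
  have 1: "2 * const_V0 B \<gamma> / const_lambda B \<gamma> = 2 * ln 2 / \<gamma>"
    using B \<gamma> by (simp add: const_V0_eq const_lambda_eq)
  have 2: "2 * const_G B \<gamma> / const_lambda B \<gamma> = 2 * B / \<gamma>"
    using B \<gamma> by (simp add: const_G_eq const_lambda_eq power2_eq_square power3_eq_cube)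
  show ?thesis by (simp only: const_r_def Let_def 1 2)
qed

lemma const_r_bounds: "sqrt (1 / \<gamma>) \<le> const_r B \<gamma>" "const_r B \<gamma> \<le> sqrt (2 * (1 / \<gamma>) + 2 * B * (1 / \<gamma>) * sqrt (2 * (1 / \<gamma>)))"
proof -
  have "0 \<le> 2 * B / \<gamma> * sqrt (2 * ln 2 / \<gamma>)" using B \<gamma> by simp
  moreover have "1 / \<gamma> \<le> 2 * ln 2 / \<gamma>" using ln2_bounds \<gamma> by (intro divide_right_mono) auto
  ultimately show "sqrt (1 / \<gamma>) \<le> const_r B \<gamma>" unfolding const_r_eq by (intro real_sqrt_le_mono) linarith
  have le: "2 * ln 2 / \<gamma> \<le> 2 * (1 / \<gamma>)" using ln2_bounds \<gamma> by (simp add: divide_right_mono)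
  show "const_r B \<gamma> \<le> sqrt (2 * (1 / \<gamma>) + 2 * B * (1 / \<gamma>) * sqrt (2 * (1 / \<gamma>)))"
    unfolding const_r_eq
    using le B \<gamma> by (intro real_sqrt_le_mono add_mono mult_mono) auto
qed

text \<open>Both summands are logarithms of polynomially bounded quantities, with 20 + 32 = 52. As
  \<delta> < 1 <= m d, the second one is nonnegative, which gives the lower bound by the
  first.\<close>

lemma mu_log_le:
  assumes \<delta>: "0 < const_delta n B \<gamma> D" "const_delta n B \<gamma> D < 1"
  shows "mu_log \<le> 52 * LF" "ln (1 + const_r B \<gamma> * const_M B \<gamma> * sqrt (2 * real n) / const_L B \<gamma>) \<le> mu_log"
proof -
  let ?x = "const_r B \<gamma> * const_M B \<gamma> * sqrt (2 * real n) / const_L B \<gamma>"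
  let ?rb = "sqrt (2 * (1 / \<gamma>) + 2 * B * (1 / \<gamma>) * sqrt (2 * (1 / \<gamma>)))"
  have x: "?x = const_r B \<gamma> * (B ^ 3 / 10 / (B\<^sup>2 / 4 + \<gamma>)) * sqrt (2 * real n)"
    unfolding M_over_L[symmetric] by simp
  have r0: "0 \<le> const_r B \<gamma>" using order_trans[OF _ const_r_bounds(1)] \<gamma> by simp
  have mol: "B ^ 3 / 10 / (B\<^sup>2 / 4 + \<gamma>) \<le> B ^ 3 * (1 / \<gamma>)"
    using B \<gamma> by (simp add: frac_le)
  have x0: "0 \<le> ?x" unfolding x using r0 B \<gamma> by (intro mult_nonneg_nonneg) auto
  have "?x \<le> ?rb * (B ^ 3 * (1 / \<gamma>)) * sqrt (2 * real n)"
    unfolding x using mol r0 const_r_bounds(2) B \<gamma> by (intro mult_right_mono mult_mono) auto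
  moreover have "logb LF 20 (1 + ?rb * (B ^ 3 * (1 / \<gamma>)) * sqrt (2 * real n))"
    by (rule logb_weaken[OF log_factor_ge_1], (rule logb_rules | simp)+)
  ultimately have 1: "logb LF 20 (1 + ?x)" using logb_mono x0 by fastforce
  let ?v = "4 * const_V0 B \<gamma> + 2 * (const_G B \<gamma>)\<^sup>2 / const_lambda B \<gamma>"
  have v_eq: "?v = ln 2 * (B\<^sup>2 / \<gamma>) + 1 / 2 * (B ^ 4 / \<gamma>\<^sup>2)"
  proof -
    have "2 * (const_G B \<gamma>)\<^sup>2 / const_lambda B \<gamma> = 2 * ((const_G B \<gamma>)\<^sup>2 / const_lambda B \<gamma>)" by simp
    thus ?thesis unfolding G_sq_over_lambda const_V0_eq by simp
  qed
  have p: "0 < B\<^sup>2 / \<gamma>" "0 < B ^ 4 / \<gamma>\<^sup>2" using B \<gamma> by simp_all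
  have v0: "0 < ?v" unfolding v_eq using p by (intro add_pos_pos mult_pos_pos) auto
  have "?v \<le> 1 * (B\<^sup>2 / \<gamma>) + 1 * (B ^ 4 / \<gamma>\<^sup>2)"
    unfolding v_eq using p ln2_bounds by (intro add_mono mult_right_mono) auto
  hence "?v \<le> B ^ 2 * (1 / \<gamma>) + B ^ 4 * (1 / \<gamma>) ^ 2" by (simp add: power_divide)
  hence v: "logb LF 10 ?v" using logb_mono[OF logb_value] v0 by blast
  have "1 / const_delta n B \<gamma> D = sqrt (real n) * (4 * \<gamma> * (1 / B) ^ 3 * (1 / D)) * ?v * sqrt (4 * (const_L B \<gamma> / const_lambda B \<gamma>))"
  proof -
    have "sqrt (const_lambda B \<gamma> / (4 * const_L B \<gamma>)) = 1 / sqrt (4 * (const_L B \<gamma> / const_lambda B \<gamma>))"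
      by (simp add: real_sqrt_divide)
    hence "const_delta n B \<gamma> D = const_G B \<gamma> * D / sqrt (real n) * (1 / sqrt (4 * (const_L B \<gamma> / const_lambda B \<gamma>)) / ?v)"
      by (simp add: const_delta_def Let_def)
    thus ?thesis using B \<gamma> by (simp add: const_G_eq power_divide)
  qed
  hence "real m * real d / const_delta n B \<gamma> D = real m * real d *
      (sqrt (real n) * (4 * \<gamma> * (1 / B) ^ 3 * (1 / D)) * ?v * sqrt (4 * (const_L B \<gamma> / const_lambda B \<gamma>)))"
    by (metis mult.right_neutral times_divide_eq_right)
  moreover have "logb LF 32 (real m * real d *
      (sqrt (real n) * (4 * \<gamma> * (1 / B) ^ 3 * (1 / D)) * ?v * sqrt (4 * (const_L B \<gamma> / const_lambda B \<gamma>))))"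
    by (rule logb_weaken[OF log_factor_ge_1], (rule v logb_cond logb_rules | simp)+)
  ultimately have 2: "logb LF 32 (real m * real d / const_delta n B \<gamma> D)" by simp
  have "1 * 1 \<le> real m * real d" using m d by (intro mult_mono) auto
  hence ge: "1 \<le> real m * real d / const_delta n B \<gamma> D" using \<delta> by (simp add: le_divide_eq)
  have l0: "0 \<le> ln (real m * real d / const_delta n B \<gamma> D)" by (rule ln_ge_zero[OF ge])
  have "ln (real m * real d / const_delta n B \<gamma> D) / real d \<le> ln (real m * real d / const_delta n B \<gamma> D) / 1"
    using d l0 by (intro divide_left_mono) auto
  thus "mu_log \<le> 52 * LF" using 1 2 unfolding mu_log_def logb_def by linarith
  show "ln (1 + ?x) \<le> mu_log" unfolding mu_log_def using l0 by simp
qed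

text \<open>For B^2 > 4 \<gamma> one has M / L >= B / 5, and r >= 1 / sqrt(\<gamma>) with B >= 2
  sqrt(\<gamma>) gives r M / L >= 2/5. With sqrt(2 n) >= 7/5 the argument of the first logarithm is
  at least 3/2.\<close>

lemma mu_log_ge:
  assumes \<delta>: "0 < const_delta n B \<gamma> D" "const_delta n B \<gamma> D < 1" and big: "4 * \<gamma> < B\<^sup>2"
  shows "1 / 3 \<le> mu_log"
proof -
  let ?x = "const_r B \<gamma> * const_M B \<gamma> * sqrt (2 * real n) / const_L B \<gamma>"
  have x: "?x = const_r B \<gamma> * (B ^ 3 / 10 / (B\<^sup>2 / 4 + \<gamma>)) * sqrt (2 * real n)"
    unfolding M_over_L[symmetric] by simp
  have "B ^ 3 / 10 / (B\<^sup>2 / 2) \<le> B ^ 3 / 10 / (B\<^sup>2 / 4 + \<gamma>)"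
    using B \<gamma> big by (intro divide_left_mono) (auto intro!: mult_pos_pos add_pos_pos)
  hence mol: "B / 5 \<le> B ^ 3 / 10 / (B\<^sup>2 / 4 + \<gamma>)" using B by (simp add: power2_eq_square power3_eq_cube)
  have "sqrt (4 * \<gamma>) \<le> sqrt (B\<^sup>2)" using big by (intro real_sqrt_le_mono) simp
  hence Bg: "2 * sqrt \<gamma> \<le> B" using B by (simp add: real_sqrt_mult)
  have "(7 / 5)\<^sup>2 \<le> (2 * real n)" using n by (simp add: power2_eq_square)
  from real_sqrt_le_mono[OF this] have sn: "7 / 5 \<le> sqrt (2 * real n)" by simp
  have "1 / 2 \<le> sqrt (1 / \<gamma>) * (2 * sqrt \<gamma> / 5) * (7 / 5)"
    using \<gamma> by (simp add: real_sqrt_divide)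
  also have "\<dots> \<le> const_r B \<gamma> * (B ^ 3 / 10 / (B\<^sup>2 / 4 + \<gamma>)) * sqrt (2 * real n)"
    using const_r_bounds(1) order_trans[OF divide_right_mono[OF Bg, of 5] mol] sn \<gamma> B order_trans[OF _ const_r_bounds(1)]
    by (intro mult_mono mult_nonneg_nonneg) auto
  finally have "1 / 2 \<le> ?x" unfolding x .
  hence "ln (3 / 2) \<le> ln (1 + ?x)" by (intro ln_mono) auto
  moreover have "1 / 3 \<le> ln (3 / 2 :: real)" using ln_le_minus_one[of "2 / 3 :: real"] by (simp add: ln_div)
  ultimately show ?thesis using mu_log_le(2)[OF \<delta>] by linarith
qed

section \<open>Condition number in terms of the dimension ratio\<close>

abbreviation "dim_ratio \<equiv> B\<^sup>2 / \<gamma> * sqrt (d / n)"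

lemma sqrt_log_le: "0 \<le> x \<Longrightarrow> x \<le> 64 * LF \<Longrightarrow> sqrt x \<le> 8 * LF"
proof -
  assume x: "0 \<le> x" "x \<le> 64 * LF"
  have "64 * LF \<le> 64 * (LF * LF)" using mult_right_mono[of 1 LF LF] log_factor_ge_1 by simp
  with x have "x \<le> (8 * LF)\<^sup>2" by (simp add: power2_eq_square)
  thus ?thesis using log_factor_ge_1 by (intro real_le_lsqrt) auto
qed

text \<open>The grid error 4 / n is absorbed by 4 sqrt(d / n), and sqrt(C / 2) <= 8 LF; together 2 *
  8 + 4 = 20.\<close>

lemma hess_dev_ratio:
  fixes C :: real
  assumes C: "0 \<le> C" "C \<le> 57 * LF"
  shows "scale_eta B \<gamma> * (2 * (B\<^sup>2 * sqrt (d * C / (2 * n))) + 4 * B\<^sup>2 / n) \<le> const_lambda B \<gamma> * (20 * LF * dim_ratio)"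
proof -
  have dn: "1 / real n \<le> sqrt (d / n)"
  proof -
    have "1 \<le> real d * real n" using mult_mono[of 1 "real d" 1 "real n"] d n by simp
    hence "(1 / real n)\<^sup>2 \<le> d / n" using n by (simp add: power2_eq_square field_simps)
    from real_sqrt_le_mono[OF this] show ?thesis by simp
  qed
  have "sqrt (d * C / (2 * n)) = sqrt (d / n) * sqrt (C / 2)"
    by (simp flip: real_sqrt_mult)
  also have "sqrt (C / 2) \<le> 8 * LF" using C by (intro sqrt_log_le) auto
  finally have s: "sqrt (d * C / (2 * n)) \<le> sqrt (d / n) * (8 * LF)" by (simp add: mult_left_mono)
  have "2 * sqrt (d * C / (2 * n)) + 4 * (1 / n) \<le> 2 * (sqrt (d / n) * (8 * LF)) + 4 * (sqrt (d / n) * LF)"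
  proof -
    have "sqrt (d / n) * 1 \<le> sqrt (d / n) * LF" using log_factor_ge_1 by (intro mult_left_mono) auto
    with s dn show ?thesis by linarith
  qed
  also have "\<dots> = 20 * LF * sqrt (d / n)" by simp
  finally have "B\<^sup>2 * (2 * sqrt (d * C / (2 * n)) + 4 * (1 / n)) \<le> B\<^sup>2 * (20 * LF * sqrt (d / n))"
    by (intro mult_left_mono) auto
  from mult_left_mono[OF this less_imp_le[OF scale_eta_pos[OF B \<gamma>]]]
  show ?thesis using \<gamma> by (simp add: const_lambda_def distrib_left mult_ac)
qed

text \<open>
  The factor \<open>1 + \<Delta> / (\<lambda> + \<mu>)\<close> is harmless: if \<open>B\<^sup>2 \<le> 4 \<gamma>\<close> then already \<open>\<Delta> \<le> \<lambda>\<close>, and otherwise the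
  first logarithm in \<open>\<mu>\<close> is bounded below, so that \<open>\<mu>\<close> is \<open>L\<close> or at least \<open>3 L sqrt (d / n)\<close>.
\<close>

lemma cond_num_bound:
  fixes \<Delta> :: real
  defines "\<mu> \<equiv> const_mu d m n B \<gamma> D" and "lm \<equiv> const_lambda B \<gamma>" and "L \<equiv> const_L B \<gamma>"
  assumes \<delta>: "0 < const_delta n B \<gamma> D" "const_delta n B \<gamma> D < 1"
    and \<Delta>: "0 \<le> \<Delta>" "\<Delta> \<le> lm * (20 * LF * dim_ratio)" "\<Delta> \<le> L - lm"
  shows "sqrt ((1 + (\<Delta> + \<mu>) / lm) * (1 + \<Delta> / (lm + \<mu>))) \<le> 30 * LF * (1 + sqrt dim_ratio)"
proof -
  have lm: "0 < lm" using B \<gamma> by (simp add: lm_def const_lambda_eq)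
  have L: "L = lm * (1 + B\<^sup>2 / (4 * \<gamma>))"
    using cond_eq lm unfolding L_def lm_def by (simp add: field_simps)
  have Lp: "0 < L" unfolding L_def by (rule const_L_pos)
  note LF1 = log_factor_ge_1
  have r0: "0 \<le> dim_ratio" using B \<gamma> by simp
  have "0 \<le> ln (1 + const_r B \<gamma> * const_M B \<gamma> * sqrt (2 * real n) / const_L B \<gamma>)"
  proof -
    have "0 \<le> const_r B \<gamma>" using order_trans[OF _ const_r_bounds(1)] \<gamma> by simp
    moreover have "0 \<le> const_M B \<gamma>" using B \<gamma> by (simp add: const_M_def scale_eta_def)
    ultimately show ?thesis using Lp unfolding L_def by simp
  qed
  hence S0: "0 \<le> mu_log" using mu_log_le(2)[OF \<delta>] by linarith
  define t where "t = sqrt (32 * (d / n)) * sqrt mu_log"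
  have t0: "0 \<le> t" using S0 by (simp add: t_def)
  have \<mu>: "\<mu> = min L (L * t)"
  proof -
    have "sqrt (32 * L\<^sup>2 * d / n) = L * sqrt (32 * (d / n))"
      using Lp by (simp add: real_sqrt_mult real_sqrt_divide)
    thus ?thesis unfolding \<mu>_def const_mu_eq t_def L_def by (simp add: mult.assoc)
  qed
  have \<mu>0: "0 \<le> \<mu>" unfolding \<mu> using Lp t0 by simp
  have "sqrt mu_log \<le> 8 * LF" using S0 mu_log_le(1)[OF \<delta>] LF1 by (intro sqrt_log_le) auto
  hence t_le: "t \<le> 6 * sqrt (d / n) * (8 * LF)"
  proof -
    have "sqrt 32 \<le> sqrt ((6::real)\<^sup>2)" by (intro real_sqrt_le_mono) simp
    hence "sqrt (32 * (d / n)) \<le> 6 * sqrt (d / n)" unfolding real_sqrt_mult by (intro mult_right_mono) auto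
    thus ?thesis unfolding t_def using \<open>sqrt mu_log \<le> 8 * LF\<close> S0 by (intro mult_mono) auto
  qed
  \<comment> \<open>\<mu> equals lam (1 + B^2 / (4 \<gamma>)) min(1, t); thanks to the minimum with
    L the summand without B stays below lam even for large t.\<close>
  have "\<mu> / lm \<le> 1 + B\<^sup>2 / (4 * \<gamma>) * t"
  proof (cases "t \<le> 1")
    case True
    have "\<mu> / lm \<le> (L * t) / lm" unfolding \<mu> using lm by (intro divide_right_mono) auto
    also have "\<dots> = t + B\<^sup>2 / (4 * \<gamma>) * t" using lm by (simp add: L distrib_right)
    finally show ?thesis using True by simp
  next
    case False
    have "\<mu> / lm \<le> L / lm" unfolding \<mu> using lm by (intro divide_right_mono) auto
    also have "\<dots> = 1 + B\<^sup>2 / (4 * \<gamma>) * 1" using lm by (simp add: L)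
    also have "\<dots> \<le> 1 + B\<^sup>2 / (4 * \<gamma>) * t" using False \<gamma> by (intro add_left_mono mult_left_mono) auto
    finally show ?thesis .
  qed
  also have "B\<^sup>2 / (4 * \<gamma>) * t \<le> B\<^sup>2 / (4 * \<gamma>) * (6 * sqrt (d / n) * (8 * LF))"
    using t_le \<gamma> by (intro mult_left_mono) auto
  finally have mr: "\<mu> / lm \<le> 1 + 12 * LF * dim_ratio" by (simp add: mult_ac)
  have "\<Delta> / lm \<le> 20 * LF * dim_ratio" using \<Delta>(2) lm by (simp add: divide_le_eq mult.commute)
  hence "1 + (\<Delta> + \<mu>) / lm \<le> 2 + 32 * LF * dim_ratio" using mr by (simp add: add_divide_distrib)
  also have "\<dots> \<le> 32 * LF * (1 + dim_ratio)" using LF1 by (simp add: distrib_left)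
  finally have f1: "1 + (\<Delta> + \<mu>) / lm \<le> 32 * LF * (1 + dim_ratio)" .
  have f2: "1 + \<Delta> / (lm + \<mu>) \<le> 28 * LF"
  proof -
    have pos: "0 < lm + \<mu>" using lm \<mu>0 by simp
    have "\<Delta> \<le> 27 * LF * (lm + \<mu>)"
    proof (cases "B\<^sup>2 \<le> 4 * \<gamma>")
      case True
      have "L - lm = lm * (B\<^sup>2 / (4 * \<gamma>))" by (simp add: L distrib_left)
      also have "\<dots> \<le> lm * 1" using True lm \<gamma> by (intro mult_left_mono) auto
      finally have "\<Delta> \<le> 1 * (lm + \<mu>)" using \<Delta>(3) \<mu>0 by simp
      also have "\<dots> \<le> 27 * LF * (lm + \<mu>)" using LF1 pos by (intro mult_right_mono) auto
      finally show ?thesis .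
    next
      case False
      show ?thesis
      proof (cases "\<mu> = L")
        case True
        have "\<Delta> \<le> 1 * (lm + \<mu>)" using \<Delta>(3) lm True by simp
        also have "\<dots> \<le> 27 * LF * (lm + \<mu>)" using LF1 pos by (intro mult_right_mono) auto
        finally show ?thesis .
      next
        case mu: False
        hence mu_t: "\<mu> = L * t" unfolding \<mu> by (auto simp: min_def split: if_splits)
        have "3 * sqrt (d / n) \<le> t"
        proof -
          have "9 * (d / n) \<le> 32 * (d / n) * mu_log"
          proof -
            have "1 / 3 \<le> mu_log" using mu_log_ge[OF \<delta>] False by simp
            hence "32 * (d / n) * (1 / 3) \<le> 32 * (d / n) * mu_log" by (intro mult_left_mono) auto
            moreover have "9 * q \<le> 32 * q * (1 / 3)" if "0 \<le> q" for q :: real using that by simp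
            ultimately show ?thesis by (meson divide_nonneg_nonneg of_nat_0_le_iff order_trans)
          qed
          from real_sqrt_le_mono[OF this] have "sqrt 9 * sqrt (d / n) \<le> t"
            unfolding t_def by (simp only: real_sqrt_mult)
          moreover have "sqrt 9 = (3 :: real)" using real_sqrt_abs[of 3] by (simp add: power2_eq_square)
          ultimately show ?thesis by simp
        qed
        from mult_left_mono[OF this less_imp_le[OF Lp]]
        have mu_ge: "3 * (L * sqrt (d / n)) \<le> \<mu>" by (simp add: mu_t mult_ac)
        have "lm * (B\<^sup>2 / \<gamma>) \<le> 4 * L" unfolding L using lm \<gamma> by (simp add: field_simps)
        hence "lm * (B\<^sup>2 / \<gamma>) * (20 * LF * sqrt (d / n)) \<le> 4 * L * (20 * LF * sqrt (d / n))"
          using LF1 by (intro mult_right_mono) auto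
        hence "\<Delta> \<le> 80 * LF * (L * sqrt (d / n))" using \<Delta>(2) by (simp add: mult_ac)
        also have "\<dots> \<le> 80 * LF * (\<mu> / 3)" using mu_ge LF1 by (intro mult_left_mono) auto
        also have "\<dots> \<le> 27 * LF * \<mu>" using LF1 \<mu>0 by simp
        also have "\<dots> \<le> 27 * LF * (lm + \<mu>)" using LF1 lm by (intro mult_left_mono) auto
        finally show ?thesis .
      qed
    qed
    hence "\<Delta> / (lm + \<mu>) \<le> 27 * LF" using pos by (simp add: divide_le_eq)
    thus ?thesis using LF1 by simp
  qed
  have "(1 + (\<Delta> + \<mu>) / lm) * (1 + \<Delta> / (lm + \<mu>)) \<le> (32 * LF * (1 + dim_ratio)) * (28 * LF)"
    using f1 f2 LF1 r0 \<Delta>(1) \<mu>0 lm by (intro mult_mono) auto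
  \<comment> \<open>32 * 28 = 896 <= 900; the target is a square, so that the root is linear in the
    log factor.\<close>
  also have "\<dots> \<le> (30 * LF)\<^sup>2 * (1 + dim_ratio)"
  proof -
    have gen: "(32 * l * t) * (28 * l) \<le> (30 * l)\<^sup>2 * t" if "0 \<le> t" for l t :: real
    proof -
      have "896 * (l\<^sup>2 * t) \<le> 900 * (l\<^sup>2 * t)" using that by (intro mult_right_mono) auto
      thus ?thesis by (simp add: power2_eq_square mult_ac)
    qed
    show ?thesis by (rule gen) (use r0 in linarith)
  qed
  also have "\<dots> \<le> (30 * LF)\<^sup>2 * (1 + sqrt dim_ratio)\<^sup>2"
  proof (intro mult_left_mono)
    have "(sqrt dim_ratio)\<^sup>2 = dim_ratio" using r0 by simp
    thus "1 + dim_ratio \<le> (1 + sqrt dim_ratio)\<^sup>2" using r0 by (simp add: power2_sum)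
  qed auto
  also have "\<dots> = (30 * LF * (1 + sqrt dim_ratio))\<^sup>2" by (simp add: power_mult_distrib)
  finally have "sqrt ((1 + (\<Delta> + \<mu>) / lm) * (1 + \<Delta> / (lm + \<mu>))) \<le> sqrt ((30 * LF * (1 + sqrt dim_ratio))\<^sup>2)"
    by (rule real_sqrt_le_mono)
  thus ?thesis using LF1 r0 by simp
qed

end

subsection \<open>Expected number of rounds\<close>

context erm_sampling
begin

text \<open>Of the two log factors one comes from the root of the condition number, the other from
  the accuracy demanded of each conjugate gradient run.\<close>

lemma expected_rounds_le:
  fixes D \<epsilon> :: real
  assumes D: "D > 0" and eps: "\<epsilon> > 0"
    and \<delta>: "0 < const_delta n B \<gamma> D" "const_delta n B \<gamma> D < 1"
    and E: "(\<integral>\<^sup>+ z. ennreal ((vec_norm (erm_minimizer d m n B \<gamma> z))\<^sup>2) \<partial>M) \<le> ennreal (D\<^sup>2)"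
  shows "(\<lambda>z. ennreal_of_enat (comm_rounds d m n B \<gamma> D \<epsilon> z)) \<in> borel_measurable M"
    and "(\<integral>\<^sup>+ z. ennreal_of_enat (comm_rounds d m n B \<gamma> D \<epsilon> z) \<partial>M)
      \<le> ennreal (40000 * log_factor d m n B \<gamma> D ^ 2 * hidden_factor n B \<gamma> D * rounds_rate d n B \<gamma> D \<epsilon>)"
proof -
  define LF where "LF = log_factor d m n B \<gamma> D"
  define \<mu> where "\<mu> = const_mu d m n B \<gamma> D"
  define \<rho> where "\<rho> = const_rho n B \<gamma> D"
  define lm where "lm = const_lambda B \<gamma>"
  define L where "L = const_L B \<gamma>"
  define F0 where "F0 = const_F0 B \<gamma>"
  define R where "R = radius B \<gamma>"
  define pf where "pf = fail_prob B \<gamma>"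
  define logacc where "logacc = max 1 (ln (1 / \<epsilon>))"
  define a where "a = B\<^sup>2 / \<gamma> * sqrt (d / n)"
  define x where "x = B ^ 3 * D / (\<gamma> * sqrt n)"
  note params = d1 m1 n1 B0 \<gamma>0 D
  note pos = B0 \<gamma>0 D
  have LF: "1 \<le> LF" unfolding LF_def by (rule log_factor_ge_1[OF params])
  have lm: "0 < lm" using lam_pos by (simp add: lm_def)
  have G: "0 < const_G B \<gamma>" using scale_eta_pos[OF B0 \<gamma>0] B0 by (simp add: const_G_def)
  have \<rho>: "0 < \<rho>" using G D n1 by (simp add: \<rho>_def const_rho_def)
  have L: "0 < L" unfolding L_def by (rule const_L_pos[OF params])
  have R: "0 \<le> R" and pf: "0 < pf" "pf \<le> 1"
    unfolding R_def pf_def using radius_nonneg[OF params] fail_prob_bounds[OF params] by auto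
  have F0: "0 < F0" unfolding F0_def by (rule const_F0_bounds(1)[OF params])
  have M1: "1 \<le> logacc" by (simp add: logacc_def)
  have a: "0 \<le> a" using pos by (simp add: a_def)
  have x: "0 \<le> x" using pos by (simp add: x_def)
  have mu_log_nonneg: "0 \<le> mu_log d m n B \<gamma> D"
  proof -
    have "0 \<le> const_r B \<gamma> * const_M B \<gamma> * sqrt (2 * real n) / const_L B \<gamma>"
      using L scale_eta_pos[OF B0 \<gamma>0] pos order_trans[OF _ const_r_bounds(1)[OF params]]
      by (intro divide_nonneg_nonneg mult_nonneg_nonneg) (auto simp: L_def const_M_def)
    thus ?thesis using order_trans[OF _ mu_log_le(2)[OF params \<delta>]] by simp
  qed
  have \<mu>: "0 \<le> \<mu>" "\<mu> \<le> L"
    unfolding \<mu>_def L_def const_mu_eq[OF params] using L mu_log_nonneg by (auto simp: L_def)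
  show meas: "(\<lambda>z. ennreal_of_enat (comm_rounds d m n B \<gamma> D \<epsilon> z)) \<in> borel_measurable M"
    by (rule measurable_comm_rounds) (use \<mu> \<rho> in \<open>auto simp: \<mu>_def \<rho>_def\<close>)
  define bad where "bad = bad_event R pf"
  \<comment> \<open>Both bounds hold off the bad event, and each has its use in
    \<open>cond_num_bound\<close>: the first carries the dimension ratio, the second serves the
    cases B^2 <= 4 \<gamma> and \<mu> = L.\<close>
  define \<Delta> where "\<Delta> = min (hess_dev R pf) (L - lm)"
  have L_lm: "lm < L" using B0 \<gamma>0 by (simp add: L_def lm_def const_L_eq scale_eta_def)
  have hd: "0 \<le> hess_dev R pf" "hess_dev R pf \<le> lm * (20 * LF * a)"
  proof -
    show "0 \<le> hess_dev R pf"
      unfolding hess_dev_def[OF R pf] using scale_eta_pos[OF B0 \<gamma>0] tau_nonneg[OF R pf] by simp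
    have N1: "real (N1 R) \<le> radius B \<gamma> * B * n * d + 1"
      unfolding N1_def[OF R pf] R_def[symmetric]
      using R B0 by (simp add: of_nat_ceiling ceiling_le_iff)
    have "log_cover R pf \<le> 57 * LF"
      unfolding log_cover_def[OF R pf] unfolding LF_def pf_def
      by (rule log_cover_le[OF params N1]) (simp add: N2_def[OF R pf])
    from hess_dev_ratio[OF params log_cover_pos[OF R pf] this[unfolded LF_def]]
    show "hess_dev R pf \<le> lm * (20 * LF * a)"
      unfolding hess_dev_def[OF R pf] tau_def[OF R pf] lm_def LF_def a_def .
  qed
  have \<Delta>: "0 \<le> \<Delta>" "\<Delta> \<le> lm * (20 * LF * a)" "\<Delta> \<le> L - lm"
    using hd L_lm by (auto simp: \<Delta>_def)
  let ?\<kappa> = "\<lambda>\<Delta>. (1 + (\<Delta> + \<mu>) / lm) * (1 + \<Delta> / (lm + \<mu>))"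
  define q where "q = L / lm"
  have q: "1 \<le> q" unfolding q_def L_def lm_def by (rule cond_ge_1[OF params])
  have lnq: "0 \<le> ln q" "ln q \<le> 6 * LF"
    using q logb_cond[OF params] by (auto simp: q_def L_def lm_def LF_def logb_def)
  \<comment> \<open>\<open>A\<close> and \<open>A'\<close> bound the rounds per Newton step off and
    on the bad event. \<open>A\<close> collects 30 LF from the condition number and 7 + 2 ln q <= 19
    LF; \<open>A'\<close> is of order q up to one log factor.\<close>
  define A where "A = 2 + sqrt (?\<kappa> \<Delta>) * (7 + 2 * ln q)"
  define A' where "A' = 2 + sqrt (?\<kappa> (L - lm)) * (7 + 2 * ln q)"
  have A: "0 \<le> A" "A \<le> 572 * LF\<^sup>2 * (1 + sqrt a)"
  proof -
    have "0 \<le> ?\<kappa> \<Delta>" using \<Delta> \<mu> lm by simp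
    thus "0 \<le> A" unfolding A_def using lnq by simp
    have "sqrt (?\<kappa> \<Delta>) \<le> 30 * LF * (1 + sqrt a)"
      using cond_num_bound[OF params \<delta> \<Delta>(1)] \<Delta> unfolding \<mu>_def lm_def L_def LF_def a_def by blast
    hence "sqrt (?\<kappa> \<Delta>) * (7 + 2 * ln q) \<le> (30 * LF * (1 + sqrt a)) * (19 * LF)"
      using lnq LF a by (intro mult_mono) auto
    also have "\<dots> = 570 * LF\<^sup>2 * (1 + sqrt a)" by (simp add: power2_eq_square)
    finally have "A \<le> 2 * (1 * 1) + 570 * LF\<^sup>2 * (1 + sqrt a)" unfolding A_def by simp
    also have "2 * (1 * 1) \<le> 2 * (LF\<^sup>2 * (1 + sqrt a))"
      using LF a one_le_power[OF LF, of 2] by (intro mult_left_mono mult_mono) auto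
    finally show "A \<le> 572 * LF\<^sup>2 * (1 + sqrt a)" by (simp add: algebra_simps)
  qed
  have A': "0 \<le> A'" "A' \<le> q * (31 * LF)"
  proof -
    have k0: "0 \<le> ?\<kappa> (L - lm)" using L_lm \<mu> lm by simp
    thus "0 \<le> A'" unfolding A'_def using lnq by simp
    have "1 + (L - lm + \<mu>) / lm \<le> 2 * q"
      unfolding q_def using \<mu>(2) lm by (simp add: field_simps)
    moreover have "1 + (L - lm) / (lm + \<mu>) \<le> q"
    proof -
      have "(L - lm) / (lm + \<mu>) \<le> (L - lm) / lm" using L_lm lm \<mu> by (intro divide_left_mono) auto
      thus ?thesis unfolding q_def using lm by (simp add: diff_divide_distrib)
    qed
    ultimately have "?\<kappa> (L - lm) \<le> (2 * q) * q"
      using L_lm \<mu> lm q by (intro mult_mono) auto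
    also have "\<dots> \<le> (3 / 2 * q)\<^sup>2" using q by (simp add: power2_eq_square)
    finally have "sqrt (?\<kappa> (L - lm)) \<le> 3 / 2 * q" using q by (intro real_le_lsqrt) auto
    hence "sqrt (?\<kappa> (L - lm)) * (7 + 2 * ln q) \<le> 3 / 2 * q * (19 * LF)"
      using lnq LF q by (intro mult_mono) auto
    moreover have "2 * 1 \<le> 2 * (q * LF)" using mult_mono[of 1 q 1 LF] q LF by simp
    ultimately show "A' \<le> q * (31 * LF)" unfolding A'_def using mult_nonneg_nonneg[of q LF] q LF by (simp add: algebra_simps)
  qed
  define Kbad where "Kbad = (65 * F0 + 15 * logacc + 1) * A'"
  have Kbad: "0 \<le> Kbad" unfolding Kbad_def using F0 M1 A' by simp
  \<comment> \<open>A pointwise majorant, linear in the initial gap. On the bad event the gap is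
    replaced by its worst value F0, so that no joint behaviour of gap and bad event has to be
    controlled.\<close>
  define h where "h = (\<lambda>z. 1 + (65 * init_gap \<rho> z + 15 * logacc + 1) * A + Kbad * indicator bad z)"
  have rounds: "\<exists>N. comm_rounds d m n B \<gamma> D \<epsilon> z = enat N \<and> real N \<le> h z"
    if z: "z \<in> space M" and bd: "\<forall>ij\<in>I. norm (data_vec d (z ij)) \<le> B" for z
  proof -
    have bdd: "bounded_disco d m n B \<gamma> z \<mu> \<rho>"
      using bd \<mu> \<rho> bounded_disco_iff by (simp add: L_def)
    interpret S: bounded_disco d m n B \<gamma> z \<mu> \<rho> by (rule bdd)
    have gap: "S.gap 0 = init_gap \<rho> z" by (rule init_gap_eq[OF \<rho> bdd, symmetric])
    have gap0: "0 \<le> init_gap \<rho> z" "init_gap \<rho> z \<le> F0"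
      using S.gap_nonneg[of 0] S.gap_le_F0 unfolding gap F0_def by auto
    have cn: "S.cond_num \<Delta>' = ?\<kappa> \<Delta>'" for \<Delta>' by (simp add: S.cond_num_def lm_def)
    show ?thesis
    proof (cases "z \<in> bad")
      case False
      have "\<bar>inner y (lhess z 1 (emb (S.it k)) y) - inner y (fhess z (emb (S.it k)) y)\<bar> \<le> \<Delta> * (norm y)\<^sup>2" for k y
      proof -
        have w: "emb (S.it k) \<in> supported d" "norm (emb (S.it k)) \<le> R"
          using S.iterate_carrier S.iterate_norm by (auto simp: R_def radius_def[OF params])
        from hessian_concentration[OF R pf z _ bd w, of y] S.crude_diff[of y "emb (S.it k)"] False
        show ?thesis unfolding bad_def \<Delta>_def L_def lm_def by (simp add: min_def)
      qed
      from S.total_rounds_le[OF eps \<Delta>(1) this] obtain N where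
        N: "disco_total_rounds d m (local_loss d n B \<gamma> z) lm L \<rho> \<mu> \<epsilon> = enat N"
        "real N \<le> 1 + (65 * init_gap \<rho> z + 15 * logacc + 1) * A"
        unfolding gap cn logacc_def[symmetric] A_def q_def lm_def L_def by auto
      moreover have "h z = 1 + (65 * init_gap \<rho> z + 15 * logacc + 1) * A"
        using False by (simp add: h_def)
      ultimately show ?thesis unfolding comm_rounds_def lm_def L_def \<rho>_def \<mu>_def by auto
    next
      case True
      have "0 \<le> L - lm" using L_lm by simp
      from S.total_rounds_le[OF eps this[unfolded L_def lm_def] S.crude_diff] obtain N where
        N: "disco_total_rounds d m (local_loss d n B \<gamma> z) lm L \<rho> \<mu> \<epsilon> = enat N"
        "real N \<le> 1 + (65 * init_gap \<rho> z + 15 * logacc + 1) * A'"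
        unfolding gap cn logacc_def[symmetric] A'_def q_def lm_def L_def by auto
      have "(65 * init_gap \<rho> z + 15 * logacc + 1) * A' \<le> Kbad"
        unfolding Kbad_def using gap0 A' by (intro mult_right_mono) auto
      moreover have "0 \<le> (65 * init_gap \<rho> z + 15 * logacc + 1) * A"
        using gap0 M1 A by simp
      ultimately have "real N \<le> h z" using N(2) True by (simp add: h_def)
      thus ?thesis using N(1) unfolding comm_rounds_def lm_def L_def \<rho>_def \<mu>_def by auto
    qed
  qed
  have bad: "bad \<in> sets M" unfolding bad_def by (rule bad_event_sets[OF R pf])
  have AEh: "AE z in M. ennreal_of_enat (comm_rounds d m n B \<gamma> D \<epsilon> z) \<le> ennreal (h z) \<and> 0 \<le> h z"
    using AE_bounded
  proof (rule AE_mp, intro AE_I2 impI)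
    fix z assume "z \<in> space M" "\<forall>ij\<in>I. norm (data_vec d (z ij)) \<le> B"
    from rounds[OF this] obtain N where N: "comm_rounds d m n B \<gamma> D \<epsilon> z = enat N" "real N \<le> h z" by blast
    thus "ennreal_of_enat (comm_rounds d m n B \<gamma> D \<epsilon> z) \<le> ennreal (h z) \<and> 0 \<le> h z"
      by (simp add: ennreal_of_nat_eq_real_of_nat)
  qed
  note ig = integrable_init_gap[OF \<rho>]
  have i1: "integrable M (\<lambda>z. 1 + (65 * init_gap \<rho> z + 15 * logacc + 1) * A)"
    by (intro Bochner_Integration.integrable_add integrable_mult_left integrable_mult_right ig integrable_const)
  have i2: "integrable M (\<lambda>z. Kbad * indicator bad z)"
    by (intro integrable_mult_right integrable_real_indicator bad) (simp add: emeasure_eq_measure)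
  have ih: "integrable M h" unfolding h_def by (rule Bochner_Integration.integrable_add[OF i1 i2])
  have Eh: "expectation h = 1 + (65 * expectation (init_gap \<rho>) + 15 * logacc + 1) * A + Kbad * prob bad"
  proof -
    have "expectation h = expectation (\<lambda>z. 1 + (65 * init_gap \<rho> z + 15 * logacc + 1) * A) + expectation (\<lambda>z. Kbad * indicator bad z)"
      unfolding h_def by (rule Bochner_Integration.integral_add[OF i1 i2])
    moreover have "expectation (\<lambda>z. Kbad * indicator bad z) = Kbad * prob bad" using bad by simp
    moreover have "expectation (\<lambda>z. 1 + (65 * init_gap \<rho> z + 15 * logacc + 1) * A) = expectation (\<lambda>z. (65 * A) * init_gap \<rho> z + (1 + (15 * logacc + 1) * A))"
      by (simp add: algebra_simps)
    moreover have "\<dots> = (65 * A) * expectation (init_gap \<rho>) + (1 + (15 * logacc + 1) * A)"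
      using ig by (simp add: prob_space)
    ultimately show ?thesis by (simp add: algebra_simps)
  qed
  \<comment> \<open>With \<rho> = s G / (sqrt(n) D) and s = sqrt 6 the bound is (s / 2 + 2 / s) G D
    / sqrt(n). This is at most 4 G D / sqrt(n), which equals x because G = B^3 / (4
    \<gamma>).\<close>
  have Eg: "expectation (init_gap \<rho>) \<le> x"
  proof -
    define s where "s = sqrt (6 :: real)"
    define g where "g = const_G B \<gamma>"
    have s: "2 \<le> s" "s \<le> 5 / 2" "s * s = 6"
      using real_le_rsqrt[of 2 6] real_le_lsqrt[of "5/2" 6] by (simp_all add: s_def power2_eq_square)
    define k where "k = sqrt (real n)"
    have k: "0 < k" "real n = k * k" using n1 by (simp_all add: k_def)
    have \<rho>_eq: "\<rho> = s * g / (k * D)" by (simp add: \<rho>_def const_rho_def s_def g_def k_def)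
    have "expectation (init_gap \<rho>) \<le> \<rho> / 2 * D\<^sup>2 + 2 * g\<^sup>2 / (n * \<rho>)"
      unfolding g_def by (rule expectation_init_gap[OF \<rho> E])
    also have "\<rho> / 2 * D\<^sup>2 = s / 2 * (g * D / k)"
      using D by (simp add: \<rho>_eq power2_eq_square)
    also have "2 * g\<^sup>2 / (n * \<rho>) = 2 / s * (g * D / k)"
      using D k s G by (simp add: \<rho>_eq power2_eq_square g_def)
    also have "s / 2 * (g * D / k) + 2 / s * (g * D / k) = (s / 2 + 2 / s) * (g * D / k)"
      by (rule distrib_right[symmetric])
    also have "\<dots> \<le> 4 * (g * D / k)"
    proof (intro mult_right_mono)
      have "2 / s \<le> 1" using s by simp
      thus "s / 2 + 2 / s \<le> 4" using s(2) by linarith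
    qed (use G D k in \<open>simp add: g_def\<close>)
    also have "\<dots> = x" using \<gamma>0 by (simp add: x_def g_def k_def const_G_eq[OF params])
    finally show ?thesis .
  qed
  \<comment> \<open>\<open>pf\<close> was chosen as 1 / (q (1 + F0)), which cancels both large
    factors; 2511 = 81 * 31.\<close>
  have badterm: "Kbad * prob bad \<le> 2511 * LF * logacc"
  proof -
    have "prob bad \<le> pf" unfolding bad_def by (rule bad_event_prob[OF R pf])
    hence "Kbad * prob bad \<le> Kbad * pf" using Kbad by (intro mult_left_mono)
    also have "\<dots> \<le> ((81 * logacc * (1 + F0)) * (q * (31 * LF))) * pf"
    proof (intro mult_right_mono)
      have "F0 * 1 \<le> F0 * logacc" using F0 M1 by (intro mult_left_mono) auto
      moreover have "81 * logacc * (1 + F0) = 81 * logacc + 81 * (F0 * logacc)" by (simp add: algebra_simps)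
      ultimately have "65 * F0 + 15 * logacc + 1 \<le> 81 * logacc * (1 + F0)" using M1 F0 by linarith
      thus "Kbad \<le> (81 * logacc * (1 + F0)) * (q * (31 * LF))"
        unfolding Kbad_def using A' F0 M1 by (intro mult_mono) auto
    qed (use pf in simp)
    also have "\<dots> = 2511 * LF * logacc * ((q * (1 + F0)) * pf)" by simp
    also have "(q * (1 + F0)) * pf = 1"
      using L lm F0 unfolding pf_def fail_prob_def[OF params] q_def L_def lm_def F0_def by simp
    finally show ?thesis by simp
  qed
  have "expectation h \<le> 40000 * LF\<^sup>2 * ((logacc + x) * (1 + sqrt a))"
  proof -
    let ?y = "1 + sqrt a"
    have y: "1 \<le> ?y" using a by simp
    have LL: "1 \<le> LF\<^sup>2" "LF \<le> LF\<^sup>2" using LF one_le_power[OF LF, of 2] mult_left_mono[of 1 LF LF] by (auto simp: power2_eq_square)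
    let ?P = "LF\<^sup>2 * ((logacc + x) * ?y)"
    have m: "logacc \<le> (logacc + x) * ?y" using mult_mono[of logacc "logacc + x" 1 ?y] y x M1 by simp
    have one: "1 \<le> ?P" using mult_mono[OF LL(1) order_trans[OF M1 m]] by simp
    have "LF * logacc \<le> ?P" using mult_mono[OF LL(2) m] LF M1 by simp
    hence 2: "2511 * LF * logacc \<le> 2511 * ?P" by simp
    have "(65 * expectation (init_gap \<rho>) + 15 * logacc + 1) * A \<le> (65 * (logacc + x)) * (572 * LF\<^sup>2 * ?y)"
      using Eg A M1 x by (intro mult_mono) auto
    also have "\<dots> = 37180 * ?P" by (simp add: algebra_simps)
    \<comment> \<open>37180 = 65 * 572, and 1 + 37180 + 2511 stays below 40000.\<close>
    finally have "expectation h \<le> 1 + 37180 * ?P + 2511 * ?P"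
      unfolding Eh using badterm 2 by linarith
    also have "\<dots> \<le> 40000 * ?P" using one by linarith
    finally show ?thesis by (simp only: mult.assoc)
  qed
  also have "\<dots> \<le> 40000 * LF\<^sup>2 * hidden_factor n B \<gamma> D * ((logacc + x) * (1 + sqrt a))"
  proof -
    have "0 \<le> 4 * const_V0 B \<gamma> + 2 * (const_G B \<gamma>)\<^sup>2 / const_lambda B \<gamma>"
      using scale_eta_pos[OF B0 \<gamma>0] lam_pos by (simp add: const_V0_def)
    hence "1 \<le> hidden_factor n B \<gamma> D" unfolding hidden_factor_def using G D by simp
    hence "40000 * LF\<^sup>2 * 1 \<le> 40000 * LF\<^sup>2 * hidden_factor n B \<gamma> D" by (intro mult_left_mono) auto
    thus ?thesis using x M1 a by (intro mult_right_mono) auto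
  qed
  also have "(logacc + x) * (1 + sqrt a) = rounds_rate d n B \<gamma> D \<epsilon>"
  proof -
    have "sqrt a = B * real d powr (1 / 4) / (\<gamma> powr (1 / 2) * real n powr (1 / 4))"
    proof -
      have q4: "sqrt (sqrt t) = t powr (1 / 4)" if "t > 0" for t :: real
        using that by (simp add: powr_half_sqrt[symmetric] powr_powr)
      have "sqrt a = B / sqrt \<gamma> * (sqrt (sqrt (real d)) / sqrt (sqrt (real n)))"
        using B0 by (simp add: a_def real_sqrt_mult real_sqrt_divide)
      also have "\<dots> = B / \<gamma> powr (1 / 2) * (real d powr (1 / 4) / real n powr (1 / 4))"
        using d1 n1 \<gamma>0 by (simp add: q4 powr_half_sqrt)
      finally show ?thesis by simp
    qed
    moreover have "x = B ^ 3 * D / (\<gamma> * real n powr (1 / 2))" using n1 by (simp add: x_def powr_half_sqrt)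
    ultimately show ?thesis by (simp add: rounds_rate_def logacc_def)
  qed
  finally have final: "expectation h \<le> 40000 * LF\<^sup>2 * hidden_factor n B \<gamma> D * rounds_rate d n B \<gamma> D \<epsilon>" .
  have "(\<integral>\<^sup>+ z. ennreal_of_enat (comm_rounds d m n B \<gamma> D \<epsilon> z) \<partial>M) \<le> (\<integral>\<^sup>+ z. ennreal (h z) \<partial>M)"
    by (rule nn_integral_mono_AE) (use AEh in auto)
  also have "\<dots> = ennreal (expectation h)"
    by (rule nn_integral_eq_integral[OF ih]) (use AEh in auto)
  also have "\<dots> \<le> ennreal (40000 * LF\<^sup>2 * hidden_factor n B \<gamma> D * rounds_rate d n B \<gamma> D \<epsilon>)"
    by (rule ennreal_leI[OF final])
  finally show "(\<integral>\<^sup>+ z. ennreal_of_enat (comm_rounds d m n B \<gamma> D \<epsilon> z) \<partial>M)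
      \<le> ennreal (40000 * log_factor d m n B \<gamma> D ^ 2 * hidden_factor n B \<gamma> D * rounds_rate d n B \<gamma> D \<epsilon>)"
    unfolding LF_def .
qed

end

theorem corollary5:
  shows "\<exists>(C :: real) (p :: nat). C > 0 \<and>
    (\<forall>(d :: nat) (m :: nat) (n :: nat) (B :: real) (\<gamma> :: real) (D :: real) (\<epsilon> :: real)
      (X :: real vec set) (Q :: sample measure).
      d \<ge> 1 \<longrightarrow> m \<ge> 1 \<longrightarrow> n \<ge> 1 \<longrightarrow> B > 0 \<longrightarrow> \<gamma> > 0 \<longrightarrow> D > 0 \<longrightarrow> \<epsilon> > 0 \<longrightarrow>
      X \<subseteq> carrier_vec d \<longrightarrow> (\<forall>x\<in>X. vec_norm x \<le> B) \<longrightarrow>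
      prob_space Q \<longrightarrow> sets Q = sets (sample_space d) \<longrightarrow>
      (AE s in Q. feature d s \<in> X \<and> label s \<in> {-1, 1}) \<longrightarrow>
      (\<integral>\<^sup>+ z. ennreal ((vec_norm (erm_minimizer d m n B \<gamma> z))\<^sup>2) \<partial>data_measure m n Q)
        \<le> ennreal (D\<^sup>2) \<longrightarrow>
      0 < const_delta n B \<gamma> D \<longrightarrow> const_delta n B \<gamma> D < 1 \<longrightarrow>
      (\<lambda>z. ennreal_of_enat (comm_rounds d m n B \<gamma> D \<epsilon> z))
        \<in> borel_measurable (data_measure m n Q) \<and>
      (\<integral>\<^sup>+ z. ennreal_of_enat (comm_rounds d m n B \<gamma> D \<epsilon> z) \<partial>data_measure m n Q)
        \<le> ennreal (C * log_factor d m n B \<gamma> D ^ p * hidden_factor n B \<gamma> D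
                     * rounds_rate d n B \<gamma> D \<epsilon>))"
proof (intro exI conjI allI impI)
  \<comment> \<open>The witnesses are fixed by unification: C by this goal, and the exponent p = 2
    by the last one.\<close>
  show "(0 :: real) < 40000" by simp
next
  fix d m n :: nat and B \<gamma> D \<epsilon> :: real and X :: "real vec set" and Q :: "sample measure"
  assume a: "d \<ge> 1" "m \<ge> 1" "n \<ge> 1" "B > 0" "\<gamma> > 0" "D > 0" "\<epsilon> > 0"
    "\<forall>x\<in>X. vec_norm x \<le> B" "prob_space Q" "sets Q = sets (sample_space d)"
    "AE s in Q. feature d s \<in> X \<and> label s \<in> {-1, 1}"
    and E: "(\<integral>\<^sup>+ z. ennreal ((vec_norm (erm_minimizer d m n B \<gamma> z))\<^sup>2) \<partial>data_measure m n Q) \<le> ennreal (D\<^sup>2)"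
    and \<delta>: "0 < const_delta n B \<gamma> D" "const_delta n B \<gamma> D < 1"
  interpret erm_sampling d m n B \<gamma> X Q
    by (rule erm_sampling.intro) (use a in auto)
  note main = expected_rounds_le[OF a(6,7) \<delta> E]
  show "(\<lambda>z. ennreal_of_enat (comm_rounds d m n B \<gamma> D \<epsilon> z)) \<in> borel_measurable (data_measure m n Q)"
    by (rule main(1))
  show "(\<integral>\<^sup>+ z. ennreal_of_enat (comm_rounds d m n B \<gamma> D \<epsilon> z) \<partial>data_measure m n Q)
      \<le> ennreal (40000 * log_factor d m n B \<gamma> D ^ 2 * hidden_factor n B \<gamma> D * rounds_rate d n B \<gamma> D \<epsilon>)"
    by (rule main(2))
qed

end
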